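(* Let $M$ be a closed oriented $2$-dimensional smooth manifold, let $f\colon M\to\mathbf{R}^3$ be a smooth ($C^\infty$) immersion, and let $n\colon M\to\mathbf{S}^2$ be the Gauss map induced by $f$. For $u\in\mathbf{S}^2$ let $S_u:=\{p\in M : \langle n(p),u\rangle>0\}$. If $M$ is homeomorphic to the sphere $\mathbf{S}^2$ and, for every $u\in\mathbf{S}^2$, $S_u$ is connected, then $f$ is a convex embedding.
   Context: $\mathbf{S}^2$ is the unit sphere in $\mathbf{R}^3$ and $\langle\cdot,\cdot\rangle$ is the standard inner product. Closed means compact without boundary. The Gauss map induced by $f$ is a smooth unit normal vector field along $f$, i.e. a smooth map $n\colon M\to\mathbf{S}^2$ with $n(p)$ orthogonal to $f_*(T_pM)$ for all $p$; it exists since $M$ is oriented. $S_u$ is called the shadow in the direction $u$. The immersion $f$ is a convex embedding if $f$ maps $M$ homeomorphically onto the boundary of a convex body (a compact convex subset of $\mathbf{R}^3$ with nonempty interior). *)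

theory Defs
  imports "HOL-Analysis.Analysis"
begin

text \<open>Derivatives are taken with respect to the full neighbourhood filter of a point,
  so these two notions are meant for an open set \<open>S\<close> only; every use below is of this kind.
  The values of \<open>f\<close> outside \<open>S\<close> are then irrelevant.\<close>

primrec higher_differentiable_on ::
    "'a::real_normed_vector set \<Rightarrow> ('a \<Rightarrow> 'b::real_normed_vector) \<Rightarrow> nat \<Rightarrow> bool" where
  "higher_differentiable_on S f 0 \<longleftrightarrow> continuous_on S f"
| "higher_differentiable_on S f (Suc k) \<longleftrightarrow>
     (\<forall>x\<in>S. f differentiable (at x)) \<and>
     (\<forall>v. higher_differentiable_on S (\<lambda>x. frechet_derivative f (at x) v) k)"

definition smooth_on ::
    "'a::real_normed_vector set \<Rightarrow> ('a \<Rightarrow> 'b::real_normed_vector) \<Rightarrow> bool" where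
  "smooth_on S f \<longleftrightarrow> (\<forall>k. higher_differentiable_on S f k)"

text \<open>A chart is a pair of its domain \<open>U\<close> and a coordinate map \<open>\<phi>\<close>, of which only
  the values on \<open>U\<close> matter. Its inverse is \<open>inv_into U \<phi>\<close>.\<close>

type_synonym ('a, 'n) chart = "'a set \<times> ('a \<Rightarrow> real ^ 'n)"

definition chart_on :: "'a topology \<Rightarrow> ('a, 'n::finite) chart \<Rightarrow> bool" where
  "chart_on X = (\<lambda>(U, \<phi>). openin X U \<and> open (\<phi> ` U) \<and>
     homeomorphic_map (subtopology X U) (top_of_set (\<phi> ` U)) \<phi>)"

definition smooth_atlas :: "'a topology \<Rightarrow> ('a, 'n::finite) chart set \<Rightarrow> bool" where
  "smooth_atlas X \<A> \<longleftrightarrow>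
     (\<forall>c\<in>\<A>. chart_on X c) \<and>
     (\<Union>(U, \<phi>)\<in>\<A>. U) = topspace X \<and>
     (\<forall>(U, \<phi>)\<in>\<A>. \<forall>(V, \<psi>)\<in>\<A>. smooth_on (\<phi> ` (U \<inter> V)) (\<psi> \<circ> inv_into U \<phi>))"

text \<open>An orientation is carried by the atlas: all transition maps have positive Jacobian
  determinant. The atlas is not required to be maximal; the notions of smoothness, immersion
  and tangent plane below are the same for any atlas of the same smooth structure.\<close>

definition oriented_atlas :: "'a topology \<Rightarrow> ('a, 'n::finite) chart set \<Rightarrow> bool" where
  "oriented_atlas X \<A> \<longleftrightarrow> smooth_atlas X \<A> \<and>
     (\<forall>(U, \<phi>)\<in>\<A>. \<forall>(V, \<psi>)\<in>\<A>. \<forall>x\<in>\<phi> ` (U \<inter> V).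
        det (matrix (frechet_derivative (\<psi> \<circ> inv_into U \<phi>) (at x))) > 0)"

text \<open>The absence of boundary is built into the charts, whose images are open in \<open>real ^ 'n\<close>.\<close>

definition closed_oriented_manifold :: "'a topology \<Rightarrow> ('a, 'n::finite) chart set \<Rightarrow> bool" where
  "closed_oriented_manifold X \<A> \<longleftrightarrow>
     Hausdorff_space X \<and> second_countable X \<and> compact_space X \<and> oriented_atlas X \<A>"

definition smooth_map ::
    "('a, 'n::finite) chart set \<Rightarrow> ('a \<Rightarrow> 'b::real_normed_vector) \<Rightarrow> bool" where
  "smooth_map \<A> f \<longleftrightarrow> (\<forall>(U, \<phi>)\<in>\<A>. smooth_on (\<phi> ` U) (f \<circ> inv_into U \<phi>))"

definition smooth_immersion ::
    "('a, 'n::finite) chart set \<Rightarrow> ('a \<Rightarrow> 'b::real_normed_vector) \<Rightarrow> bool" where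
  "smooth_immersion \<A> f \<longleftrightarrow> smooth_map \<A> f \<and>
     (\<forall>(U, \<phi>)\<in>\<A>. \<forall>x\<in>\<phi> ` U. inj (frechet_derivative (f \<circ> inv_into U \<phi>) (at x)))"

text \<open>The image of the tangent space at \<open>p\<close> under the differential of \<open>f\<close>. By the chain rule
  every chart around \<open>p\<close> yields the same subspace, so that the union over all such charts
  is that subspace.\<close>

definition tangent_image ::
    "('a, 'n::finite) chart set \<Rightarrow> ('a \<Rightarrow> 'b::real_normed_vector) \<Rightarrow> 'a \<Rightarrow> 'b set" where
  "tangent_image \<A> f p =
     {frechet_derivative (f \<circ> inv_into U \<phi>) (at (\<phi> p)) v | U \<phi> v. (U, \<phi>) \<in> \<A> \<and> p \<in> U}"

text \<open>Smoothness into the unit sphere is smoothness into the ambient space together with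
  unit length, the sphere being an embedded submanifold. The sign of the normal
  is left open: both choices are Gauss maps.\<close>

definition gauss_map ::
    "'a topology \<Rightarrow> ('a, 2) chart set \<Rightarrow> ('a \<Rightarrow> real ^ 3) \<Rightarrow> ('a \<Rightarrow> real ^ 3) \<Rightarrow> bool" where
  "gauss_map X \<A> f n \<longleftrightarrow> smooth_map \<A> n \<and>
     (\<forall>p\<in>topspace X. n p \<in> sphere 0 1 \<and> (\<forall>w\<in>tangent_image \<A> f p. orthogonal (n p) w))"

definition shadow :: "'a topology \<Rightarrow> ('a \<Rightarrow> real ^ 3) \<Rightarrow> real ^ 3 \<Rightarrow> 'a set" where
  "shadow X n u = {p \<in> topspace X. n p \<bullet> u > 0}"

definition convex_body :: "'a::euclidean_space set \<Rightarrow> bool" where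
  "convex_body K \<longleftrightarrow> compact K \<and> convex K \<and> interior K \<noteq> {}"

definition convex_embedding :: "'a topology \<Rightarrow> ('a \<Rightarrow> real ^ 3) \<Rightarrow> bool" where
  "convex_embedding X f \<longleftrightarrow>
     (\<exists>K. convex_body K \<and> homeomorphic_map X (top_of_set (frontier K)) f)"

end

theory Submission
  imports Defs
begin

text \<open>
  Transport everything to the unit sphere \<open>S\<close> and write \<open>h\<^sub>u\<close> for the height function
  \<open>f \<bullet> u\<close>. Its critical points are the points with \<open>n = u\<close> or \<open>n = - u\<close>.
  The heart of the matter is purely topological: connectedness of all preimages under \<open>n\<close> of open
  hemispheres forces the fibres of \<open>n\<close> to be connected. One passes from hemispheres to lunes,
  then to triangles and finally to points, using Janiszewski's theorem and its dual to trade
  connectedness of an open set for connectedness of the opposite closed set. For lunes with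
  fixed corners, open and closed lunes are connected at the same time, and these properties are
  stable under increasing and decreasing limits respectively; this lets one decrease the angle of a lune from
  \<open>\<pi>\<close>, provided that the lunes have finitely many components, which Sard's theorem gives
  for almost all corners.

  By a Sard type argument \<open>h\<^sub>u\<close> is constant on connected sets of critical points,
  hence on the fibres over \<open>u\<close> and \<open>- u\<close>. So every critical point is a global
  extremum and every tangent plane supports the convex hull of the image. Therefore
  \<open>f\<close> maps \<open>S\<close> locally injectively, hence by a local homeomorphism, into the
  frontier of the hull, which is again a sphere. It is onto, and it is injective because the
  number of preimages is one at a point farthest from the origin.
\<close>

section \<open>Janiszewski's theorems on the sphere\<close>

text \<open>Nothing is known at the outset about the fibres of \<open>n\<close>, so a lune may have
  infinitely many components. Each of them must cross an intermediate half circle, so they can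
  accumulate only over the two corners; this obstacle is why corners are first taken generic, where
  \<open>n\<close> is locally injective. General corners are recovered because a separation of a
  closed lune survives small tilts of its two half spaces, which leaves room to move the corners.

  Besides genericity, the immersion enters the topology through one fact: the preimage of a pair of
  antipodes is disconnected. Otherwise a height function would be constant on a connected set
  containing its maximum and its minimum, and the surface would lie in a plane. This makes all
  shadows nonempty, as the dual of Janiszewski's theorem requires.

  The sign of \<open>n\<close> at an extremum is never determined, so supporting half spaces are
  obtained on one side or the other.\<close>

abbreviation (input) S2 :: "(real^3) set" where "S2 \<equiv> sphere 0 1"

lemma punctured_sphere_homeomorphism:
  assumes "z \<in> S2"
  obtains h k where "homeomorphism (S2 - {z}) (UNIV :: complex set) h k"
    "continuous_on (S2 - {z}) h" "inj_on h (S2 - {z})" "h ` (S2 - {z}) = UNIV"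
    "continuous_on UNIV k" "\<And>x. x \<in> S2 - {z} \<Longrightarrow> k (h x) = x"
proof -
  have "(S2 - {z}) homeomorphic (UNIV :: complex set)"
    using assms by (intro homeomorphic_punctured_sphere_affine) auto
  then obtain h k where hk: "homeomorphism (S2 - {z}) (UNIV :: complex set) h k"
    unfolding homeomorphic_def by blast
  show thesis
  proof (rule that[OF hk])
    show "continuous_on (S2 - {z}) h" "h ` (S2 - {z}) = UNIV" "continuous_on UNIV k"
      using hk by (simp_all add: homeomorphism_def)
    show *: "k (h x) = x" if "x \<in> S2 - {z}" for x
      using homeomorphism_apply1[OF hk that] .
    show "inj_on h (S2 - {z})"
      using * by (metis inj_onI)
  qed
qed

text \<open>A point missing from \<open>V\<close> serves as the centre of a stereographic
  projection, which reduces the claim to open subsets of the plane. The whole sphere leaves no such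
  point, but once punctured it is itself a copy of the plane.\<close>

lemma connected_openin_sphere_delete:
  assumes "openin (top_of_set S2) V" "connected V"
  shows "connected (V - {z})"
proof (cases "V = S2")
  case True
  show ?thesis
  proof (cases "z \<in> S2")
    case True
    with \<open>V = S2\<close> obtain h k where "homeomorphism (V - {z}) (UNIV :: complex set) h k"
      using punctured_sphere_homeomorphism by metis
    then show ?thesis
      by (metis connected_UNIV connected_continuous_image homeomorphism_def)
  qed (use assms True in auto)
next
  case False
  have "V \<subseteq> S2" using assms(1) openin_imp_subset by blast
  with False obtain y where y: "y \<in> S2" "y \<notin> V" by blast
  then obtain h k where hk: "homeomorphism (S2 - {y}) (UNIV :: complex set) h k"
    using punctured_sphere_homeomorphism by metis
  have V: "V \<subseteq> S2 - {y}" using \<open>V \<subseteq> S2\<close> y by blast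
  have hV: "homeomorphism V (h ` V) h k"
    using hk V by (meson homeomorphism_of_subsets subset_refl subset_UNIV)
  have "openin (top_of_set (S2 - {y})) V"
    using assms(1) V openin_subset_trans by (metis Diff_subset)
  then have "open (h ` V)"
    using homeomorphism_imp_open_map[OF hk] by auto
  moreover have "connected (h ` V)"
    using hV assms(2) by (metis connected_continuous_image homeomorphism_def)
  ultimately have "connected (h ` V - h ` {z})"
    by (simp add: connected_open_delete)
  then have c: "connected (k ` (h ` V - h ` {z}))"
    using hV by (metis Diff_subset connected_continuous_image continuous_on_subset homeomorphism_def)
  have kh: "k (h x) = x" if "x \<in> V" for x
    using hV that by (simp add: homeomorphism_def)
  show ?thesis
  proof (cases "z \<in> V")
    case True
    have "k ` (h ` V - h ` {z}) = V - {z}"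
    proof -
      have "inj_on h V" using kh by (metis inj_onI)
      then have "h ` V - h ` {z} = h ` (V - {z})"
        using True by (simp add: inj_on_image_set_diff[of h V])
      then show ?thesis using kh by (force simp: image_image)
    qed
    then show ?thesis using c by simp
  qed (use assms in auto)
qed

lemma sphere_in_closure_delete:
  assumes "openin (top_of_set S2) V" "z \<in> V"
  shows "z \<in> closure (V - {z})"
proof -
  have "z \<in> S2" using assms openin_imp_subset by blast
  have "connected S2" by (simp add: connected_sphere)
  moreover have "- z \<in> S2" using \<open>z \<in> S2\<close> by simp
  moreover have "z \<noteq> 0" using \<open>z \<in> S2\<close> by auto
  then have "- z \<noteq> z" by (simp add: vec_eq_iff)
  ultimately have "S2 \<noteq> {x}" for x
    using \<open>z \<in> S2\<close> by (metis singletonD)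
  then have "z islimpt S2"
    using connected_imp_perfect \<open>connected S2\<close> \<open>z \<in> S2\<close> by blast
  obtain T where "open T" "V = S2 \<inter> T" using assms(1) by (auto simp: openin_open)
  have "z islimpt V"
  proof (rule islimptI)
    fix W assume "z \<in> W" "open W"
    with \<open>open T\<close> \<open>V = S2 \<inter> T\<close> assms(2) have "z \<in> W \<inter> T" "open (W \<inter> T)" by auto
    then show "\<exists>y\<in>V. y \<in> W \<and> y \<noteq> z"
      using \<open>z islimpt S2\<close> \<open>V = S2 \<inter> T\<close> by (meson IntD1 IntD2 IntI islimptE)
  qed
  then show ?thesis by (simp add: islimpt_in_closure)
qed

text \<open>Project from a point \<open>z\<close> of the complement and use the planar theorem. The
  open complements lose \<open>z\<close> on the way to the plane, which keeps them connected; on the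
  way back \<open>z\<close> is adjoined as a limit point.\<close>

lemma sphere_Janiszewski:
  assumes "closed A" "closed B" "A \<subseteq> S2" "B \<subseteq> S2" "connected (A \<inter> B)"
    and "connected (S2 - A)" "connected (S2 - B)"
  shows "connected (S2 - (A \<union> B))"
proof (cases "S2 - (A \<union> B) = {}")
  case False
  then obtain z where z: "z \<in> S2" "z \<notin> A" "z \<notin> B" by blast
  obtain h :: "real^3 \<Rightarrow> complex" and k where ch: "continuous_on (S2 - {z}) h" and injh: "inj_on h (S2 - {z})"
    and im: "h ` (S2 - {z}) = UNIV"
    and ck: "continuous_on UNIV k" and kh: "\<And>x. x \<in> S2 - {z} \<Longrightarrow> k (h x) = x"
    using punctured_sphere_homeomorphism[OF z(1)] by metis
  have sub: "A \<subseteq> S2 - {z}" "B \<subseteq> S2 - {z}" using assms z by auto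
  have cpt: "compact A" "compact B"
    using assms by (meson bounded_sphere bounded_subset compact_eq_bounded_closed)+
  have compl: "- (h ` C) = h ` (S2 - C - {z})" if "C \<subseteq> S2 - {z}" for C
  proof -
    have "h ` (S2 - {z} - C) = h ` (S2 - {z}) - h ` C"
      by (rule inj_on_image_set_diff[OF injh]) (use that in auto)
    moreover have "S2 - {z} - C = S2 - C - {z}" by blast
    ultimately show ?thesis using im by (simp add: Compl_eq_Diff_UNIV)
  qed
  have conn: "connected (- (h ` C))" if "C \<subseteq> S2 - {z}" "closed C" "connected (S2 - C)" for C
  proof -
    have "openin (top_of_set S2) (S2 - C)" using that(2)
      by (metis Diff_eq open_Compl openin_open_Int)
    then have "connected (S2 - C - {z})" using that connected_openin_sphere_delete by blast
    then have "connected (h ` (S2 - C - {z}))"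
      by (intro connected_continuous_image continuous_on_subset[OF ch]) auto
    then show ?thesis using compl[OF that(1)] by simp
  qed
  have "connected (- (h ` A \<union> h ` B))"
  proof (rule Janiszewski_connected)
    show "compact (h ` A)" "closed (h ` B)"
      using cpt sub by (auto intro!: compact_imp_closed compact_continuous_image intro: continuous_on_subset[OF ch])
    have "h ` A \<inter> h ` B = h ` (A \<inter> B)"
      using inj_on_image_Int[OF injh sub] by simp
    then show "connected (h ` A \<inter> h ` B)"
      using assms(5) sub by (auto intro!: connected_continuous_image intro: continuous_on_subset[OF ch])
  qed (use conn sub assms in auto)
  then have "connected (h ` (S2 - (A \<union> B) - {z}))"
    using compl[of "A \<union> B"] sub by (simp add: image_Un)
  then have "connected (k ` h ` (S2 - (A \<union> B) - {z}))"
    using ck by (meson connected_continuous_image continuous_on_subset subset_UNIV)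
  moreover have "k ` h ` (S2 - (A \<union> B) - {z}) = S2 - (A \<union> B) - {z}"
  proof -
    have "k ` h ` (S2 - (A \<union> B) - {z}) = (\<lambda>x. x) ` (S2 - (A \<union> B) - {z})"
      unfolding image_image by (rule image_cong) (use kh in auto)
    then show ?thesis by simp
  qed
  ultimately have "connected (S2 - (A \<union> B) - {z})" by simp
  moreover have "openin (top_of_set S2) (S2 - (A \<union> B))"
    using assms(1,2) by (metis Diff_eq closed_Un open_Compl openin_open_Int)
  then have "z \<in> closure (S2 - (A \<union> B) - {z})"
    using z sphere_in_closure_delete by blast
  ultimately show ?thesis
    using connected_intermediate_closure[of "S2 - (A \<union> B) - {z}" "S2 - (A \<union> B)"]
      closure_subset[of "S2 - (A \<union> B) - {z}"] by blast
qed (metis connected_empty)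

text \<open>The same projection, centred in the nonempty complement. As \<open>A\<close> and
  \<open>B\<close> avoid the centre, \<open>A \<inter> B\<close> returns from the plane
  intact.\<close>

lemma sphere_Janiszewski_dual:
  assumes "closed A" "closed B" "A \<subseteq> S2" "B \<subseteq> S2" "connected A" "connected B"
    and "connected (S2 - (A \<union> B))" "S2 - (A \<union> B) \<noteq> {}"
  shows "connected (A \<inter> B)"
proof -
  obtain z where z: "z \<in> S2" "z \<notin> A" "z \<notin> B" using assms(8) by blast
  obtain h :: "real^3 \<Rightarrow> complex" and k where ch: "continuous_on (S2 - {z}) h" and injh: "inj_on h (S2 - {z})"
    and im: "h ` (S2 - {z}) = UNIV"
    and ck: "continuous_on UNIV k" and kh: "\<And>x. x \<in> S2 - {z} \<Longrightarrow> k (h x) = x"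
    using punctured_sphere_homeomorphism[OF z(1)] by metis
  have sub: "A \<subseteq> S2 - {z}" "B \<subseteq> S2 - {z}" using assms z by auto
  have cpt: "compact A" "compact B"
    using assms by (meson bounded_sphere bounded_subset compact_eq_bounded_closed)+
  have eq: "- (h ` A \<union> h ` B) = h ` (S2 - (A \<union> B) - {z})"
  proof -
    have "h ` (S2 - {z} - (A \<union> B)) = h ` (S2 - {z}) - h ` (A \<union> B)"
      by (rule inj_on_image_set_diff[OF injh]) (use sub in auto)
    moreover have "S2 - {z} - (A \<union> B) = S2 - (A \<union> B) - {z}" by blast
    ultimately show ?thesis using im by (simp add: Compl_eq_Diff_UNIV image_Un)
  qed
  have "openin (top_of_set S2) (S2 - (A \<union> B))"
    using assms(1,2) by (metis Diff_eq closed_Un open_Compl openin_open_Int)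
  then have "connected (S2 - (A \<union> B) - {z})"
    using assms connected_openin_sphere_delete by blast
  then have "connected (- (h ` A \<union> h ` B))"
    unfolding eq by (intro connected_continuous_image continuous_on_subset[OF ch]) auto
  then have "connected (h ` A \<inter> h ` B)"
    using cpt sub ch assms(5,6)
    by (intro Janiszewski_dual compact_continuous_image connected_continuous_image)
       (auto intro: continuous_on_subset)
  then have "connected (k ` (h ` A \<inter> h ` B))"
    using ck by (meson connected_continuous_image continuous_on_subset subset_UNIV)
  moreover have "k ` (h ` A \<inter> h ` B) = A \<inter> B"
  proof -
    have "k ` (h ` A \<inter> h ` B) = k ` h ` (A \<inter> B)"
      by (simp only: inj_on_image_Int[OF injh sub])
    also have "\<dots> = (\<lambda>x. x) ` (A \<inter> B)"
      unfolding image_image by (rule image_cong[OF refl kh]) (use sub in blast)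
    finally show ?thesis by simp
  qed
  ultimately show ?thesis by simp
qed

section \<open>Sphere maps with connected shadows\<close>

lemma compact_neg_bounded_away:
  fixes h :: "'a::topological_space \<Rightarrow> real"
  assumes "compact K" "continuous_on K h" "\<And>y. y \<in> K \<Longrightarrow> h y < 0"
  obtains \<delta> where "\<delta> > 0" "\<And>y. y \<in> K \<Longrightarrow> h y \<le> - \<delta>"
proof (cases "K = {}")
  case False
  then obtain z where "z \<in> K" "\<And>y. y \<in> K \<Longrightarrow> h y \<le> h z"
    using continuous_attains_sup[OF assms(1) _ assms(2)] by blast
  then show thesis using that[of "- h z"] assms(3) by simp
qed (use that[of 1] in auto)

text \<open>By the triple product identity \<open>cross3 x v\<close> is parallel to both
  \<open>a\<close> and \<open>b\<close>; these are independent, so it vanishes.\<close>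

lemma orthogonal_pair_unique_direction:
  fixes a b x v :: "real^3"
  assumes "cross3 a b \<noteq> 0" "x \<bullet> a = 0" "x \<bullet> b = 0" "v \<bullet> a = 0" "v \<bullet> b = 0" "v \<noteq> 0"
  shows "\<exists>c. x = c *\<^sub>R v"
proof -
  let ?w = "cross3 x v"
  have "cross3 a ?w = 0" "cross3 b ?w = 0"
    using assms by (simp_all add: Lagrange inner_commute)
  then have "cross3 ?w a = 0" "cross3 ?w b = 0"
    using cross_skew[of a ?w] cross_skew[of b ?w] by auto
  then have coll: "collinear {0, ?w, a}" "collinear {0, ?w, b}"
    by (simp_all add: cross_eq_0)
  have "?w = 0"
  proof (rule ccontr)
    assume "?w \<noteq> 0"
    then have "a = 0 \<or> (\<exists>c. a = c *\<^sub>R ?w)" "b = 0 \<or> (\<exists>c. b = c *\<^sub>R ?w)"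
      using coll unfolding collinear_lemma by blast+
    then show False using assms(1) by (auto simp: cross_mult_left cross_mult_right)
  qed
  then have "cross3 v x = 0" using cross_skew[of x v] by simp
  then have "x = 0 \<or> (\<exists>c. x = c *\<^sub>R v)"
    using assms(6) unfolding cross_eq_0 collinear_lemma by blast
  then show ?thesis by (auto intro: exI[of _ 0])
qed

text \<open>Here \<open>u\<close> is an arbitrary vector. Only its direction matters and
  \<open>u = 0\<close> gives the empty set, so directions can be tilted by adding vectors, without
  normalising.\<close>

locale shadow_map =
  fixes g :: "real^3 \<Rightarrow> real^3"
  assumes cont: "continuous_on S2 g"
    and norm_g: "x \<in> S2 \<Longrightarrow> norm (g x) = 1"
    and connected_shadow: "connected {x \<in> S2. 0 < g x \<bullet> u}"
begin

definition open_shadow :: "real^3 \<Rightarrow> (real^3) set" where "open_shadow u = {x \<in> S2. 0 < g x \<bullet> u}"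
definition closed_shadow :: "real^3 \<Rightarrow> (real^3) set" where "closed_shadow u = {x \<in> S2. 0 \<le> g x \<bullet> u}"

lemma connected_open_shadow: "connected (open_shadow u)"
  using connected_shadow by (simp add: open_shadow_def)

lemma open_shadow_subset: "open_shadow u \<subseteq> S2" and closed_shadow_subset: "closed_shadow u \<subseteq> S2" and open_shadow_subset_closed_shadow: "open_shadow u \<subseteq> closed_shadow u"
  by (auto simp: open_shadow_def closed_shadow_def)

lemma continuous_on_height: "A \<subseteq> S2 \<Longrightarrow> continuous_on A (\<lambda>x. g x \<bullet> u)"
  by (intro continuous_intros continuous_on_subset[OF cont])

lemma inner_g_bound: "x \<in> S2 \<Longrightarrow> \<bar>g x \<bullet> u\<bar> \<le> norm u"
  using Cauchy_Schwarz_ineq2[of "g x" u] norm_g by simp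

lemma openin_open_shadow: "openin (top_of_set S2) (open_shadow u)"
proof -
  have "open_shadow u = S2 \<inter> (\<lambda>x. g x \<bullet> u) -` {0<..}" by (auto simp: open_shadow_def)
  then show ?thesis
    using continuous_openin_preimage_gen[OF continuous_on_height[of S2 u]] by simp
qed

lemma compact_closed_shadow: "compact (closed_shadow u)"
proof -
  have "closed_shadow u = S2 \<inter> (\<lambda>x. g x \<bullet> u) -` {0..}" by (auto simp: closed_shadow_def)
  then have "closedin (top_of_set S2) (closed_shadow u)"
    using continuous_closedin_preimage[OF continuous_on_height[of S2 u]] by simp
  then show ?thesis using closedin_compact[OF compact_sphere] by blast
qed

lemma closed_closed_shadow: "closed (closed_shadow u)" by (simp add: compact_closed_shadow compact_imp_closed)

lemma Diff_closed_shadow_uminus: "S2 - closed_shadow (- u) = open_shadow u" by (auto simp: open_shadow_def closed_shadow_def)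

text \<open>A piece of \<^term>\<open>closed_shadow u\<close> disjoint from \<^term>\<open>open_shadow u\<close> becomes a separate piece of
  a shadow once \<open>u\<close> is tilted slightly towards the value of \<open>g\<close> there.\<close>

lemma connected_closed_shadow:
  assumes "open_shadow u \<noteq> {}"
  shows "connected (closed_shadow u)"
proof (rule ccontr)
  assume "\<not> connected (closed_shadow u)"
  then obtain A B where AB: "closed A" "closed B" "A \<noteq> {}" "B \<noteq> {}" "A \<union> B = closed_shadow u" "A \<inter> B = {}"
    unfolding connected_closed_set[OF closed_closed_shadow] by blast
  have "A \<inter> open_shadow u = {} \<or> B \<inter> open_shadow u = {}"
    by (rule connected_closedD[OF connected_open_shadow]) (use AB open_shadow_subset_closed_shadow[of u] in blast)+
  then obtain G H where GH: "closed G" "closed H" "H \<noteq> {}" "G \<union> H = closed_shadow u" "G \<inter> H = {}" "H \<inter> open_shadow u = {}"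
  proof (cases "B \<inter> open_shadow u = {}")
    case True
    then show ?thesis using that[of A B] AB by blast
  next
    case False
    with \<open>A \<inter> open_shadow u = {} \<or> B \<inter> open_shadow u = {}\<close> show ?thesis using that[of B A] AB by blast
  qed
  obtain p where p: "p \<in> H" using GH by blast
  obtain x where x: "x \<in> open_shadow u" using assms by blast
  obtain U V where UV: "open U" "open V" "G \<subseteq> U" "H \<subseteq> V" "U \<inter> V = {}"
    using separation_normal[OF GH(1,2,5)] by metis
  define K where "K = S2 - (U \<union> V)"
  have "compact K" unfolding K_def using UV by (simp add: compact_diff open_Un)
  moreover have "continuous_on K (\<lambda>y. g y \<bullet> u)" by (rule continuous_on_height) (simp add: K_def)
  moreover have "g y \<bullet> u < 0" if "y \<in> K" for y
  proof (rule ccontr)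
    assume "\<not> g y \<bullet> u < 0"
    then have "y \<in> closed_shadow u" using that by (simp add: K_def closed_shadow_def)
    then have "y \<in> U \<union> V" using GH(4) UV(3,4) by blast
    then show False using that by (simp add: K_def)
  qed
  ultimately obtain \<delta> where \<delta>: "\<delta> > 0" "\<And>y. y \<in> K \<Longrightarrow> g y \<bullet> u \<le> - \<delta>"
    using compact_neg_bounded_away by metis
  have gx: "0 < g x \<bullet> u" "x \<in> S2" using x by (auto simp: open_shadow_def)
  have "p \<in> closed_shadow u" "p \<notin> open_shadow u" using p GH by blast+
  then have "p \<in> S2" "g p \<bullet> u = 0" by (auto simp: closed_shadow_def open_shadow_def)
  \<comment> \<open>Below \<open>\<delta>\<close>, so that the tilted shadow still avoids
    \<open>K\<close> and stays inside \<open>U \<union> V\<close>; below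
    \<open>g x \<bullet> u\<close>, so that \<open>x\<close> remains in it.\<close>
  define \<epsilon> where "\<epsilon> = min \<delta> (g x \<bullet> u) / 2"
  have \<epsilon>: "0 < \<epsilon>" "\<epsilon> < \<delta>" "\<epsilon> < g x \<bullet> u" using \<delta> gx by (auto simp: \<epsilon>_def min_def)
  define w where "w = u + \<epsilon> *\<^sub>R g p"
  have w: "\<bar>g y \<bullet> w - g y \<bullet> u\<bar> \<le> \<epsilon>" if "y \<in> S2" for y
    using inner_g_bound[OF that, of "g p"] norm_g[OF \<open>p \<in> S2\<close>] \<epsilon>
    by (simp add: w_def inner_add_right abs_mult mult_le_cancel_left1)
  have "g p \<bullet> w = \<epsilon>"
    using \<open>g p \<bullet> u = 0\<close> norm_g[OF \<open>p \<in> S2\<close>] by (simp add: w_def inner_add_right dot_square_norm)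
  then have "p \<in> open_shadow w" using \<epsilon> \<open>p \<in> S2\<close> by (simp add: open_shadow_def)
  have "x \<in> open_shadow w" using w[OF gx(2)] \<epsilon> gx by (auto simp: open_shadow_def)
  have "x \<in> U" using x GH UV open_shadow_subset_closed_shadow by blast
  have "open_shadow w \<subseteq> U \<union> V"
  proof
    fix y assume "y \<in> open_shadow w"
    then have "y \<in> S2" "0 < g y \<bullet> w" by (auto simp: open_shadow_def)
    then have "y \<notin> K" using \<delta>(2)[of y] w[of y] \<epsilon> by auto
    then show "y \<in> U \<union> V" using \<open>y \<in> S2\<close> by (simp add: K_def)
  qed
  then have "U \<inter> open_shadow w = {} \<or> V \<inter> open_shadow w = {}"
    by (intro connectedD[OF connected_open_shadow]) (use UV in auto)
  then show False using \<open>x \<in> U\<close> \<open>x \<in> open_shadow w\<close> \<open>p \<in> open_shadow w\<close> p UV by blast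
qed

text \<open>A point in the shadow of a convex combination lies in that of \<open>a\<close> or of
  \<open>b\<close>. If these were disjoint within \<open>W\<close>, connectedness would leave only
  one of the two visible at each parameter \<open>t\<close>. The parameters seeing \<open>a\<close>
  and those seeing \<open>b\<close> would then split the unit interval into two disjoint nonempty
  open sets.\<close>

lemma open_shadow_segment_meets:
  assumes con: "\<And>t. 0 \<le> t \<Longrightarrow> t \<le> 1 \<Longrightarrow> connected (W \<inter> open_shadow ((1 - t) *\<^sub>R a + t *\<^sub>R b))"
    and ne: "\<And>t. 0 \<le> t \<Longrightarrow> t \<le> 1 \<Longrightarrow> W \<inter> open_shadow ((1 - t) *\<^sub>R a + t *\<^sub>R b) \<noteq> {}"
  shows "W \<inter> open_shadow a \<inter> open_shadow b \<noteq> {}"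
proof
  assume empty: "W \<inter> open_shadow a \<inter> open_shadow b = {}"
  define u where "u t = (1 - t) *\<^sub>R a + t *\<^sub>R b" for t
  define O1 where "O1 = (\<Union>x \<in> W \<inter> open_shadow a. {t. 0 < g x \<bullet> u t})"
  define O2 where "O2 = (\<Union>x \<in> W \<inter> open_shadow b. {t. 0 < g x \<bullet> u t})"
  have op: "open {t. 0 < g x \<bullet> u t}" for x
    unfolding u_def by (intro open_Collect_less continuous_intros)
  have gu: "g x \<bullet> u t = (1 - t) * (g x \<bullet> a) + t * (g x \<bullet> b)" for x t
    by (simp add: u_def inner_add_right)
  have pos: "0 < g x \<bullet> a \<or> 0 < g x \<bullet> b" if "0 < g x \<bullet> u t" "0 \<le> t" "t \<le> 1" for x t
  proof (rule ccontr)
    assume "\<not> ?thesis"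
    then have "(1 - t) * (g x \<bullet> a) \<le> 0" "t * (g x \<bullet> b) \<le> 0"
      using that(2,3) by (auto simp: mult_le_0_iff)
    then show False using that(1) gu[of x t] by simp
  qed
  have "O1 \<inter> O2 \<inter> {0..1} \<noteq> {}"
  proof
    assume d: "O1 \<inter> O2 \<inter> {0..1} = {}"
    have "{0..1} \<subseteq> O1 \<union> O2"
    proof
      fix t :: real assume t: "t \<in> {0..1}"
      then obtain x where "x \<in> W" "x \<in> open_shadow (u t)" using ne[of t] by (auto simp: u_def)
      then show "t \<in> O1 \<union> O2" using pos[of x t] t by (auto simp: open_shadow_def O1_def O2_def)
    qed
    moreover have "open O1" "open O2" unfolding O1_def O2_def using op by auto
    ultimately have "O1 \<inter> {0..1} = {} \<or> O2 \<inter> {0..1} = {}"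
      using connectedD[of "{0..1::real}" O1 O2] d connected_Icc by blast
    moreover obtain x where "x \<in> W" "x \<in> open_shadow a" using ne[of 0] by auto
    then have "0 \<in> O1" by (auto simp: O1_def gu open_shadow_def)
    moreover obtain x where "x \<in> W" "x \<in> open_shadow b" using ne[of 1] by auto
    then have "1 \<in> O2" by (auto simp: O2_def gu open_shadow_def)
    ultimately show False by auto
  qed
  then obtain t x y where t: "0 \<le> t" "t \<le> 1" and x: "x \<in> W" "x \<in> open_shadow a" "0 < g x \<bullet> u t"
    and y: "y \<in> W" "y \<in> open_shadow b" "0 < g y \<bullet> u t"
    by (auto simp: O1_def O2_def)
  define C where "C = W \<inter> open_shadow (u t)"
  have "connected C" using con t by (simp add: C_def u_def)
  then have "connected (g ` C)"
    by (intro connected_continuous_image continuous_on_subset[OF cont]) (auto simp: C_def open_shadow_def)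
  moreover have "g ` C \<subseteq> {y. 0 < y \<bullet> a} \<union> {y. 0 < y \<bullet> b}"
    using pos t by (auto simp: C_def open_shadow_def)
  moreover have "{y. 0 < y \<bullet> a} \<inter> {y. 0 < y \<bullet> b} \<inter> g ` C = {}"
    using empty by (auto simp: C_def open_shadow_def)
  moreover have "open {y. 0 < y \<bullet> a}" "open {y. 0 < y \<bullet> b}"
    by (auto intro!: open_Collect_less continuous_intros)
  ultimately have "{y. 0 < y \<bullet> a} \<inter> g ` C = {} \<or> {y. 0 < y \<bullet> b} \<inter> g ` C = {}"
    by (intro connectedD) auto
  moreover have "x \<in> C" "y \<in> C" using x y by (auto simp: C_def open_shadow_def)
  ultimately show False using x y by (auto simp: open_shadow_def)
qed

end

text \<open>For an immersion this holds because extrema of a height function sit over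
  \<open>v\<close> and \<open>- v\<close>, see \<open>fibres_disconnected\<close>. As the empty set
  is connected, it also says that \<open>g\<close> meets every pair of antipodes.\<close>

locale shadow_map_poles = shadow_map +
  assumes poles_disconnected: "v \<in> S2 \<Longrightarrow> \<not> connected {x \<in> S2. g x = v \<or> g x = - v}"
begin

lemma open_shadow_ne_or:
  assumes "0 < v \<bullet> a" "v \<bullet> b < 0"
  shows "open_shadow a \<noteq> {} \<or> open_shadow b \<noteq> {}"
proof -
  have "v \<noteq> 0" using assms by auto
  then have "v /\<^sub>R norm v \<in> S2" by simp
  then obtain x where x: "x \<in> S2" "g x = v /\<^sub>R norm v \<or> g x = - (v /\<^sub>R norm v)"
    using poles_disconnected by (metis (mono_tags, lifting) Collect_empty_eq connected_empty)
  then have "g x \<bullet> a = (v \<bullet> a) / norm v \<or> g x \<bullet> b = - (v \<bullet> b) / norm v"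
    by (auto simp: divide_inverse_commute)
  then have "0 < g x \<bullet> a \<or> 0 < g x \<bullet> b"
    using assms \<open>v \<noteq> 0\<close> by (auto simp: divide_pos_pos divide_neg_pos)
  then show ?thesis using x by (auto simp: open_shadow_def)
qed

text \<open>If one shadow were empty then the great circle bounding it would have a preimage that
  does not separate the sphere, although it is the union of two continua whose intersection,
  the preimage of a pair of antipodes, is disconnected.\<close>

lemma open_shadow_nonempty:
  assumes "u \<noteq> 0"
  shows "open_shadow u \<noteq> {}"
proof
  assume empty: "open_shadow u = {}"
  obtain w where w: "w \<noteq> 0" "w \<bullet> u = 0"
    using orthogonal_to_vector_exists[of u] by (auto simp: orthogonal_def inner_commute)
  have le: "g x \<bullet> u \<le> 0" if "x \<in> S2" for x using empty that by (auto simp: open_shadow_def not_less)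
  \<comment> \<open>For \<open>z\<close> orthogonal to \<open>u\<close> this is the preimage of a
    closed half of the great circle orthogonal to \<open>u\<close>; the halves for \<open>w\<close>
    and \<open>- w\<close> share just a pair of antipodes.\<close>
  define A where "A z = {x \<in> S2. g x \<bullet> u = 0 \<and> 0 \<le> g x \<bullet> z}" for z
  have Aeq: "A z = closed_shadow u \<inter> closed_shadow z" for z by (auto simp: A_def closed_shadow_def intro!: antisym le)
  then have clA: "closed (A z)" for z by (simp add: closed_closed_shadow closed_Int)
  have conA: "connected (A z)" if z: "z \<noteq> 0" "z \<bullet> u = 0" for z
  proof -
    have ne: "open_shadow (u + e *\<^sub>R z) \<noteq> {}" if "0 < e" for e
    proof -
      \<comment> \<open>The coefficient is chosen so that the inner products with \<open>u\<close>
        and \<open>u + e *\<^sub>R z\<close> are \<open>u \<bullet> u\<close> and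
        \<open>- (u \<bullet> u)\<close>. Hence one of the two shadows is nonempty, and it is not
        that of \<open>u\<close>.\<close>
      let ?v = "u - (2 * (u \<bullet> u) / (e * (z \<bullet> z))) *\<^sub>R z"
      have "?v \<bullet> (u + e *\<^sub>R z) = - (u \<bullet> u)"
        using z that by (simp add: inner_add_right inner_diff_left inner_commute[of u z] field_simps)
      moreover have "?v \<bullet> u = u \<bullet> u" using z by (simp add: inner_diff_left)
      ultimately show ?thesis using open_shadow_ne_or[of ?v u "u + e *\<^sub>R z"] empty assms by auto
    qed
    \<comment> \<open>Since \<open>g x \<bullet> u\<close> is never positive, a point of such a
      closed shadow satisfies \<open>0 \<le> g x \<bullet> z\<close>, and the shadow grows with the
      coefficient. As the coefficient tends to 0 only \<open>A z\<close> is left.\<close>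
    have mono: "closed_shadow (u + e *\<^sub>R z) \<subseteq> closed_shadow (u + d *\<^sub>R z)" if "0 < e" "e \<le> d" for e d
    proof
      fix x assume "x \<in> closed_shadow (u + e *\<^sub>R z)"
      then have x: "x \<in> S2" "0 \<le> g x \<bullet> u + e * (g x \<bullet> z)" by (auto simp: closed_shadow_def inner_add_right)
      then have "0 \<le> e * (g x \<bullet> z)" using le by force
      then have "0 \<le> g x \<bullet> z" using that by (simp add: zero_le_mult_iff)
      then have "e * (g x \<bullet> z) \<le> d * (g x \<bullet> z)" using that by (simp add: mult_right_mono)
      then show "x \<in> closed_shadow (u + d *\<^sub>R z)" using x by (auto simp: closed_shadow_def inner_add_right)
    qed
    let ?F = "(\<lambda>e. closed_shadow (u + e *\<^sub>R z)) ` {0<..}"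
    have "connected (\<Inter> ?F)"
    proof (rule connected_chain)
      show "\<And>T. T \<in> ?F \<Longrightarrow> compact T \<and> connected T" using ne compact_closed_shadow connected_closed_shadow by auto
      fix S T assume "S \<in> ?F \<and> T \<in> ?F"
      then obtain d e where "S = closed_shadow (u + d *\<^sub>R z)" "T = closed_shadow (u + e *\<^sub>R z)" "0 < d" "0 < e" by auto
      then show "S \<subseteq> T \<or> T \<subseteq> S" using mono[of d e] mono[of e d] linear[of d e] by metis
    qed
    also have "\<Inter> ?F = A z"
    proof (intro subset_antisym subsetI)
      fix x assume "x \<in> \<Inter> ?F"
      then have "x \<in> closed_shadow (u + e *\<^sub>R z)" if "0 < e" for e using that by blast
      from this[of 1] this have x: "x \<in> S2" "\<And>e. 0 < e \<Longrightarrow> 0 \<le> g x \<bullet> u + e * (g x \<bullet> z)"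
        by (auto simp: closed_shadow_def inner_add_right)
      have "((\<lambda>e. g x \<bullet> u + e * (g x \<bullet> z)) \<longlongrightarrow> g x \<bullet> u + 0 * (g x \<bullet> z)) (at_right 0)"
        by (intro tendsto_intros)
      then have "0 \<le> g x \<bullet> u + 0 * (g x \<bullet> z)"
        by (rule tendsto_lowerbound) (use x in \<open>auto intro!: eventually_at_rightI[of 0 1]\<close>)
      then have "g x \<bullet> u = 0" using le[OF x(1)] by simp
      then show "x \<in> A z" using x(1) x(2)[of 1] by (simp add: A_def)
    qed (auto simp: A_def closed_shadow_def inner_add_right)
    finally show ?thesis .
  qed
  have "A w \<union> A (- w) = closed_shadow u" by (auto simp: A_def closed_shadow_def intro!: antisym le)
  then have D: "S2 - (A w \<union> A (- w)) = open_shadow (- u)" using Diff_closed_shadow_uminus[of "- u"] by simp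
  have "open_shadow (- u) \<noteq> {}" using open_shadow_ne_or[of u u "- u"] empty assms by simp
  have "connected (A w \<inter> A (- w))"
  proof (rule sphere_Janiszewski_dual)
    show "A w \<subseteq> S2" "A (- w) \<subseteq> S2" by (auto simp: A_def)
    show "connected (A w)" "connected (A (- w))" using w by (auto intro!: conA)
  qed (use clA D connected_open_shadow \<open>open_shadow (- u) \<noteq> {}\<close> in auto)
  define y where "y = cross3 u w /\<^sub>R norm (cross3 u w)"
  have cr: "cross3 u w \<noteq> 0" 
  proof
    assume "cross3 u w = 0"
    then have "(norm u * norm w)\<^sup>2 = 0" using norm_cross_dot[of u w] w by (simp add: inner_commute)
    then show False using w assms by simp
  qed
  then have y: "y \<in> S2" "y \<bullet> u = 0" "y \<bullet> w = 0"
    by (simp_all add: y_def dot_cross_self)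
  have "A w \<inter> A (- w) = {x \<in> S2. g x = y \<or> g x = - y}"
  proof (intro subset_antisym subsetI)
    fix x assume "x \<in> A w \<inter> A (- w)"
    then have x: "x \<in> S2" "g x \<bullet> u = 0" "g x \<bullet> w = 0" by (auto simp: A_def)
    then obtain c where c: "g x = c *\<^sub>R y"
      using orthogonal_pair_unique_direction[OF cr] y by (metis norm_zero mem_sphere_0 zero_neq_one)
    then have "\<bar>c\<bar> = 1" using norm_g[OF x(1)] y by simp
    then show "x \<in> {x \<in> S2. g x = y \<or> g x = - y}" using c x by (auto simp: abs_if split: if_splits)
  qed (use y in \<open>auto simp: A_def\<close>)
  then show False using poles_disconnected[OF y(1)] \<open>connected (A w \<inter> A (- w))\<close> by simp
qed

end

section \<open>Pencils of lunes\<close>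

text \<open>Local connectedness makes \<open>C\<close> open in \<open>B\<close>, the last hypothesis
  makes it closed in \<open>B\<close>. Read contrapositively: if \<open>A \<inter> B\<close> is
  disconnected, the closure of each component contains points of \<open>B\<close> outside
  \<open>A\<close>.\<close>

lemma component_eq_of_closure:
  assumes "locally connected (A \<inter> B)" "openin (top_of_set B) (A \<inter> B)" "connected B"
    and "C \<in> components (A \<inter> B)" "B \<inter> closure C \<subseteq> A"
  shows "connected (A \<inter> B)"
proof -
  have "C \<subseteq> A \<inter> B" "C \<noteq> {}"
    using assms(4) in_components_subset in_components_nonempty by blast+
  have "openin (top_of_set (A \<inter> B)) C"
    using openin_components_locally_connected assms(1,4) by blast
  then have op: "openin (top_of_set B) C"
    using assms(2) openin_trans by blast
  obtain T where "closed T" "C = A \<inter> B \<inter> T"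
    using closedin_component[OF assms(4)] by (auto simp: closedin_closed)
  then have "C = A \<inter> B \<inter> closure C"
    using closure_minimal[of C T] closure_subset[of C] by blast
  then have "C = B \<inter> closure C" using assms(5) by blast
  then have cl: "closedin (top_of_set B) C" using closedin_closed_Int closed_closure by metis
  have "C = B"
    using op cl assms(3) \<open>C \<noteq> {}\<close> by (metis connected_clopen)
  then show ?thesis using \<open>C \<subseteq> A \<inter> B\<close> assms(3) by (metis Int_lower2 subset_antisym)
qed

context shadow_map_poles
begin

lemma open_shadow_Int_nonempty:
  assumes "0 \<notin> closed_segment a b"
  shows "open_shadow a \<inter> open_shadow b \<noteq> {}"
proof -
  have "(1 - t) *\<^sub>R a + t *\<^sub>R b \<noteq> 0" if "0 \<le> t" "t \<le> 1" for t
    using assms that unfolding in_segment by metis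
  then have "S2 \<inter> open_shadow a \<inter> open_shadow b \<noteq> {}"
    by (intro open_shadow_segment_meets) (auto simp: Int_absorb1 open_shadow_subset connected_open_shadow open_shadow_nonempty)
  then show ?thesis by blast
qed

lemma connected_closed_shadow': "u \<noteq> 0 \<Longrightarrow> connected (closed_shadow u)"
  by (simp add: connected_closed_shadow open_shadow_nonempty)

text \<open>The closed shadows of \<open>- a\<close> and \<open>- b\<close> have the complement of
  the open lune as their union and the opposite closed lune as their intersection, so each direction
  is one of Janiszewski's theorems. The segment condition excludes zero and opposite
  vectors.\<close>

lemma connected_lune_iff:
  assumes "0 \<notin> closed_segment a b"
  shows "connected (open_shadow a \<inter> open_shadow b) \<longleftrightarrow> connected (closed_shadow (- a) \<inter> closed_shadow (- b))"
proof -
  have ne: "a \<noteq> 0" "b \<noteq> 0" using assms by auto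
  have D: "S2 - (closed_shadow (- a) \<union> closed_shadow (- b)) = open_shadow a \<inter> open_shadow b" by (auto simp: open_shadow_def closed_shadow_def)
  show ?thesis
  proof
    assume "connected (open_shadow a \<inter> open_shadow b)"
    then show "connected (closed_shadow (- a) \<inter> closed_shadow (- b))"
      using ne D open_shadow_Int_nonempty[OF assms]
      by (intro sphere_Janiszewski_dual closed_closed_shadow closed_shadow_subset connected_closed_shadow') auto
  next
    assume "connected (closed_shadow (- a) \<inter> closed_shadow (- b))"
    then have "connected (S2 - (closed_shadow (- a) \<union> closed_shadow (- b)))"
      by (intro sphere_Janiszewski closed_closed_shadow closed_shadow_subset)
         (simp_all add: Diff_closed_shadow_uminus connected_open_shadow)
    then show "connected (open_shadow a \<inter> open_shadow b)" using D by simp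
  qed
qed

end

text \<open>All lunes of the pencil have their corners on the line orthogonal to \<open>e1\<close>
  and \<open>e2\<close>. The neighbourhoods demanded over the corners keep the components of a lune
  from accumulating there.\<close>

locale lune_pencil = shadow_map_poles +
  fixes e1 e2 :: "real^3"
  assumes indep: "cross3 e1 e2 \<noteq> 0"
    and nice_at_poles: "\<And>p. p \<in> S2 \<Longrightarrow> g p \<bullet> e1 = 0 \<Longrightarrow> g p \<bullet> e2 = 0 \<Longrightarrow>
      \<exists>N. openin (top_of_set S2) N \<and> p \<in> N \<and> (\<forall>a b. connected (N \<inter> open_shadow a \<inter> open_shadow b))"
begin

text \<open>With the coordinates \<open>x = g p \<bullet> e1\<close> and
  \<open>y = g p \<bullet> e2\<close>, the lune is the sector given by \<open>0 < x\<close> and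
  \<open>y / x < s\<close>. The slope \<open>s\<close> replaces the angle, and the angle
  \<open>\<pi>\<close> corresponds to an infinite slope.\<close>

definition slope_side :: "real \<Rightarrow> (real^3) set" where "slope_side s = open_shadow (s *\<^sub>R e1 - e2)"
definition pencil_lune :: "real \<Rightarrow> (real^3) set" where "pencil_lune s = open_shadow e1 \<inter> slope_side s"
definition opposite_lune :: "real \<Rightarrow> (real^3) set" where "opposite_lune s = closed_shadow (- e1) \<inter> closed_shadow (e2 - s *\<^sub>R e1)"

lemma mem_slope_side: "x \<in> slope_side s \<longleftrightarrow> x \<in> S2 \<and> g x \<bullet> e2 < s * (g x \<bullet> e1)"
  by (auto simp: slope_side_def open_shadow_def inner_diff_right)

lemma mem_pencil_lune: "x \<in> pencil_lune s \<longleftrightarrow> x \<in> S2 \<and> 0 < g x \<bullet> e1 \<and> g x \<bullet> e2 < s * (g x \<bullet> e1)"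
  by (auto simp: pencil_lune_def mem_slope_side) (simp add: open_shadow_def)+

lemma mem_opposite_lune: "x \<in> opposite_lune s \<longleftrightarrow> x \<in> S2 \<and> g x \<bullet> e1 \<le> 0 \<and> s * (g x \<bullet> e1) \<le> g x \<bullet> e2"
  by (auto simp: opposite_lune_def closed_shadow_def inner_diff_right)

lemma not_in_segment: "0 \<notin> closed_segment e1 (s *\<^sub>R e1 - e2)"
proof
  assume "0 \<in> closed_segment e1 (s *\<^sub>R e1 - e2)"
  then obtain t where t: "0 = (1 - t) *\<^sub>R e1 + t *\<^sub>R (s *\<^sub>R e1 - e2)" by (auto simp: in_segment)
  then have "t *\<^sub>R e2 = (1 - t + t * s) *\<^sub>R e1"
    by (simp add: algebra_simps)
  then have "t *\<^sub>R cross3 e1 e2 = 0"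
    by (metis cross_mult_right cross_refl scaleR_zero_right)
  then have "t = 0" using indep by simp
  then have "e1 = 0" using t by simp
  then show False using indep by simp
qed

lemma connected_pencil_lune_iff: "connected (pencil_lune s) \<longleftrightarrow> connected (opposite_lune s)"
  using connected_lune_iff[OF not_in_segment] by (simp add: pencil_lune_def slope_side_def opposite_lune_def)

lemma pencil_lune_nonempty: "pencil_lune s \<noteq> {}"
  using open_shadow_Int_nonempty[OF not_in_segment] by (simp add: pencil_lune_def slope_side_def)

lemma openin_pencil_lune: "openin (top_of_set S2) (pencil_lune s)"
  by (simp add: pencil_lune_def slope_side_def openin_Int openin_open_shadow)

lemma locally_connected_pencil_lune: "locally connected (pencil_lune s)"
  using locally_open_subset[OF locally_connected_sphere openin_pencil_lune] .

lemma pencil_lune_mono: "s \<le> t \<Longrightarrow> pencil_lune s \<subseteq> pencil_lune t"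
  by (auto simp: mem_pencil_lune) (meson less_le_trans mult_right_mono less_imp_le)

lemma compact_opposite_lune: "compact (opposite_lune s)"
  by (simp add: opposite_lune_def compact_closed_shadow compact_Int)

lemma closure_bound:
  assumes "C \<subseteq> S2" "\<And>x. x \<in> C \<Longrightarrow> 0 \<le> g x \<bullet> u" "z \<in> closure C"
  shows "0 \<le> g z \<bullet> u"
proof -
  have "C \<subseteq> closed_shadow u" using assms by (auto simp: closed_shadow_def)
  then have "closure C \<subseteq> closed_shadow u" by (simp add: closure_minimal closed_closed_shadow)
  then show ?thesis using assms(3) by (auto simp: closed_shadow_def)
qed

lemma component_pencil_lune_facts:
  assumes "C \<in> components (pencil_lune s)"
  shows "C \<subseteq> pencil_lune s" "C \<subseteq> S2" "connected C" "C \<noteq> {}"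
  using assms in_components_subset in_components_connected in_components_nonempty openin_pencil_lune
    openin_imp_subset by blast+

text \<open>Over a component missing the narrower lune all slopes are at least \<open>t\<close>. On
  the edge \<open>x = 0\<close> this leaves \<open>0 \<le> y\<close>, which
  \<open>slope_side s\<close> forbids; so the component would be closed in the connected set
  \<open>slope_side s\<close>.\<close>

lemma component_pencil_lune_meets:
  assumes "\<not> connected (pencil_lune s)" "C \<in> components (pencil_lune s)" "t < s"
  shows "C \<inter> pencil_lune t \<noteq> {}"
proof
  assume empty: "C \<inter> pencil_lune t = {}"
  note C = component_pencil_lune_facts[OF assms(2)]
  have "slope_side s \<inter> closure C \<subseteq> open_shadow e1"
  proof
    fix z assume z: "z \<in> slope_side s \<inter> closure C"
    have "0 \<le> g x \<bullet> e1" "0 \<le> g x \<bullet> (e2 - t *\<^sub>R e1)" if "x \<in> C" for x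
      using C(1) that empty by (auto simp: mem_pencil_lune inner_diff_right not_less dest!: subsetD)
    then have "0 \<le> g z \<bullet> e1" "0 \<le> g z \<bullet> (e2 - t *\<^sub>R e1)"
      using closure_bound[OF C(2)] z by auto
    then show "z \<in> open_shadow e1"
      using z by (cases "g z \<bullet> e1 = 0") (auto simp: mem_slope_side open_shadow_def inner_diff_right)
  qed
  moreover have "openin (top_of_set (slope_side s)) (open_shadow e1 \<inter> slope_side s)"
    by (metis openin_pencil_lune pencil_lune_def slope_side_def open_shadow_subset inf_le2 openin_subset_trans)
  ultimately have "connected (open_shadow e1 \<inter> slope_side s)"
    using component_eq_of_closure[of "open_shadow e1" "slope_side s" C] assms(2) locally_connected_pencil_lune connected_open_shadow
    by (simp add: pencil_lune_def slope_side_def)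
  then show False using assms(1) by (simp add: pencil_lune_def)
qed

text \<open>The counterpart at the other edge: slopes at most \<open>t\<close> keep the closure away
  from slope \<open>s\<close>, so the component would be closed in the connected set
  \<open>open_shadow e1\<close>.\<close>

lemma component_pencil_lune_not_subset:
  assumes "\<not> connected (pencil_lune s)" "C \<in> components (pencil_lune s)" "t < s"
  shows "\<not> C \<subseteq> pencil_lune t"
proof
  assume sub: "C \<subseteq> pencil_lune t"
  note C = component_pencil_lune_facts[OF assms(2)]
  have "open_shadow e1 \<inter> closure C \<subseteq> slope_side s"
  proof
    fix z assume z: "z \<in> open_shadow e1 \<inter> closure C"
    have "0 \<le> g x \<bullet> (t *\<^sub>R e1 - e2)" if "x \<in> C" for x
      using sub that by (auto simp: mem_pencil_lune inner_diff_right dest!: subsetD)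
    then have "0 \<le> g z \<bullet> (t *\<^sub>R e1 - e2)"
      using closure_bound[OF C(2)] z by auto
    then have "g z \<bullet> e2 \<le> t * (g z \<bullet> e1)" by (simp add: inner_diff_right)
    also have "\<dots> < s * (g z \<bullet> e1)" using z assms(3) by (simp add: open_shadow_def)
    finally show "z \<in> slope_side s" using z by (auto simp: mem_slope_side open_shadow_def)
  qed
  moreover have "openin (top_of_set (open_shadow e1)) (slope_side s \<inter> open_shadow e1)"
    by (metis openin_pencil_lune pencil_lune_def open_shadow_subset inf_commute inf_le1 openin_subset_trans)
  ultimately have "connected (slope_side s \<inter> open_shadow e1)"
    using component_eq_of_closure[of "slope_side s" "open_shadow e1" C] assms(2) locally_connected_pencil_lune[of s] connected_open_shadow
    by (simp add: pencil_lune_def Int_commute)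
  then show False using assms(1) by (simp add: pencil_lune_def Int_commute)
qed

lemma component_pencil_lune_meets_circle:
  assumes "\<not> connected (pencil_lune s)" "C \<in> components (pencil_lune s)" "t < s"
  shows "\<exists>y\<in>C. g y \<bullet> e2 = t * (g y \<bullet> e1)"
proof (rule ccontr)
  assume neg: "\<not> ?thesis"
  note C = component_pencil_lune_facts[OF assms(2)]
  have "connected (g ` C)"
    using C by (intro connected_continuous_image continuous_on_subset[OF cont])
  moreover have "open {y. y \<bullet> e2 < t * (y \<bullet> e1)}" "open {y. t * (y \<bullet> e1) < y \<bullet> e2}"
    by (auto intro!: open_Collect_less continuous_intros)
  moreover have "g ` C \<subseteq> {y. y \<bullet> e2 < t * (y \<bullet> e1)} \<union> {y. t * (y \<bullet> e1) < y \<bullet> e2}"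
    using neg by (auto simp: neq_iff)
  ultimately have "{y. y \<bullet> e2 < t * (y \<bullet> e1)} \<inter> g ` C = {} \<or> {y. t * (y \<bullet> e1) < y \<bullet> e2} \<inter> g ` C = {}"
    by (intro connectedD) auto
  moreover obtain x where "x \<in> C" "x \<in> pencil_lune t" using component_pencil_lune_meets[OF assms] by blast
  moreover obtain y where y: "y \<in> C" "y \<notin> pencil_lune t" using component_pencil_lune_not_subset[OF assms] by blast
  moreover have "y \<in> pencil_lune s" using y C by blast
  then have "t * (g y \<bullet> e1) < g y \<bullet> e2" using y neg by (auto simp: mem_pencil_lune neq_iff)
  ultimately show False by (auto simp: mem_pencil_lune)
qed

text \<open>Every component crosses the half circle of slope \<open>t\<close>, whose preimage
  becomes the compact set \<open>L\<close> once the corners are added. Each point of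
  \<open>L\<close> has a neighbourhood meeting at most one component: inside the lune because
  components are open, over a corner by \<open>nice_at_poles\<close>. Finitely many such
  neighbourhoods cover \<open>L\<close>.\<close>

lemma finite_components_pencil_lune:
  assumes "\<not> connected (pencil_lune s)"
  shows "finite (components (pencil_lune s))"
proof -
  define t where "t = s - 1"
  have "t < s" by (simp add: t_def)
  define L where "L = closed_shadow e1 \<inter> closed_shadow (e2 - t *\<^sub>R e1) \<inter> closed_shadow (t *\<^sub>R e1 - e2)"
  have mem_L: "x \<in> L \<longleftrightarrow> x \<in> S2 \<and> 0 \<le> g x \<bullet> e1 \<and> g x \<bullet> e2 = t * (g x \<bullet> e1)" for x
    by (auto simp: L_def closed_shadow_def inner_diff_right)
  have "compact L" by (simp add: L_def compact_closed_shadow compact_Int)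
  have "\<exists>T c. open T \<and> x \<in> T \<and> (\<forall>y \<in> T \<inter> pencil_lune s. connected_component_set (pencil_lune s) y = c)" if x: "x \<in> L" for x
  proof (cases "0 < g x \<bullet> e1")
    case True
    then have "t * (g x \<bullet> e1) < s * (g x \<bullet> e1)" using \<open>t < s\<close> by simp
    then have xO: "x \<in> pencil_lune s" using x True by (auto simp: mem_pencil_lune mem_L)
    then have "openin (top_of_set S2) (connected_component_set (pencil_lune s) x)"
      using openin_connected_component_locally_connected[OF locally_connected_pencil_lune] openin_pencil_lune openin_trans by blast
    then obtain T where T: "open T" "connected_component_set (pencil_lune s) x = S2 \<inter> T"
      by (auto simp: openin_open)
    have "x \<in> T" using T xO connected_component_refl by (metis IntD2 mem_Collect_eq)
    moreover have "connected_component_set (pencil_lune s) y = connected_component_set (pencil_lune s) x" if "y \<in> T \<inter> pencil_lune s" for y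
      using that T by (metis IntD1 IntD2 IntI connected_component_eq mem_pencil_lune)
    ultimately show ?thesis using T by blast
  next
    case False
    then have "g x \<bullet> e1 = 0" "g x \<bullet> e2 = 0" using x by (auto simp: mem_L)
    then obtain N where N: "openin (top_of_set S2) N" "x \<in> N" "connected (N \<inter> open_shadow e1 \<inter> open_shadow (s *\<^sub>R e1 - e2))"
      using nice_at_poles x mem_L by metis
    then obtain T where T: "open T" "N = S2 \<inter> T" by (auto simp: openin_open)
    have con: "connected (T \<inter> pencil_lune s)"
    proof -
      have "T \<inter> pencil_lune s = N \<inter> open_shadow e1 \<inter> open_shadow (s *\<^sub>R e1 - e2)"
        using T open_shadow_subset by (auto simp: pencil_lune_def slope_side_def)
      then show ?thesis using N by simp
    qed
    have "connected_component_set (pencil_lune s) y = connected_component_set (pencil_lune s) z"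
      if "y \<in> T \<inter> pencil_lune s" "z \<in> T \<inter> pencil_lune s" for y z
    proof -
      have "connected_component (pencil_lune s) y z"
        unfolding connected_component_def using con that by blast
      then show ?thesis by (rule connected_component_eq[symmetric, of _ "pencil_lune s" y, simplified])
    qed
    then show ?thesis using T N by (metis (no_types, lifting) Int_iff)
  qed
  then obtain T c where Tc: "\<And>x. x \<in> L \<Longrightarrow> open (T x) \<and> x \<in> T x \<and>
      (\<forall>y \<in> T x \<inter> pencil_lune s. connected_component_set (pencil_lune s) y = c x)"
    by metis
  obtain D where D: "D \<subseteq> L" "finite D" "L \<subseteq> (\<Union>x\<in>D. T x)"
  proof (rule compactE_image[OF \<open>compact L\<close>, of L T])
    show "\<And>x. x \<in> L \<Longrightarrow> open (T x)" "L \<subseteq> (\<Union>x\<in>L. T x)" using Tc by blast+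
  qed auto
  have "components (pencil_lune s) \<subseteq> c ` D"
  proof
    fix C assume C: "C \<in> components (pencil_lune s)"
    then obtain y where y: "y \<in> C" "g y \<bullet> e2 = t * (g y \<bullet> e1)"
      using component_pencil_lune_meets_circle[OF assms _ \<open>t < s\<close>] by blast
    have "y \<in> pencil_lune s" using y C component_pencil_lune_facts by blast
    then have "y \<in> L" using y by (simp add: mem_L mem_pencil_lune)
    then obtain x where x: "x \<in> D" "y \<in> T x" using D by blast
    have "connected_component_set (pencil_lune s) y = c x" using Tc[of x] x D \<open>y \<in> pencil_lune s\<close> by blast
    moreover have "connected_component_set (pencil_lune s) y = C"
      using C y by (metis joinable_components_eq component_pencil_lune_facts(1) connected_component_eq componentsE)
    ultimately show "C \<in> c ` D" using x by blast
  qed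
  then show ?thesis using D(2) finite_surj by blast
qed

lemma compact_subset_Union_pencil_lune:
  assumes "compact K" "K \<subseteq> (\<Union>s\<in>J. pencil_lune s)" "J \<noteq> {}"
  shows "\<exists>s\<in>J. K \<subseteq> pencil_lune s"
proof -
  have "K \<subseteq> S2" using assms(2) by (auto simp: mem_pencil_lune)
  define H where "H s = {y. 0 < y \<bullet> e1} \<inter> {y. y \<bullet> e2 < s * (y \<bullet> e1)}" for s
  have H: "x \<in> pencil_lune s \<longleftrightarrow> x \<in> S2 \<and> g x \<in> H s" for x s by (simp add: mem_pencil_lune H_def)
  have "open (H s)" for s
    unfolding H_def by (intro open_Int open_Collect_less continuous_intros)
  moreover have "compact (g ` K)"
    using assms(1) \<open>K \<subseteq> S2\<close> by (intro compact_continuous_image continuous_on_subset[OF cont])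
  moreover have "g ` K \<subseteq> (\<Union>s\<in>J. H s)" using assms(2) H by blast
  ultimately obtain D where D: "D \<subseteq> J" "finite D" "g ` K \<subseteq> (\<Union>s\<in>D. H s)"
    using compactE_image[of "g ` K" J H] by metis
  show ?thesis
  proof (cases "D = {}")
    case True
    then show ?thesis using D assms(3) by auto
  next
    case False
    have "K \<subseteq> pencil_lune (Max D)"
    proof
      fix x assume "x \<in> K"
      then obtain s where "s \<in> D" "x \<in> pencil_lune s" using D(3) \<open>K \<subseteq> S2\<close> H by blast
      then show "x \<in> pencil_lune (Max D)" using pencil_lune_mono[of s "Max D"] D(2) by auto
    qed
    then show ?thesis using D False by (meson Max_in subsetD)
  qed
qed

text \<open>If the union were connected, it would be path connected. Paths from a base point to one
  point in each of the finitely many components of lune \<open>s0\<close> are compact, so all fit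
  into a single lune \<open>s\<close> of the family. Then lune \<open>s0\<close> lies in one
  component of lune \<open>s\<close>; as every component of lune \<open>s\<close> reaches back into
  lune \<open>s0\<close>, lune \<open>s\<close> would be connected.\<close>

lemma increasing_union_pencil_lune_disconnected:
  assumes "\<And>s. s \<in> J \<Longrightarrow> \<not> connected (pencil_lune s)" "J \<noteq> {}"
  shows "\<not> connected (\<Union>s\<in>J. pencil_lune s)"
proof
  define Q where "Q = (\<Union>s\<in>J. pencil_lune s)"
  assume "connected (\<Union>s\<in>J. pencil_lune s)"
  then have Q: "connected Q" by (simp add: Q_def)
  obtain s0 where s0: "s0 \<in> J" using assms(2) by blast
  have "openin (top_of_set S2) Q" unfolding Q_def by (intro openin_Union) (auto intro: openin_pencil_lune)
  then have lpc: "locally path_connected Q"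
    using locally_open_subset locally_path_connected_sphere by blast
  obtain x0 where x0: "x0 \<in> pencil_lune s0" using pencil_lune_nonempty by blast
  have "\<exists>s\<in>J. connected_component (pencil_lune s) x0 x" if "x \<in> pencil_lune s0" for x
  proof -
    have "x0 \<in> Q" "x \<in> Q" using s0 x0 that by (auto simp: Q_def)
    then have "connected_component Q x0 x"
      using Q by (meson connected_iff_connected_component)
    then have "path_component Q x0 x"
      using path_component_eq_connected_component[OF lpc] by simp
    then obtain p where p: "path p" "path_image p \<subseteq> Q" "pathstart p = x0" "pathfinish p = x"
      by (auto simp: path_component_def)
    then obtain s where "s \<in> J" "path_image p \<subseteq> pencil_lune s"
      using compact_subset_Union_pencil_lune[of "path_image p" J] assms(2) compact_path_image by (auto simp: Q_def)
    then show ?thesis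
      using p connected_path_image pathstart_in_path_image pathfinish_in_path_image
      unfolding connected_component_def by metis
  qed
  then obtain r where r: "\<And>x. x \<in> pencil_lune s0 \<Longrightarrow> r x \<in> J \<and> connected_component (pencil_lune (r x)) x0 x" by metis
  have "\<exists>x. x \<in> C" if "C \<in> components (pencil_lune s0)" for C using component_pencil_lune_facts[OF that] by blast
  then obtain pt where pt: "\<And>C. C \<in> components (pencil_lune s0) \<Longrightarrow> pt C \<in> C" by metis
  \<comment> \<open>Finiteness of the set of components is used here, to have a maximum; including
    \<open>s0\<close> ensures that lune \<open>s\<close> contains lune \<open>s0\<close>.\<close>
  define R where "R = insert s0 ((\<lambda>C. r (pt C)) ` components (pencil_lune s0))"
  define s where "s = Max R"
  have fin: "finite R" using finite_components_pencil_lune assms(1) s0 by (simp add: R_def)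
  have ptO: "pt C \<in> pencil_lune s0" if "C \<in> components (pencil_lune s0)" for C
    using pt[OF that] component_pencil_lune_facts(1)[OF that] by blast
  have "R \<subseteq> J" using s0 r ptO by (auto simp: R_def)
  have "s \<in> R" unfolding s_def by (rule Max_in[OF fin]) (simp add: R_def)
  then have "s \<in> J" using \<open>R \<subseteq> J\<close> by blast
  have le: "t \<le> s" if "t \<in> R" for t using that fin by (simp add: s_def)
  have "connected_component (pencil_lune s) x0 y" if y: "y \<in> pencil_lune s" for y
  proof -
    define D where "D = connected_component_set (pencil_lune s) y"
    have D: "D \<in> components (pencil_lune s)" using y by (auto simp: D_def components_def)
    have "D \<inter> pencil_lune s0 \<noteq> {}"
    proof (cases "s0 = s")
      case True
      then have "y \<in> D \<inter> pencil_lune s0" using y connected_component_refl[OF y] by (simp add: D_def)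
      then show ?thesis by blast
    next
      case False
      then have "s0 < s" using le[of s0] by (simp add: R_def)
      then show ?thesis using component_pencil_lune_meets[OF assms(1)[OF \<open>s \<in> J\<close>] D] by blast
    qed
    then obtain z where z: "z \<in> pencil_lune s0" "connected_component (pencil_lune s) y z" by (auto simp: D_def)
    define C where "C = connected_component_set (pencil_lune s0) z"
    have C: "C \<in> components (pencil_lune s0)" using z by (auto simp: C_def components_def)
    have "connected_component (pencil_lune s0) z (pt C)" using pt[OF C] by (simp add: C_def)
    then have "connected_component (pencil_lune s) z (pt C)"
      using pencil_lune_mono[OF le[of s0]] connected_component_of_subset by (metis R_def insertI1)
    moreover have "r (pt C) \<in> R" using C by (simp add: R_def)
    then have "connected_component (pencil_lune s) x0 (pt C)"
      using r[OF ptO[OF C]] pencil_lune_mono[OF le] connected_component_of_subset by metis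
    ultimately show ?thesis
      using z by (meson connected_component_sym connected_component_trans)
  qed
  then have "connected (pencil_lune s)"
    by (meson connected_component_sym connected_component_trans connected_iff_connected_component)
  then show False using assms(1) \<open>s \<in> J\<close> by blast
qed

text \<open>Closed lunes behave well under decreasing limits and open ones under increasing limits.
  As the two are connected simultaneously, a maximal interval of bad slopes is half open to the
  right, which contradicts \<open>increasing_union_pencil_lune_disconnected\<close> at its right end.\<close>

lemma connected_pencil_lune: "connected (pencil_lune s1)"
proof (rule ccontr)
  assume bad: "\<not> connected (pencil_lune s1)"
  \<comment> \<open>The good slopes above \<open>s1\<close>; \<open>J\<close> collects the slopes
    from \<open>s1\<close> on that lie strictly below all of them, hence are all bad.\<close>
  define Gd where "Gd = {s. s1 < s \<and> connected (pencil_lune s)}"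
  define J where "J = {s. s1 \<le> s \<and> (\<forall>r\<in>Gd. s < r)}"
  have bad_J: "\<not> connected (pencil_lune s)" if "s \<in> J" for s
    using that bad by (metis (mono_tags, lifting) Gd_def J_def less_irrefl mem_Collect_eq order_le_less)
  have "s1 \<in> J" by (auto simp: J_def Gd_def)
  have "connected (\<Union>s\<in>J. pencil_lune s)"
  \<comment> \<open>Without good slopes the union is the whole shadow of \<open>e1\<close>.
    Otherwise it is the lune at the infimum \<open>c\<close>, which is good because the opposite
    closed lunes decrease to that of \<open>c\<close>.\<close>
  proof (cases "Gd = {}")
    case True
    have "(\<Union>s\<in>J. pencil_lune s) = open_shadow e1"
    proof (intro subset_antisym subsetI)
      fix x assume x: "x \<in> open_shadow e1"
      define s where "s = max s1 (g x \<bullet> e2 / (g x \<bullet> e1) + 1)"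
      have "g x \<bullet> e2 / (g x \<bullet> e1) < s" by (simp add: s_def)
      then have "x \<in> pencil_lune s" using x by (auto simp: mem_pencil_lune open_shadow_def pos_divide_less_eq)
      moreover have "s \<in> J" using True by (simp add: J_def s_def)
      ultimately show "x \<in> (\<Union>s\<in>J. pencil_lune s)" by blast
    qed (auto simp: pencil_lune_def)
    then show ?thesis using connected_open_shadow by simp
  next
    case False
    have bdd: "bdd_below Gd" by (rule bdd_belowI[of _ s1]) (auto simp: Gd_def)
    define c where "c = Inf Gd"
    have cle: "c \<le> s" if "s \<in> Gd" for s using that bdd by (simp add: c_def cInf_lower)
    have "s1 \<le> c" unfolding c_def by (rule cInf_greatest[OF False]) (auto simp: Gd_def)
    have "connected (\<Inter>(opposite_lune ` Gd))"
    proof (rule connected_chain)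
      show "\<And>S. S \<in> opposite_lune ` Gd \<Longrightarrow> compact S \<and> connected S"
        using compact_opposite_lune connected_pencil_lune_iff by (auto simp: Gd_def)
      fix S T assume "S \<in> opposite_lune ` Gd \<and> T \<in> opposite_lune ` Gd"
      then obtain a b where ab: "S = opposite_lune a" "T = opposite_lune b" by blast
      have "opposite_lune a \<subseteq> opposite_lune b" if "a \<le> b" for a b
        using that by (auto simp: mem_opposite_lune) (meson mult_right_mono_neg order_trans)
      then show "S \<subseteq> T \<or> T \<subseteq> S" using ab linear[of a b] by metis
    qed
    also have "\<Inter>(opposite_lune ` Gd) = opposite_lune c"
    proof (intro subset_antisym subsetI)
      fix x assume x: "x \<in> \<Inter>(opposite_lune ` Gd)"
      then have x1: "x \<in> S2" "g x \<bullet> e1 \<le> 0" "\<And>s. s \<in> Gd \<Longrightarrow> s * (g x \<bullet> e1) \<le> g x \<bullet> e2"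
        using False by (auto simp: mem_opposite_lune)
      have "c * (g x \<bullet> e1) \<le> g x \<bullet> e2"
      proof (cases "g x \<bullet> e1 = 0")
        case True
        then show ?thesis using x1(3) False by auto
      next
        case neg: False
        then have "g x \<bullet> e1 < 0" using x1(2) by simp
        then have "g x \<bullet> e2 / (g x \<bullet> e1) \<le> c"
          unfolding c_def using x1(3) False by (intro cInf_greatest) (auto simp: neg_divide_le_eq)
        then show ?thesis using \<open>g x \<bullet> e1 < 0\<close> by (simp add: neg_divide_le_eq)
      qed
      then show "x \<in> opposite_lune c" using x1 by (simp add: mem_opposite_lune)
    next
      fix x assume "x \<in> opposite_lune c"
      then show "x \<in> \<Inter>(opposite_lune ` Gd)"
        using cle by (auto simp: mem_opposite_lune) (meson mult_right_mono_neg order_trans)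
    qed
    finally have con: "connected (pencil_lune c)" by (simp add: connected_pencil_lune_iff)
    have J: "J = {s. s1 \<le> s \<and> s < c}"
    proof (intro subset_antisym subsetI)
      fix s assume "s \<in> J"
      then have "s1 \<le> s" "\<And>r. r \<in> Gd \<Longrightarrow> s \<le> r" by (auto simp: J_def intro: less_imp_le)
      then have "s \<le> c" unfolding c_def by (intro cInf_greatest[OF False]) 
      moreover have "s \<noteq> c" using con bad_J \<open>s \<in> J\<close> by blast
      ultimately show "s \<in> {s. s1 \<le> s \<and> s < c}" using \<open>s1 \<le> s\<close> by simp
    next
      fix s assume "s \<in> {s. s1 \<le> s \<and> s < c}"
      then show "s \<in> J" using cle by (force simp: J_def)
    qed
    have "(\<Union>s\<in>J. pencil_lune s) = pencil_lune c"
    proof (intro subset_antisym subsetI)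
      fix x assume x: "x \<in> pencil_lune c"
      have "s1 < c" using \<open>s1 \<in> J\<close> J by simp
      have gx: "0 < g x \<bullet> e1" "g x \<bullet> e2 / (g x \<bullet> e1) < c" "x \<in> S2"
        using x by (auto simp: mem_pencil_lune pos_divide_less_eq)
      then obtain s where "max s1 (g x \<bullet> e2 / (g x \<bullet> e1)) < s" "s < c"
        using dense[of "max s1 (g x \<bullet> e2 / (g x \<bullet> e1))" c] \<open>s1 < c\<close> by auto
      then have "x \<in> pencil_lune s" "s \<in> J" using gx by (auto simp: mem_pencil_lune pos_divide_less_eq J)
      then show "x \<in> (\<Union>s\<in>J. pencil_lune s)" by blast
    qed (use pencil_lune_mono J in \<open>auto dest: less_imp_le\<close>)
    then show ?thesis using con by simp
  qed
  then show False using increasing_union_pencil_lune_disconnected[of J] bad_J \<open>s1 \<in> J\<close> by blast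
qed

end

section \<open>Connectedness of fibres\<close>

text \<open>Only the line through \<open>v\<close> matters. Density is stated for open sets of space
  rather than of the sphere, because the exceptional \<open>v\<close> will form a cone of measure
  zero in space.\<close>

locale nice_shadow_map = shadow_map_poles +
  assumes nice_dense: "\<And>U. open U \<Longrightarrow> U \<noteq> {} \<Longrightarrow> \<exists>v\<in>U. v \<noteq> 0 \<and>
    (\<forall>p\<in>S2. (\<exists>c. g p = c *\<^sub>R v) \<longrightarrow>
      (\<exists>N. openin (top_of_set S2) N \<and> p \<in> N \<and> (\<forall>a b. connected (N \<inter> open_shadow a \<inter> open_shadow b))))"
begin

text \<open>Let \<open>x\<close> lie in the open lune and \<open>p\<close> in a piece of the closed
  lune away from \<open>x\<close>. Tilting both half spaces towards \<open>g p\<close> places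
  \<open>p\<close> in the open lune as well, after which the separation is stable under small
  changes of the two vectors. These suffice to turn the corners into a generic direction, where
  \<open>lune_pencil\<close> applies.\<close>

lemma connected_closed_lune:
  assumes "0 \<notin> closed_segment a b"
  shows "connected (closed_shadow a \<inter> closed_shadow b)"
proof (rule ccontr)
  assume disc: "\<not> connected (closed_shadow a \<inter> closed_shadow b)"
  have "closed (closed_shadow a \<inter> closed_shadow b)" by (simp add: closed_closed_shadow closed_Int)
  then obtain A B where AB: "closed A" "closed B" "A \<noteq> {}" "B \<noteq> {}" "A \<union> B = closed_shadow a \<inter> closed_shadow b" "A \<inter> B = {}"
    using connected_closed_set disc by metis
  obtain x where x: "x \<in> open_shadow a" "x \<in> open_shadow b" using open_shadow_Int_nonempty[OF assms] by blast
  then have "x \<in> A \<or> x \<in> B" using AB(5) open_shadow_subset_closed_shadow by blast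
  then obtain G H where GH: "closed G" "closed H" "H \<noteq> {}" "G \<union> H = closed_shadow a \<inter> closed_shadow b" "G \<inter> H = {}" "x \<in> G"
  proof (cases "x \<in> A")
    case True
    then show ?thesis using that[of A B] AB by blast
  next
    case False
    with \<open>x \<in> A \<or> x \<in> B\<close> show ?thesis using that[of B A] AB by blast
  qed
  obtain p where p: "p \<in> H" using GH by blast
  obtain U V where UV: "open U" "open V" "G \<subseteq> U" "H \<subseteq> V" "U \<inter> V = {}"
    using separation_normal[OF GH(1,2,5)] by metis
  define K where "K = S2 - (U \<union> V)"
  have "compact K" unfolding K_def using UV by (simp add: compact_diff open_Un)
  moreover have "continuous_on K (\<lambda>y. min (g y \<bullet> a) (g y \<bullet> b))"
    by (intro continuous_on_min continuous_on_height) (auto simp: K_def)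
  moreover have "min (g y \<bullet> a) (g y \<bullet> b) < 0" if "y \<in> K" for y
  proof (rule ccontr)
    assume "\<not> min (g y \<bullet> a) (g y \<bullet> b) < 0"
    then have "0 \<le> g y \<bullet> a" "0 \<le> g y \<bullet> b" by auto
    then have "y \<in> closed_shadow a \<inter> closed_shadow b" using that by (simp add: K_def closed_shadow_def)
    then have "y \<in> U \<union> V" using GH(4) UV(3,4) by blast
    then show False using that by (simp add: K_def)
  qed
  ultimately obtain \<delta> where \<delta>: "\<delta> > 0" "\<And>y. y \<in> K \<Longrightarrow> min (g y \<bullet> a) (g y \<bullet> b) \<le> - \<delta>"
    using compact_neg_bounded_away[of K "\<lambda>y. min (g y \<bullet> a) (g y \<bullet> b)"] by blast
  have gx: "0 < g x \<bullet> a" "0 < g x \<bullet> b" "x \<in> S2" using x by (auto simp: open_shadow_def)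
  have gp: "0 \<le> g p \<bullet> a" "0 \<le> g p \<bullet> b" "p \<in> S2" using p GH(4) by (auto simp: closed_shadow_def)
  \<comment> \<open>The tilt changes \<open>g y \<bullet> a\<close> by at most
    \<open>\<epsilon>\<close> and the later move of the corners by less than
    \<open>\<epsilon>\<close>; hence the factor 2 in the bounds.\<close>
  define \<epsilon> where "\<epsilon> = min \<delta> (min (g x \<bullet> a) (g x \<bullet> b)) / 2"
  have \<epsilon>: "0 < \<epsilon>" "2 * \<epsilon> \<le> \<delta>" "2 * \<epsilon> \<le> g x \<bullet> a" "2 * \<epsilon> \<le> g x \<bullet> b" using \<delta> gx by (auto simp: \<epsilon>_def)
  define a1 where "a1 = a + \<epsilon> *\<^sub>R g p"
  define b1 where "b1 = b + \<epsilon> *\<^sub>R g p"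
  have bd: "\<bar>g y \<bullet> (c' - c)\<bar> < 2 * \<epsilon>" "g p \<bullet> c < g p \<bullet> c'" if "y \<in> S2" "norm (c' - (c + \<epsilon> *\<^sub>R g p)) < \<epsilon>" for y c c'
  proof -
    have eq: "z \<bullet> (c' - c) = z \<bullet> (c' - (c + \<epsilon> *\<^sub>R g p)) + \<epsilon> * (z \<bullet> g p)" for z
      by (simp add: inner_add_right inner_diff_right)
    have 1: "\<bar>g q \<bullet> (c' - (c + \<epsilon> *\<^sub>R g p))\<bar> < \<epsilon>" if "q \<in> S2" for q
      using inner_g_bound[OF that] \<open>norm (c' - (c + \<epsilon> *\<^sub>R g p)) < \<epsilon>\<close> by (rule le_less_trans)
    have "\<bar>\<epsilon> * (g y \<bullet> g p)\<bar> \<le> \<epsilon>"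
      using inner_g_bound[OF that(1), of "g p"] norm_g[OF gp(3)] \<epsilon>
      by (simp add: abs_mult mult_le_cancel_left1)
    then show "\<bar>g y \<bullet> (c' - c)\<bar> < 2 * \<epsilon>" using eq[of "g y"] 1[OF that(1)] by linarith
    have "g p \<bullet> g p = 1" using norm_g[OF gp(3)] by (simp add: dot_square_norm)
    then have "0 < g p \<bullet> (c' - c)" using eq[of "g p"] 1[OF gp(3)] by simp
    then show "g p \<bullet> c < g p \<bullet> c'" by (simp add: inner_diff_right)
  qed
  have near: "\<not> connected (closed_shadow a2 \<inter> closed_shadow b2)" "0 < g x \<bullet> a2" "0 < g x \<bullet> b2"
    if "norm (a2 - a1) < \<epsilon>" "norm (b2 - b1) < \<epsilon>" for a2 b2
  proof -
    note a2 = bd[of _ a2 a, folded a1_def, OF _ that(1)] and b2 = bd[of _ b2 b, folded b1_def, OF _ that(2)]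
    show gx2: "0 < g x \<bullet> a2" "0 < g x \<bullet> b2"
      using a2(1)[OF gx(3)] b2(1)[OF gx(3)] \<epsilon> by (auto simp: inner_diff_right)
    then have "x \<in> closed_shadow a2 \<inter> closed_shadow b2" using gx by (simp add: closed_shadow_def)
    moreover have "p \<in> closed_shadow a2 \<inter> closed_shadow b2" using gp a2(2)[OF gp(3)] b2(2)[OF gp(3)] by (auto simp: closed_shadow_def)
    moreover have "closed_shadow a2 \<inter> closed_shadow b2 \<subseteq> U \<union> V"
    proof
      fix y assume "y \<in> closed_shadow a2 \<inter> closed_shadow b2"
      then have y: "y \<in> S2" "0 \<le> g y \<bullet> a2" "0 \<le> g y \<bullet> b2" by (auto simp: closed_shadow_def)
      have "- \<delta> < g y \<bullet> a" "- \<delta> < g y \<bullet> b"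
        using a2(1)[OF y(1)] b2(1)[OF y(1)] y \<epsilon>(2) by (auto simp: inner_diff_right)
      then have "y \<notin> K" using \<delta>(2)[of y] by auto
      then show "y \<in> U \<union> V" using y(1) by (simp add: K_def)
    qed
    moreover have "x \<in> U" "p \<in> V" using GH UV p by auto
    ultimately show "\<not> connected (closed_shadow a2 \<inter> closed_shadow b2)"
      using UV connectedD[of "closed_shadow a2 \<inter> closed_shadow b2" U V] by blast
  qed
  \<comment> \<open>Parallel vectors would both be positive at \<open>x\<close>, so their lune would
    be a single closed shadow, which is connected.\<close>
  have coll: "cross3 a2 b2 \<noteq> 0" if "norm (a2 - a1) < \<epsilon>" "norm (b2 - b1) < \<epsilon>" for a2 b2
  proof
    assume "cross3 a2 b2 = 0"
    then have "a2 = 0 \<or> b2 = 0 \<or> (\<exists>c. b2 = c *\<^sub>R a2)" by (simp add: cross_eq_0 collinear_lemma)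
    moreover have "0 < g x \<bullet> a2" "0 < g x \<bullet> b2" using near(2,3)[OF that] .
    ultimately have "a2 \<noteq> 0" "\<exists>c. b2 = c *\<^sub>R a2" by auto
    then obtain c where c: "b2 = c *\<^sub>R a2" "a2 \<noteq> 0" by blast
    then have "0 < c" using \<open>0 < g x \<bullet> a2\<close> \<open>0 < g x \<bullet> b2\<close> by (simp add: zero_less_mult_iff)
    then have "closed_shadow a2 \<inter> closed_shadow b2 = closed_shadow a2" using c by (auto simp: closed_shadow_def)
    then show False using near(1)[OF that] connected_closed_shadow'[OF c(2)] by simp
  qed
  define v0 where "v0 = cross3 a1 b1"
  have "v0 \<noteq> 0" using coll[of a1 b1] \<epsilon> by (simp add: v0_def)
  \<comment> \<open>The orthogonal projection along \<open>v\<close>. It fixes \<open>a1\<close> and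
    \<open>b1\<close> for \<open>v = v0\<close> and depends continuously on \<open>v\<close>, so a
    generic \<open>v\<close> near \<open>v0\<close> yields nearby vectors whose lune has its corners
    on the line through \<open>v\<close>.\<close>
  define pr where "pr c v = c - ((c \<bullet> v) / (v \<bullet> v)) *\<^sub>R v" for c v :: "real^3"
  have orth: "v \<bullet> pr c v = 0" if "v \<noteq> 0" for c v
    using that by (simp add: pr_def inner_diff_right inner_commute)
  have "(\<lambda>v. pr c v) \<midarrow>v0\<rightarrow> pr c v0" for c
    unfolding pr_def using \<open>v0 \<noteq> 0\<close> by (intro tendsto_intros) auto
  moreover have "pr a1 v0 = a1" "pr b1 v0 = b1"
    by (simp_all add: pr_def v0_def dot_cross_self)
  ultimately have "(pr a1 \<longlongrightarrow> a1) (at v0)" "(pr b1 \<longlongrightarrow> b1) (at v0)" by metis+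
  then have "\<forall>\<^sub>F v in at v0. dist (pr a1 v) a1 < \<epsilon> \<and> dist (pr b1 v) b1 < \<epsilon>"
    by (intro eventually_conj tendstoD \<epsilon>(1))
  then obtain W where W: "open W" "v0 \<in> W"
    "\<And>v. v \<in> W \<Longrightarrow> v \<noteq> v0 \<Longrightarrow> dist (pr a1 v) a1 < \<epsilon> \<and> dist (pr b1 v) b1 < \<epsilon>"
    unfolding eventually_at_topological by blast
  obtain v where v: "v \<in> W" "v \<noteq> 0" and nice: "\<And>q c. q \<in> S2 \<Longrightarrow> g q = c *\<^sub>R v \<Longrightarrow>
      (\<exists>N. openin (top_of_set S2) N \<and> q \<in> N \<and> (\<forall>a b. connected (N \<inter> open_shadow a \<inter> open_shadow b)))"
    using nice_dense[OF W(1)] W(2) by blast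
  define a2 where "a2 = pr a1 v"
  define b2 where "b2 = pr b1 v"
  have "dist a2 a1 < \<epsilon> \<and> dist b2 b1 < \<epsilon>"
    using W(3)[OF v(1)] \<open>pr a1 v0 = a1\<close> \<open>pr b1 v0 = b1\<close> \<epsilon>(1)
    by (cases "v = v0") (auto simp: a2_def b2_def)
  then have ab2: "norm (a2 - a1) < \<epsilon>" "norm (b2 - b1) < \<epsilon>" by (auto simp: dist_norm)
  \<comment> \<open>With these signs \<open>opposite_lune 0\<close> is exactly the closed lune of
    \<open>a2\<close> and \<open>b2\<close>.\<close>
  interpret lp: lune_pencil g "- a2" b2
  proof
    show "cross3 (- a2) b2 \<noteq> 0" using coll[OF ab2] by simp
    fix q assume q: "q \<in> S2" "g q \<bullet> - a2 = 0" "g q \<bullet> b2 = 0"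
    have "\<exists>c. g q = c *\<^sub>R v"
      by (rule orthogonal_pair_unique_direction[OF coll[OF ab2]])
         (use q v orth in \<open>auto simp: a2_def b2_def\<close>)
    then show "\<exists>N. openin (top_of_set S2) N \<and> q \<in> N \<and> (\<forall>a b. connected (N \<inter> open_shadow a \<inter> open_shadow b))"
      using nice q(1) by blast
  qed
  have "connected (lp.opposite_lune 0)" using lp.connected_pencil_lune lp.connected_pencil_lune_iff by blast
  then show False using near(1)[OF ab2] by (simp add: lp.opposite_lune_def)
qed

lemma connected_open_lune:
  assumes "0 \<notin> closed_segment a b"
  shows "connected (open_shadow a \<inter> open_shadow b)"
proof -
  have "0 \<notin> closed_segment (- a) (- b)"
  proof
    assume "0 \<in> closed_segment (- a) (- b)"
    then obtain t where t: "0 \<le> t" "t \<le> 1" "0 = (1 - t) *\<^sub>R (- a) + t *\<^sub>R (- b)"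
      unfolding in_segment by blast
    have "- 0 = - ((1 - t) *\<^sub>R (- a) + t *\<^sub>R (- b))" using t(3) by (rule arg_cong)
    also have "\<dots> = (1 - t) *\<^sub>R a + t *\<^sub>R b" by simp
    finally have "0 = (1 - t) *\<^sub>R a + t *\<^sub>R b" by simp
    then show False using assms t(1,2) unfolding in_segment by blast
  qed
  then show ?thesis using connected_closed_lune connected_lune_iff[OF assms] by blast
qed

text \<open>Intersect the closed lune of \<open>- a\<close>, \<open>- b\<close> with the closed
  shadow of \<open>- c\<close> by the dual of Janiszewski's theorem. The complement of their union
  consists of two open lunes, which overlap because the three open shadows have a common point. The
  vector \<open>v\<close> keeps 0 off all segments between \<open>a\<close>, \<open>b\<close> and
  \<open>c\<close>.\<close>

lemma connected_closed_triangle: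
  assumes "0 < v \<bullet> a" "0 < v \<bullet> b" "0 < v \<bullet> c"
  shows "connected (closed_shadow (- a) \<inter> closed_shadow (- b) \<inter> closed_shadow (- c))"
proof -
  have pos: "0 < v \<bullet> ((1 - t) *\<^sub>R y + t *\<^sub>R z)" if "0 < v \<bullet> y" "0 < v \<bullet> z" "0 \<le> t" "t \<le> 1" for t y z
  proof -
    have "0 \<le> (1 - t) * (v \<bullet> y)" "0 \<le> t * (v \<bullet> z)" using that by auto
    moreover have "0 < (1 - t) * (v \<bullet> y) \<or> 0 < t * (v \<bullet> z)" using that by (cases "t = 0") auto
    ultimately show ?thesis by (auto simp: inner_add_right)
  qed
  have seg: "0 \<notin> closed_segment y z" if "0 < v \<bullet> y" "0 < v \<bullet> z" for y z
    using pos[OF that] by (metis in_segment(1) inner_zero_right less_irrefl)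
  have "open_shadow c \<inter> open_shadow a \<inter> open_shadow b \<noteq> {}"
  proof (rule open_shadow_segment_meets)
    fix t :: real assume "0 \<le> t" "t \<le> 1"
    then have "0 \<notin> closed_segment c ((1 - t) *\<^sub>R a + t *\<^sub>R b)" by (intro seg pos assms)
    then show "connected (open_shadow c \<inter> open_shadow ((1 - t) *\<^sub>R a + t *\<^sub>R b))"
      "open_shadow c \<inter> open_shadow ((1 - t) *\<^sub>R a + t *\<^sub>R b) \<noteq> {}"
      using connected_open_lune open_shadow_Int_nonempty by blast+
  qed
  then have "connected ((open_shadow a \<inter> open_shadow c) \<union> (open_shadow b \<inter> open_shadow c))"
    by (intro connected_Un connected_open_lune seg assms) blast
  moreover have "S2 - (closed_shadow (- a) \<inter> closed_shadow (- b) \<union> closed_shadow (- c)) = (open_shadow a \<inter> open_shadow c) \<union> (open_shadow b \<inter> open_shadow c)"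
    by (auto simp: closed_shadow_def open_shadow_def)
  moreover have "connected (closed_shadow (- a) \<inter> closed_shadow (- b))"
    using connected_lune_iff connected_open_lune seg assms by blast
  moreover have "connected (closed_shadow (- c))"
    using assms by (intro connected_closed_shadow') auto
  ultimately show ?thesis
    using \<open>open_shadow c \<inter> open_shadow a \<inter> open_shadow b \<noteq> {}\<close> closed_shadow_subset
    by (intro sphere_Janiszewski_dual[of "closed_shadow (- a) \<inter> closed_shadow (- b)" "closed_shadow (- c)"])
       (auto simp: closed_closed_shadow closed_Int)
qed

text \<open>A point of the sphere is a decreasing intersection of closed triangles.\<close>

theorem connected_fibre:
  assumes "v \<in> S2"
  shows "connected {x \<in> S2. g x = v}"
proof -
  have "v \<noteq> 0" using assms by auto
  obtain w where w: "w \<noteq> 0" "v \<bullet> w = 0"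
    using orthogonal_to_vector_exists[of v] by (auto simp: orthogonal_def)
  define z where "z = cross3 v w"
  have z: "v \<bullet> z = 0" "w \<bullet> z = 0" by (simp_all add: z_def dot_cross_self)
  have "cross3 w z \<noteq> 0"
    unfolding z_def Lagrange using w \<open>v \<noteq> 0\<close> by (simp add: inner_commute)
  \<comment> \<open>The vectors \<open>w\<close>, \<open>z\<close> and \<open>- w - z\<close> add up
    to 0, so the three inequalities sum to
    \<open>0 \<le> 3 * (\<epsilon> * (g x \<bullet> v))\<close>. This makes the triangles shrink
    with \<open>\<epsilon>\<close> and keeps \<open>- v\<close> out; in the limit both
    \<open>g x \<bullet> w\<close> and \<open>g x \<bullet> z\<close> vanish.\<close>
  define T where "T \<epsilon> = closed_shadow (- (w - \<epsilon> *\<^sub>R v)) \<inter> closed_shadow (- (z - \<epsilon> *\<^sub>R v)) \<inter> closed_shadow (- (- w - z - \<epsilon> *\<^sub>R v))" for \<epsilon> :: real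
  have mem_T: "x \<in> T \<epsilon> \<longleftrightarrow> x \<in> S2 \<and> g x \<bullet> w \<le> \<epsilon> * (g x \<bullet> v) \<and> g x \<bullet> z \<le> \<epsilon> * (g x \<bullet> v) \<and>
      - (g x \<bullet> w) - g x \<bullet> z \<le> \<epsilon> * (g x \<bullet> v)" for x \<epsilon>
    by (auto simp: T_def closed_shadow_def inner_diff_right inner_add_right)
  have "connected (\<Inter> (T ` {0<..}))"
  proof (rule connected_chain)
    fix S assume "S \<in> T ` {0<..}"
    then obtain \<epsilon> where e: "0 < \<epsilon>" "S = T \<epsilon>" by auto
    have "0 < v \<bullet> v" using \<open>v \<noteq> 0\<close> by simp
    have "connected (T \<epsilon>)"
      unfolding T_def
      by (rule connected_closed_triangle[of "- v"])
         (use e w z \<open>0 < v \<bullet> v\<close> in \<open>simp_all add: inner_diff_right inner_add_right\<close>)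
    then show "compact S \<and> connected S" using e by (simp add: T_def compact_closed_shadow compact_Int)
  next
    have mono: "T \<epsilon> \<subseteq> T \<epsilon>'" if "0 < \<epsilon>" "\<epsilon> \<le> \<epsilon>'" for \<epsilon> \<epsilon>'
    proof
      fix x assume x: "x \<in> T \<epsilon>"
      then have "0 \<le> 3 * (\<epsilon> * (g x \<bullet> v))" by (auto simp: mem_T)
      then have "0 \<le> g x \<bullet> v" using that by (simp add: zero_le_mult_iff)
      then have "\<epsilon> * (g x \<bullet> v) \<le> \<epsilon>' * (g x \<bullet> v)" using that by (simp add: mult_right_mono)
      then show "x \<in> T \<epsilon>'" using x unfolding mem_T by linarith
    qed
    fix A B assume "A \<in> T ` {0<..} \<and> B \<in> T ` {0<..}"
    then obtain d e where "A = T d" "B = T e" "0 < d" "0 < e" by auto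
    then show "A \<subseteq> B \<or> B \<subseteq> A" using mono[of d e] mono[of e d] linear[of d e] by metis
  qed
  also have "\<Inter> (T ` {0<..}) = {x \<in> S2. g x = v}"
  proof (intro subset_antisym subsetI)
    fix x assume "x \<in> \<Inter> (T ` {0<..})"
    then have T: "x \<in> T \<epsilon>" if "0 < \<epsilon>" for \<epsilon> using that by blast
    then have x: "x \<in> S2" using mem_T[of x 1] by simp
    have lim: "((\<lambda>\<epsilon>. \<epsilon> * (g x \<bullet> v)) \<longlongrightarrow> 0 * (g x \<bullet> v)) (at_right 0)"
      by (intro tendsto_intros)
    have "c \<le> 0 * (g x \<bullet> v)" if "\<And>\<epsilon>. 0 < \<epsilon> \<Longrightarrow> c \<le> \<epsilon> * (g x \<bullet> v)" for c
      by (rule tendsto_lowerbound[OF lim]) (use that in \<open>auto intro!: eventually_at_rightI[of 0 1]\<close>)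
    then have "g x \<bullet> w \<le> 0" "g x \<bullet> z \<le> 0" "- (g x \<bullet> w) - g x \<bullet> z \<le> 0"
      using T unfolding mem_T by (metis mult_zero_left)+
    then have 0: "g x \<bullet> w = 0" "g x \<bullet> z = 0" by auto
    then obtain c where c: "g x = c *\<^sub>R v"
      using orthogonal_pair_unique_direction[OF \<open>cross3 w z \<noteq> 0\<close>] w z \<open>v \<noteq> 0\<close> by blast
    then have "\<bar>c\<bar> = 1" using norm_g[OF x] assms by simp
    moreover have "0 \<le> g x \<bullet> v" using T[of 1] 0 by (simp add: mem_T)
    then have "0 \<le> c" using c assms by (simp add: dot_square_norm)
    ultimately show "x \<in> {x \<in> S2. g x = v}" using c x by simp
  next
    fix x assume "x \<in> {x \<in> S2. g x = v}"
    then show "x \<in> \<Inter> (T ` {0<..})"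
      using w z by (auto simp: mem_T)
  qed
  finally show ?thesis .
qed

end

section \<open>Critical values of smooth maps on the plane\<close>

text \<open>A grid of mesh \<open>1 / N\<close> has of the order of \<open>N^2\<close> cells meeting
  a bounded planar set, and the image of each has length of the order of \<open>1 / N^3\<close>; the
  total length tends to 0.\<close>

lemma negligible_image_cubic_Holder:
  fixes F :: "real^2 \<Rightarrow> real"
  assumes "bounded T" and hol: "\<And>x y. x \<in> T \<Longrightarrow> y \<in> T \<Longrightarrow> \<bar>F x - F y\<bar> \<le> C * dist x y ^ 3"
  shows "negligible (F ` T)"
  unfolding negligible_outer_le
proof (intro allI impI)
  fix e :: real assume "0 < e"
  obtain R0 where R0: "\<And>x. x \<in> T \<Longrightarrow> norm x \<le> R0" using assms(1) by (auto simp: bounded_iff)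
  obtain R :: nat where "R0 \<le> real R" using real_arch_simple by blast
  then have R: "\<bar>x $ i\<bar> \<le> R" if "x \<in> T" for x i
    using R0[OF that] component_le_norm_cart[of x i] by linarith
  define K where "K = max C 0"
  have K: "0 \<le> K" "C \<le> K" by (auto simp: K_def)
  obtain N0 :: nat where "16 * K * (2 * R + 3)^2 / e < N0"
    using reals_Archimedean2 by blast
  then obtain N :: nat where N: "0 < N" "16 * K * (2 * R + 3)^2 / e < N"
    using that[of "Suc N0"] by auto
  define q where "q x = (\<lfloor>N * x $ 1\<rfloor>, \<lfloor>N * x $ 2\<rfloor>)" for x :: "real^2"
  let ?G = "{- int (N * R) - 1..int (N * R)} \<times> {- int (N * R) - 1..int (N * R)}"
  have sub: "q ` T \<subseteq> ?G"
  proof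
    fix z assume "z \<in> q ` T"
    then obtain x where "x \<in> T" "z = q x" by blast
    have "- int (N * R) - 1 \<le> \<lfloor>N * x $ i\<rfloor> \<and> \<lfloor>N * x $ i\<rfloor> \<le> int (N * R)" for i
    proof -
      have "\<bar>N * x $ i\<bar> \<le> of_int (int (N * R))"
        using R[OF \<open>x \<in> T\<close>, of i] by (simp add: abs_mult mult_left_mono)
      then have "of_int (- int (N * R) - 1) \<le> N * x $ i" "N * x $ i < of_int (int (N * R)) + 1"
        unfolding of_int_diff of_int_minus of_int_1 by linarith+
      then show ?thesis unfolding le_floor_iff floor_le_iff by blast
    qed
    then show "z \<in> ?G" using \<open>z = q x\<close> by (simp add: q_def)
  qed
  then have fin: "finite (q ` T)" by (rule finite_subset) simp
  have "card (q ` T) \<le> card ?G" by (rule card_mono[OF _ sub]) simp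
  also have "\<dots> = (2 * N * R + 2) ^ 2"
  proof -
    have "nat (int (N * R) - (- int (N * R) - 1) + 1) = 2 * N * R + 2" by linarith
    then show ?thesis unfolding card_cartesian_product card_atLeastAtMost_int power2_eq_square
      by (simp only: algebra_simps)
  qed
  also have "\<dots> \<le> (N * (2 * R + 3)) ^ 2"
  proof -
    have "2 \<le> N * 3" using N(1) by simp
    then show ?thesis by (intro power_mono) (auto simp: algebra_simps)
  qed
  finally have card: "real (card (q ` T)) \<le> N^2 * (2 * R + 3)^2"
    by (metis of_nat_le_iff of_nat_mult of_nat_power power_mult_distrib)
  have close: "dist x y \<le> 2 / N" if "q x = q y" for x y
  proof -
    have "\<bar>N * x $ i - N * y $ i\<bar> \<le> 1" for i
    proof -
      have "\<lfloor>N * x $ i\<rfloor> = \<lfloor>N * y $ i\<rfloor>" using that exhaust_2[of i] by (auto simp: q_def)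
      then show ?thesis by linarith
    qed
    then have "N * \<bar>x $ i - y $ i\<bar> \<le> 1" for i
      by (metis abs_mult abs_of_nat right_diff_distrib)
    then have c: "\<bar>(x - y) $ i\<bar> \<le> 1 / N" for i
      using N(1) by (simp add: field_simps)
    have "dist x y \<le> (\<Sum>i\<in>UNIV. \<bar>(x - y) $ i\<bar>)"
      unfolding dist_norm by (rule norm_le_l1_cart)
    also have "\<dots> \<le> 2 / N" using c[of 1] c[of 2] by (simp add: UNIV_2)
    finally show ?thesis .
  qed
  \<comment> \<open>Two points of a cell are at distance at most \<open>2 / N\<close>. At most
    \<open>N^2 * (2 * R + 3)^2\<close> intervals of length \<open>2 * r\<close> then have total
    length \<open>16 * K * (2 * R + 3)^2 / N\<close>, which dictated the choice of
    \<open>N\<close>.\<close>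
  define r where "r = K * (2 / N) ^ 3"
  have "0 \<le> r" using K by (simp add: r_def)
  define p where "p i = (SOME x. x \<in> T \<and> q x = i)" for i
  have p: "p i \<in> T \<and> q (p i) = i" if "i \<in> q ` T" for i
    unfolding p_def by (rule someI_ex) (use that in auto)
  define S where "S = (\<Union>i\<in>q ` T. {F (p i) - r..F (p i) + r})"
  show "\<exists>S. F ` T \<subseteq> S \<and> S \<in> lmeasurable \<and> measure lebesgue S \<le> e"
  proof (intro exI conjI)
    show "F ` T \<subseteq> S"
    proof
      fix y assume "y \<in> F ` T"
      then obtain x where x: "x \<in> T" "y = F x" by blast
      then have px: "p (q x) \<in> T" "q (p (q x)) = q x" using p by auto
      have "\<bar>F x - F (p (q x))\<bar> \<le> C * dist x (p (q x)) ^ 3" using hol x px by blast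
      also have "\<dots> \<le> K * dist x (p (q x)) ^ 3" using K by (intro mult_right_mono) auto
      also have "\<dots> \<le> r" unfolding r_def
        using close[of x "p (q x)"] px K by (intro mult_left_mono power_mono) auto
      finally have "y \<in> {F (p (q x)) - r..F (p (q x)) + r}" using x by (auto simp: abs_le_iff)
      then show "y \<in> S" using x unfolding S_def by blast
    qed
    show "S \<in> lmeasurable" unfolding S_def using fin by (intro fmeasurable_UN[of "q ` T"] fmeasurable.finite_UN) auto
    have "measure lebesgue S \<le> (\<Sum>i\<in>q ` T. measure lebesgue {F (p i) - r..F (p i) + r})"
      unfolding S_def using fin by (rule measure_UNION_le) auto
    also have "\<dots> = card (q ` T) * (2 * r)" using \<open>0 \<le> r\<close> by simp
    also have "\<dots> \<le> N^2 * (2 * R + 3)^2 * (2 * r)"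
      using card \<open>0 \<le> r\<close> by (intro mult_right_mono) auto
    also have "\<dots> = 16 * K * (2 * R + 3)^2 / N"
      using N(1) by (simp add: r_def field_simps power2_eq_square power3_eq_cube)
    also have "\<dots> \<le> e"
      using N \<open>0 < e\<close> by (simp add: field_simps)
    finally show "measure lebesgue S \<le> e" .
  qed
qed

section \<open>Mean value estimates for smooth functions\<close>

lemma smooth_on_differentiable:
  assumes "smooth_on W G" "x \<in> W"
  shows "(G has_derivative frechet_derivative G (at x)) (at x)"
  using assms frechet_derivative_works higher_differentiable_on.simps(2) unfolding smooth_on_def by metis

lemma smooth_on_frechet_derivative:
  assumes "smooth_on W G"
  shows "smooth_on W (\<lambda>x. frechet_derivative G (at x) v)"
  using assms higher_differentiable_on.simps(2) unfolding smooth_on_def by metis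

lemma smooth_on_imp_continuous_on: "smooth_on W G \<Longrightarrow> continuous_on W G"
  using higher_differentiable_on.simps(1) unfolding smooth_on_def by metis

text \<open>Smoothness controls the derivative in each fixed direction separately; this bound
  converts control of the partial derivatives into control of the operator norm.\<close>

lemma norm_linear_le_sum_Basis:
  fixes h :: "'a::euclidean_space \<Rightarrow> 'b::real_normed_vector"
  assumes "linear h"
  shows "norm (h v) \<le> (\<Sum>b\<in>Basis. norm (h b)) * norm v"
proof -
  have "h v = (\<Sum>b\<in>Basis. (v \<bullet> b) *\<^sub>R h b)"
    using linear_sum[OF assms] linear_scale[OF assms] euclidean_representation[of v]
    by (metis (no_types, lifting) sum.cong)
  then have "norm (h v) \<le> (\<Sum>b\<in>Basis. norm ((v \<bullet> b) *\<^sub>R h b))" by (metis norm_sum)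
  also have "\<dots> \<le> (\<Sum>b\<in>Basis. norm (h b) * norm v)"
  proof (intro sum_mono)
    fix b :: 'a assume "b \<in> Basis"
    then have "\<bar>v \<bullet> b\<bar> * norm (h b) \<le> norm v * norm (h b)"
      by (intro mult_right_mono Basis_le_norm) auto
    then show "norm ((v \<bullet> b) *\<^sub>R h b) \<le> norm (h b) * norm v" by (simp add: mult.commute)
  qed
  finally show ?thesis by (simp add: sum_distrib_right)
qed

lemma smooth_on_imp_Lipschitz:
  fixes G :: "'a::euclidean_space \<Rightarrow> 'b::real_normed_vector"
  assumes "smooth_on W G" "Q \<subseteq> W" "compact Q" "convex Q"
  obtains L where "0 \<le> L" "\<And>x y. x \<in> Q \<Longrightarrow> y \<in> Q \<Longrightarrow> norm (G x - G y) \<le> L * norm (x - y)"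
proof -
  define c where "c x = (\<Sum>b\<in>Basis. norm (frechet_derivative G (at x) b))" for x
  have "continuous_on Q c"
    unfolding c_def
    by (intro continuous_intros continuous_on_subset[OF smooth_on_imp_continuous_on assms(2)]
        smooth_on_frechet_derivative assms(1))
  then have "compact (c ` Q)" using assms by (intro compact_continuous_image)
  then obtain B where B: "\<And>x. x \<in> Q \<Longrightarrow> c x \<le> B"
    using compact_imp_bounded bounded_real by (metis (no_types, lifting) abs_le_D1 image_eqI)
  define L where "L = max B 0"
  have "norm (G x - G y) \<le> L * norm (x - y)" if "x \<in> Q" "y \<in> Q" for x y
  proof (rule differentiable_bound[OF assms(4)])
    show d: "(G has_derivative frechet_derivative G (at z)) (at z within Q)" if "z \<in> Q" for z
      using smooth_on_differentiable assms that has_derivative_at_withinI by blast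
    show "onorm (frechet_derivative G (at z)) \<le> L" if "z \<in> Q" for z
    proof (rule onorm_bound)
      show "0 \<le> L" by (simp add: L_def)
      fix v
      have "norm (frechet_derivative G (at z) v) \<le> c z * norm v"
        unfolding c_def using d[OF that] has_derivative_linear by (intro norm_linear_le_sum_Basis) 
      also have "\<dots> \<le> L * norm v" using B[OF that] by (intro mult_right_mono) (auto simp: L_def)
      finally show "norm (frechet_derivative G (at z) v) \<le> L * norm v" .
    qed
  qed (use that in auto)
  moreover have "0 \<le> L" by (simp add: L_def)
  ultimately show thesis using that by blast
qed

lemma has_real_derivative_along_segment:
  fixes G :: "'a::euclidean_space \<Rightarrow> real"
  assumes "smooth_on W G" "x + t *\<^sub>R d \<in> W"
  shows "((\<lambda>t. G (x + t *\<^sub>R d)) has_real_derivative frechet_derivative G (at (x + t *\<^sub>R d)) d) (at t)"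
proof -
  have D: "(G has_derivative frechet_derivative G (at (x + t *\<^sub>R d))) (at (x + t *\<^sub>R d))"
    by (rule smooth_on_differentiable[OF assms])
  have "((\<lambda>t. x + t *\<^sub>R d) has_derivative (\<lambda>s. s *\<^sub>R d)) (at t)"
    by (auto intro!: derivative_eq_intros)
  then have "((\<lambda>t. G (x + t *\<^sub>R d)) has_derivative (\<lambda>s. frechet_derivative G (at (x + t *\<^sub>R d)) (s *\<^sub>R d))) (at t)"
    using D by (rule has_derivative_compose)
  moreover have "(\<lambda>s. frechet_derivative G (at (x + t *\<^sub>R d)) (s *\<^sub>R d)) = (*) (frechet_derivative G (at (x + t *\<^sub>R d)) d)"
    using linear_scale[OF has_derivative_linear[OF D]] by (auto simp: mult.commute)
  ultimately show ?thesis by (simp add: has_field_derivative_def)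
qed

text \<open>By Rolle the derivative along the segment vanishes somewhere, so it is
  \<open>O(dist x y ^ 2)\<close> throughout.\<close>

lemma smooth_on_bound_between_zeros:
  fixes G :: "'a::euclidean_space \<Rightarrow> real"
  assumes "smooth_on W G" "Q \<subseteq> W" "compact Q" "convex Q"
  obtains B where "0 \<le> B"
    "\<And>x y z. x \<in> Q \<Longrightarrow> y \<in> Q \<Longrightarrow> G x = 0 \<Longrightarrow> G y = 0 \<Longrightarrow> z \<in> closed_segment x y \<Longrightarrow> \<bar>G z\<bar> \<le> B * dist x y ^ 2"
proof -
  define D where "D v z = frechet_derivative G (at z) v" for v z
  have "\<exists>L. 0 \<le> L \<and> (\<forall>x\<in>Q. \<forall>y\<in>Q. norm (D b x - D b y) \<le> L * norm (x - y))" for b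
    using smooth_on_imp_Lipschitz[OF smooth_on_frechet_derivative[OF assms(1)] assms(2-4)] unfolding D_def by metis
  then obtain L where L: "\<And>b. 0 \<le> L b" "\<And>b x y. x \<in> Q \<Longrightarrow> y \<in> Q \<Longrightarrow> \<bar>D b x - D b y\<bar> \<le> L b * norm (x - y)"
    unfolding real_norm_def by metis
  define B where "B = (\<Sum>b\<in>Basis. L b)"
  have "0 \<le> B" unfolding B_def using L by (intro sum_nonneg) auto
  have lin: "linear (\<lambda>v. D v z)" if "z \<in> Q" for z
    unfolding D_def using smooth_on_differentiable[OF assms(1)] assms(2) that has_derivative_linear by blast
  have dif: "\<bar>D d z - D d z'\<bar> \<le> B * norm (z - z') * norm d" if "z \<in> Q" "z' \<in> Q" for d z z'
  proof -
    have "linear (\<lambda>v. D v z - D v z')" by (intro linear_compose_sub lin that)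
    from norm_linear_le_sum_Basis[OF this, of d]
    have "\<bar>D d z - D d z'\<bar> \<le> (\<Sum>b\<in>Basis. \<bar>D b z - D b z'\<bar>) * norm d" by simp
    also have "\<dots> \<le> (\<Sum>b\<in>Basis. L b * norm (z - z')) * norm d"
      by (intro mult_right_mono sum_mono L that) auto
    finally show ?thesis by (simp add: B_def sum_distrib_right)
  qed
  have "\<bar>G z\<bar> \<le> B * dist x y ^ 2"
    if xy: "x \<in> Q" "y \<in> Q" "G x = 0" "G y = 0" "z \<in> closed_segment x y" for x y z
  proof -
    define d where "d = y - x"
    have nd: "norm d = dist x y" by (simp add: d_def dist_norm norm_minus_commute)
    define \<phi> where "\<phi> t = G (x + t *\<^sub>R d)" for t
    have seg: "x + t *\<^sub>R d \<in> Q" if "0 \<le> t" "t \<le> 1" for t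
    proof -
      have "x + t *\<^sub>R d = (1 - t) *\<^sub>R x + t *\<^sub>R y" by (simp add: d_def algebra_simps)
      then show ?thesis using xy(1,2) assms(4) that by (simp add: convex_alt)
    qed
    have der: "(\<phi> has_real_derivative D d (x + t *\<^sub>R d)) (at t)" if "0 \<le> t" "t \<le> 1" for t
      unfolding \<phi>_def D_def using has_real_derivative_along_segment assms(1,2) seg[OF that] by blast
    have \<phi>01: "\<phi> 0 = 0" "\<phi> 1 = 0" using xy by (simp_all add: \<phi>_def d_def)
    obtain c where c: "0 < c" "c < 1" "D d (x + c *\<^sub>R d) = 0"
      using MVT2[of 0 1 \<phi> "\<lambda>t. D d (x + t *\<^sub>R d)"] der \<phi>01 by auto
    have bd: "\<bar>D d (x + t *\<^sub>R d)\<bar> \<le> B * norm d ^ 2" if t: "0 \<le> t" "t \<le> 1" for t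
    proof -
      have "\<bar>D d (x + t *\<^sub>R d) - D d (x + c *\<^sub>R d)\<bar> \<le> B * norm ((x + t *\<^sub>R d) - (x + c *\<^sub>R d)) * norm d"
        using seg t c by (intro dif) auto
      also have "(x + t *\<^sub>R d) - (x + c *\<^sub>R d) = (t - c) *\<^sub>R d" by (simp add: algebra_simps)
      also have "B * norm ((t - c) *\<^sub>R d) * norm d = \<bar>t - c\<bar> * (B * norm d ^ 2)"
        by (simp add: power2_eq_square)
      also have "\<dots> \<le> 1 * (B * norm d ^ 2)"
        using t c \<open>0 \<le> B\<close> by (intro mult_right_mono) auto
      finally show ?thesis using c by simp
    qed
    obtain t where t: "0 \<le> t" "t \<le> 1" "z = x + t *\<^sub>R d"
      using xy(5) unfolding in_segment d_def by (auto simp: algebra_simps)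
    show ?thesis
    proof (cases "t = 0")
      case True
      then show ?thesis using t xy \<open>0 \<le> B\<close> by simp
    next
      case False
      then have "0 < t" using t by simp
      then obtain s where s: "0 < s" "s < t" "\<phi> t - \<phi> 0 = (t - 0) * D d (x + s *\<^sub>R d)"
        using MVT2[of 0 t \<phi> "\<lambda>t. D d (x + t *\<^sub>R d)"] der t by auto
      then have "\<bar>G z\<bar> = t * \<bar>D d (x + s *\<^sub>R d)\<bar>" using \<phi>01 t by (simp add: \<phi>_def abs_mult)
      also have "\<dots> \<le> 1 * (B * norm d ^ 2)" using bd[of s] s t by (intro mult_mono) auto
      finally show ?thesis by (simp add: nd)
    qed
  qed
  then show thesis using that \<open>0 \<le> B\<close> by blast
qed

text \<open>Between two critical points the gradient is quadratically small, so critical values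
  differ by the cube of the distance.\<close>

lemma negligible_critical_values:
  fixes F :: "real^2 \<Rightarrow> real"
  assumes "smooth_on W F" "Q \<subseteq> W" "compact Q" "convex Q"
  shows "negligible (F ` {z \<in> Q. \<forall>v. frechet_derivative F (at z) v = 0})" (is "negligible (F ` ?T)")
proof -
  define D where "D v z = frechet_derivative F (at z) v" for v z
  \<comment> \<open>Each partial derivative is itself a smooth function vanishing at both critical
    points; summing the constants bounds the whole gradient on the segment.\<close>
  have "\<exists>B. 0 \<le> B \<and> (\<forall>x y z. x \<in> Q \<longrightarrow> y \<in> Q \<longrightarrow> D b x = 0 \<longrightarrow> D b y = 0 \<longrightarrow> z \<in> closed_segment x y \<longrightarrow>
      \<bar>D b z\<bar> \<le> B * dist x y ^ 2)" for b
    using smooth_on_bound_between_zeros[OF smooth_on_frechet_derivative[OF assms(1)] assms(2-4)]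
    unfolding D_def by metis
  then obtain B where B: "\<And>b. 0 \<le> B b"
    "\<And>b x y z. x \<in> Q \<Longrightarrow> y \<in> Q \<Longrightarrow> D b x = 0 \<Longrightarrow> D b y = 0 \<Longrightarrow> z \<in> closed_segment x y \<Longrightarrow> \<bar>D b z\<bar> \<le> B b * dist x y ^ 2"
    by metis
  define C where "C = (\<Sum>b\<in>Basis. B b)"
  have der: "(F has_derivative (\<lambda>v. D v z)) (at z)" if "z \<in> Q" for z
    unfolding D_def using smooth_on_differentiable[OF assms(1)] assms(2) that by blast
  have "\<bar>F x - F y\<bar> \<le> C * dist x y ^ 3" if xy: "x \<in> ?T" "y \<in> ?T" for x y
  proof -
    have "norm (F x - F y) \<le> (C * dist x y ^ 2) * norm (x - y)"
    proof (rule differentiable_bound[of "closed_segment x y" F "\<lambda>z v. D v z"])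
      have segQ: "closed_segment x y \<subseteq> Q" using xy assms(4) by (simp add: closed_segment_subset)
      show "(F has_derivative (\<lambda>v. D v z)) (at z within closed_segment x y)" if "z \<in> closed_segment x y" for z
        using der segQ that has_derivative_at_withinI by blast
      show "onorm (\<lambda>v. D v z) \<le> C * dist x y ^ 2" if z: "z \<in> closed_segment x y" for z
      proof (rule onorm_bound)
        show "0 \<le> C * dist x y ^ 2" using B unfolding C_def by (simp add: sum_nonneg)
        fix v
        have "norm (D v z) \<le> (\<Sum>b\<in>Basis. norm (D b z)) * norm v"
          using der segQ z has_derivative_linear by (intro norm_linear_le_sum_Basis) blast
        also have "\<dots> \<le> (\<Sum>b\<in>Basis. B b * dist x y ^ 2) * norm v"
          using xy z B(2) by (intro mult_right_mono sum_mono) (auto simp: D_def)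
        finally show "norm (D v z) \<le> C * dist x y ^ 2 * norm v"
          by (simp add: C_def sum_distrib_right)
      qed
    qed auto
    then show ?thesis by (simp add: dist_norm power2_eq_square power3_eq_cube mult.assoc)
  qed
  moreover have "bounded ?T" using assms(3) compact_imp_bounded by (auto intro: bounded_subset)
  ultimately show ?thesis by (intro negligible_image_cubic_Holder)
qed

text \<open>The local injectivity criterion of \<open>has_derivative_locally_injective\<close> wants
  a left inverse of the derivative at \<open>x\<close> and continuity of the derivative in operator
  norm. The latter comes from the function \<open>c\<close>, a sum over the partial
  derivatives.\<close>

lemma smooth_immersion_locally_injective:
  fixes G :: "'a::euclidean_space \<Rightarrow> 'b::euclidean_space"
  assumes "open W" "smooth_on W G" "x \<in> W" "inj (frechet_derivative G (at x))"
  obtains r where "0 < r" "ball x r \<subseteq> W" "inj_on G (ball x r)"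
proof -
  have der: "(G has_derivative frechet_derivative G (at z)) (at z)" if "z \<in> W" for z
    using smooth_on_differentiable assms(2) that by blast
  have "linear (frechet_derivative G (at x))" using der assms(3) has_derivative_linear by blast
  then obtain h where h: "linear h" "h \<circ> frechet_derivative G (at x) = id"
    using linear_injective_left_inverse assms(4) by blast
  define c where "c z = (\<Sum>b\<in>Basis. norm (frechet_derivative G (at z) b - frechet_derivative G (at x) b))" for z
  have "continuous_on W c"
    unfolding c_def using smooth_on_imp_continuous_on[OF smooth_on_frechet_derivative[OF assms(2)]]
    by (intro continuous_intros) 
  then have cx: "isCont c x" using assms(1,3) continuous_on_eq_continuous_at by blast
  have "\<exists>d>0. \<forall>z. dist x z < d \<longrightarrow> onorm (\<lambda>v. frechet_derivative G (at z) v - frechet_derivative G (at x) v) < e"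
    if e: "0 < e" for e
  proof -
    obtain d1 where d1: "0 < d1" "ball x d1 \<subseteq> W" using assms(1,3) openE by blast
    have "c x = 0" by (simp add: c_def)
    obtain d2 where d2: "0 < d2" "\<And>z. dist z x < d2 \<Longrightarrow> dist (c z) (c x) < e"
      using cx[unfolded continuous_at_eps_delta, rule_format, OF e] by blast
    note d2 = d2(1) d2(2)[unfolded \<open>c x = 0\<close>]
    show ?thesis
    proof (intro exI[of _ "min d1 d2"] conjI allI impI)
      fix z assume "dist x z < min d1 d2"
      then have z: "z \<in> W" "c z < e" using d1 d2(2)[of z] by (auto simp: dist_commute mem_ball subset_iff)
      have "onorm (\<lambda>v. frechet_derivative G (at z) v - frechet_derivative G (at x) v) \<le> c z"
      proof (rule onorm_bound)
        show "0 \<le> c z" by (simp add: c_def sum_nonneg)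
        fix v
        have "linear (\<lambda>v. frechet_derivative G (at z) v - frechet_derivative G (at x) v)"
          using der z assms(3) has_derivative_linear by (intro linear_compose_sub) blast+
        then show "norm (frechet_derivative G (at z) v - frechet_derivative G (at x) v) \<le> c z * norm v"
          unfolding c_def by (rule norm_linear_le_sum_Basis)
      qed
      then show "onorm (\<lambda>v. frechet_derivative G (at z) v - frechet_derivative G (at x) v) < e" using z by simp
    qed (use d1 d2 in auto)
  qed
  then show thesis
    using has_derivative_locally_injective[OF assms(3,1) linear_conv_bounded_linear[THEN iffD1, OF h(1)] h(2) der]
      that by metis
qed

text \<open>The cone is the image under \<open>\<Psi>\<close> of points \<open>(x, c)\<close> of
  space, so Sard's theorem is needed only between equal dimensions: a kernel vector of the
  derivative of \<open>G\<close> at \<open>x\<close>, with third coordinate 0, is killed by the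
  derivative of \<open>\<Psi>\<close>.\<close>

lemma negligible_cone_over_critical_values:
  fixes G :: "real^2 \<Rightarrow> real^3"
  assumes "smooth_on W G"
  shows "negligible {c *\<^sub>R G x | c x. x \<in> W \<and> \<not> inj (frechet_derivative G (at x))}"
proof -
  define \<pi> where "\<pi> y = (\<chi> i::2. if i = 1 then y $ 1 else y $ 2)" for y :: "real^3"
  have "linear \<pi>" by (rule linearI) (auto simp: \<pi>_def vec_eq_iff)
  then have \<pi>: "bounded_linear \<pi>" by (simp add: linear_conv_bounded_linear)
  define Z where "Z = {y. \<pi> y \<in> W \<and> \<not> inj (frechet_derivative G (at (\<pi> y)))}"
  define \<Psi> where "\<Psi> y = (y $ 3) *\<^sub>R G (\<pi> y)" for y
  define \<Psi>' where "\<Psi>' y z = (y $ 3) *\<^sub>R frechet_derivative G (at (\<pi> y)) (\<pi> z) + (z $ 3) *\<^sub>R G (\<pi> y)" for y z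
  have "negligible (\<Psi> ` Z)"
  proof (rule baby_Sard)
    fix y assume y: "y \<in> Z"
    have D: "(G has_derivative frechet_derivative G (at (\<pi> y))) (at (\<pi> y))"
      using smooth_on_differentiable[OF assms] y by (simp add: Z_def)
    have "((\<lambda>y. G (\<pi> y)) has_derivative (\<lambda>z. frechet_derivative G (at (\<pi> y)) (\<pi> z))) (at y)"
      using has_derivative_compose[OF bounded_linear_imp_has_derivative[OF \<pi>] D] .
    moreover have "((\<lambda>y::real^3. y $ 3) has_derivative (\<lambda>z. z $ 3)) (at y)"
      by (rule bounded_linear_imp_has_derivative[OF bounded_linear_vec_nth])
    ultimately have der: "(\<Psi> has_derivative \<Psi>' y) (at y)"
      unfolding \<Psi>_def \<Psi>'_def by (rule has_derivative_scaleR[rotated])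
    then show "(\<Psi> has_derivative \<Psi>' y) (at y within Z)" by (rule has_derivative_at_withinI)
    have lin: "linear (\<Psi>' y)" using der has_derivative_linear by blast
    have linG: "linear (frechet_derivative G (at (\<pi> y)))" using D has_derivative_linear by blast
    have "\<not> inj (frechet_derivative G (at (\<pi> y)))" using y by (simp add: Z_def)
    then obtain k where k: "k \<noteq> 0" "frechet_derivative G (at (\<pi> y)) k = 0"
      using linear_injective_0[OF linG] by blast
    define z :: "real^3" where "z = (\<chi> i. if i = 1 then k $ 1 else if i = 2 then k $ 2 else 0)"
    have "\<pi> z = k" by (auto simp: \<pi>_def z_def vec_eq_iff forall_2)
    moreover have "z $ 3 = 0" by (simp add: z_def)
    ultimately have "\<Psi>' y z = 0" using k by (simp add: \<Psi>'_def)
    moreover have "z \<noteq> 0" using k \<open>\<pi> z = k\<close> linear_0[OF \<open>linear \<pi>\<close>] by metis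
    ultimately have "\<not> inj (\<Psi>' y)" using linear_injective_0[OF lin] by blast
    moreover have "(*v) (matrix (\<Psi>' y)) = \<Psi>' y" 
      using matrix_vector_mul[of "\<Psi>' y"] lin linear_matrix_vector_mul_eq[of "\<Psi>' y"] by simp
    ultimately show "rank (matrix (\<Psi>' y)) < CARD(3)"
      using less_rank_noninjective[of "matrix (\<Psi>' y)"] by simp
  qed simp
  moreover have "{c *\<^sub>R G x | c x. x \<in> W \<and> \<not> inj (frechet_derivative G (at x))} \<subseteq> \<Psi> ` Z"
  proof clarify
    fix c x assume x: "x \<in> W" "\<not> inj (frechet_derivative G (at x))"
    define y :: "real^3" where "y = (\<chi> i. if i = 1 then x $ 1 else if i = 2 then x $ 2 else c)"
    have "\<pi> y = x" by (auto simp: \<pi>_def y_def vec_eq_iff forall_2)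
    moreover have "y $ 3 = c" by (simp add: y_def)
    ultimately show "c *\<^sub>R G x \<in> \<Psi> ` Z"
      using x by (intro image_eqI[of _ _ y]) (auto simp: \<Psi>_def Z_def)
  qed
  ultimately show ?thesis using negligible_subset by blast
qed

section \<open>Locally injective maps whose fibres carry the extrema\<close>

text \<open>Near an image point \<open>y\<close> the antipode \<open>- y\<close> is not a value, so
  stereographic projection from it reduces the claim to maps from the sphere into the plane.\<close>

lemma invariance_of_domain_S2:
  fixes h :: "real^3 \<Rightarrow> real^3"
  assumes "openin (top_of_set S2) N" "continuous_on N h" "inj_on h N" "h ` N \<subseteq> S2"
  shows "openin (top_of_set S2) (h ` N)"
proof (subst openin_subopen, intro ballI)
  fix y assume "y \<in> h ` N"
  then obtain x where x: "x \<in> N" "y = h x" by blast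
  have "y \<in> S2" using x assms(4) by blast
  then have "- y \<in> S2" "- y \<noteq> y" by (auto simp: vec_eq_iff) (metis norm_zero vec_eq_iff zero_index zero_neq_one)
  define N' where "N' = N \<inter> h -` (S2 - {- y})"
  have "openin (top_of_set S2) (S2 - {- y})" by (simp add: openin_delete)
  then have "openin (top_of_set N) N'"
    unfolding N'_def using continuous_openin_preimage[OF assms(2)] assms(4) by (metis image_subset_iff_funcset)
  then have N': "openin (top_of_set S2) N'" "N' \<subseteq> N"
    using assms(1) openin_trans openin_imp_subset by blast+
  obtain j :: "real^3 \<Rightarrow> complex" and k where jk: "homeomorphism (S2 - {- y}) UNIV j k"
    and j: "continuous_on (S2 - {- y}) j" "inj_on j (S2 - {- y})"
    and kj: "\<And>x. x \<in> S2 - {- y} \<Longrightarrow> k (j x) = x"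
    using punctured_sphere_homeomorphism[OF \<open>- y \<in> S2\<close>] by metis
  have hN': "h ` N' \<subseteq> S2 - {- y}" by (auto simp: N'_def)
  have "openin (top_of_set UNIV) ((j \<circ> h) ` N')"
  proof (rule invariance_of_domain_sphere_affine_set)
    show "continuous_on N' (j \<circ> h)"
      using assms(2) N' j(1) hN' by (meson continuous_on_compose continuous_on_subset)
    show "inj_on (j \<circ> h) N'"
      using assms(3) N' j(2) hN' by (meson comp_inj_on inj_on_subset)
    show "openin (top_of_set (sphere 0 1)) N'" using N' by simp
  qed auto
  then have "openin (top_of_set (S2 - {- y})) (k ` (j \<circ> h) ` N')"
    using homeomorphism_imp_open_map[OF homeomorphism_symD[OF jk]] by blast
  moreover have "k ` (j \<circ> h) ` N' = (\<lambda>x. x) ` h ` N'"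
    unfolding image_image comp_def by (rule image_cong[OF refl kj]) (use hN' in blast)
  ultimately have "openin (top_of_set (S2 - {- y})) (h ` N')" by simp
  then have "openin (top_of_set S2) (h ` N')"
    using openin_trans \<open>openin (top_of_set S2) (S2 - {- y})\<close> by blast
  moreover have "y \<in> h ` N'" using x \<open>y \<in> S2\<close> \<open>- y \<noteq> y\<close> by (auto simp: N'_def)
  moreover have "h ` N' \<subseteq> h ` N" using N' by blast
  ultimately show "\<exists>T. openin (top_of_set S2) T \<and> y \<in> T \<and> T \<subseteq> h ` N" by blast
qed

text \<open>The set is the radial projection of \<open>E\<close>, and \<open>E\<close> is convex:
  for \<open>0 \<le> c\<close> the condition involving \<open>c * norm x\<close> passes to convex
  combinations by the triangle inequality.\<close>

lemma connected_sphere_Int_cone: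
  fixes y0 a b :: "'a::euclidean_space"
  assumes "0 \<le> c"
  shows "connected {y \<in> sphere 0 1. c < y \<bullet> y0 \<and> 0 < y \<bullet> a \<and> 0 < y \<bullet> b}"
proof -
  define E where "E = {x. c * norm x < x \<bullet> y0 \<and> 0 < x \<bullet> a \<and> 0 < x \<bullet> b}"
  have "convex E"
  proof (rule convexI)
    fix x y :: 'a and u v :: real assume xy: "x \<in> E" "y \<in> E" and uv: "0 \<le> u" "0 \<le> v" "u + v = 1"
    have comb: "u * s + v * t > 0" if "0 < s" "0 < t" for s t :: real
      using uv that by (cases "u = 0") (auto intro: add_pos_nonneg)
    have "c * norm (u *\<^sub>R x + v *\<^sub>R y) \<le> c * (u * norm x + v * norm y)"
      using norm_triangle_ineq[of "u *\<^sub>R x" "v *\<^sub>R y"] uv assms by (intro mult_left_mono) auto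
    also have "\<dots> < u * (x \<bullet> y0) + v * (y \<bullet> y0)"
      using comb[of "x \<bullet> y0 - c * norm x" "y \<bullet> y0 - c * norm y"] xy by (simp add: E_def algebra_simps)
    finally show "u *\<^sub>R x + v *\<^sub>R y \<in> E"
      using comb xy by (simp add: E_def inner_add_left)
  qed
  have nz: "x \<noteq> 0" if "x \<in> E" for x using that by (auto simp: E_def)
  have "continuous_on E (\<lambda>x. x /\<^sub>R norm x)"
    using nz by (intro continuous_intros) auto
  then have "connected ((\<lambda>x. x /\<^sub>R norm x) ` E)"
    using \<open>convex E\<close> convex_connected connected_continuous_image by blast
  also have "(\<lambda>x. x /\<^sub>R norm x) ` E = {y \<in> sphere 0 1. c < y \<bullet> y0 \<and> 0 < y \<bullet> a \<and> 0 < y \<bullet> b}"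
  proof (intro subset_antisym subsetI)
    fix y assume "y \<in> (\<lambda>x. x /\<^sub>R norm x) ` E"
    then obtain x where "x \<in> E" "y = x /\<^sub>R norm x" by blast
    then show "y \<in> {y \<in> sphere 0 1. c < y \<bullet> y0 \<and> 0 < y \<bullet> a \<and> 0 < y \<bullet> b}"
      using nz[of x] by (auto simp: E_def field_simps)
  next
    fix y assume "y \<in> {y \<in> sphere 0 1. c < y \<bullet> y0 \<and> 0 < y \<bullet> a \<and> 0 < y \<bullet> b}"
    then show "y \<in> (\<lambda>x. x /\<^sub>R norm x) ` E"
      by (intro image_eqI[of _ _ y]) (auto simp: E_def)
  qed
  finally show ?thesis .
qed

text \<open>By invariance of domain \<open>g\<close> maps \<open>N\<close> homeomorphically onto an
  open set. Cutting \<open>N\<close> down to the preimage of a round cap about \<open>g p\<close>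
  makes its trace on any lune the preimage of a cap intersected with two hemispheres.\<close>

lemma (in shadow_map) locally_injective_imp_nice:
  assumes "openin (top_of_set S2) N" "p \<in> N" "inj_on g N"
  shows "\<exists>N'. openin (top_of_set S2) N' \<and> p \<in> N' \<and> (\<forall>a b. connected (N' \<inter> open_shadow a \<inter> open_shadow b))"
proof -
  have NS: "N \<subseteq> S2" using assms(1) openin_imp_subset by blast
  have gS: "g ` S2 \<subseteq> S2" using norm_g by auto
  have op: "openin (top_of_set S2) (g ` T)" if "openin (top_of_set S2) T" "T \<subseteq> N" for T
  proof (rule invariance_of_domain_S2[OF that(1)])
    show "continuous_on T g" using cont that NS continuous_on_subset by blast
    show "inj_on g T" using assms(3) that inj_on_subset by blast
    show "g ` T \<subseteq> S2" using gS that NS by blast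
  qed
  define y0 where "y0 = g p"
  have "y0 \<in> S2" "y0 \<in> g ` N" using assms(2) NS gS unfolding y0_def by blast+
  then obtain e where e: "0 < e" "ball y0 e \<inter> S2 \<subseteq> g ` N"
    using op[OF assms(1)] openin_contains_ball by (metis subset_refl)
  \<comment> \<open>For unit vectors the squared distance is
    \<open>2 - 2 * (y \<bullet> y0)\<close>, so \<open>1 - e^2 / 2 < y \<bullet> y0\<close> means
    distance below \<open>e\<close>. The maximum with 0 keeps the cone over the cap convex.\<close>
  define c where "c = max 0 (1 - e^2 / 2)"
  have c: "0 \<le> c" "c < 1" "1 - e^2 / 2 \<le> c" using e by (auto simp: c_def)
  have cap: "y \<in> g ` N" if y: "y \<in> S2" "c < y \<bullet> y0" for y
  proof -
    have "y \<bullet> y = 1" "y0 \<bullet> y0 = 1" using y(1) \<open>y0 \<in> S2\<close> by (simp_all add: dot_square_norm)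
    then have "(dist y0 y)\<^sup>2 = 2 - 2 * (y \<bullet> y0)"
      unfolding dist_norm power2_norm_eq_inner inner_diff_left inner_diff_right
      by (simp add: inner_commute[of y0 y])
    also have "\<dots> < e^2" using y(2) c by simp
    finally have "dist y0 y < e" using e by (simp add: power_less_imp_less_base)
    then show ?thesis using e y by auto
  qed
  define N' where "N' = {x \<in> N. c < g x \<bullet> y0}"
  have "N' = N \<inter> (\<lambda>x. g x \<bullet> y0) -` {c<..}" by (auto simp: N'_def)
  then have "openin (top_of_set N) N'"
    using continuous_openin_preimage_gen[OF continuous_on_height[OF NS]] by simp
  then have opN': "openin (top_of_set S2) N'" using assms(1) openin_trans by blast
  have "g p \<bullet> y0 = 1" using \<open>y0 \<in> S2\<close> by (simp add: y0_def dot_square_norm)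
  then have "p \<in> N'" using assms(2) c by (simp add: N'_def)
  have cinv: "continuous_on (g ` N) (inv_into N g)"
  proof (rule continuous_on_inverse_open_map[of N g])
    show "continuous_on N g" using cont NS continuous_on_subset by blast
    fix U assume U: "openin (top_of_set N) U"
    then have "openin (top_of_set S2) (g ` U)"
      using op openin_trans[OF U assms(1)] openin_imp_subset[OF U] by blast
    moreover have "g ` U \<subseteq> g ` N" using openin_imp_subset[OF U] by blast
    ultimately show "openin (top_of_set (g ` N)) (g ` U)"
      using openin_subset_trans gS NS by (metis image_mono subset_trans)
  qed (use assms(3) in auto)
  have "connected (N' \<inter> open_shadow a \<inter> open_shadow b)" for a b
  proof -
    define D where "D = {y \<in> S2. c < y \<bullet> y0 \<and> 0 < y \<bullet> a \<and> 0 < y \<bullet> b}"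
    have "D \<subseteq> g ` N" using cap by (auto simp: D_def)
    then have "connected (inv_into N g ` D)"
      using cinv connected_sphere_Int_cone[OF c(1)] connected_continuous_image continuous_on_subset
      unfolding D_def by blast
    moreover have "inv_into N g ` D = N' \<inter> open_shadow a \<inter> open_shadow b"
    proof (intro subset_antisym subsetI)
      fix x assume "x \<in> inv_into N g ` D"
      then obtain y where y: "y \<in> D" "x = inv_into N g y" by blast
      then have "x \<in> N" "g x = y" using \<open>D \<subseteq> g ` N\<close> by (auto simp: inv_into_into f_inv_into_f)
      then show "x \<in> N' \<inter> open_shadow a \<inter> open_shadow b" using y NS by (auto simp: N'_def open_shadow_def D_def)
    next
      fix x assume x: "x \<in> N' \<inter> open_shadow a \<inter> open_shadow b"
      then have "x \<in> N" "g x \<in> D" using norm_g by (auto simp: N'_def open_shadow_def D_def)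
      then show "x \<in> inv_into N g ` D" using assms(3) by (metis image_eqI inv_into_f_f)
    qed
    ultimately show ?thesis by simp
  qed
  then show ?thesis using opN' \<open>p \<in> N'\<close> by blast
qed

text \<open>The interface between differential and global geometry: inside this locale no derivative
  occurs, and the charts are used later only to establish its assumptions.\<close>

locale gauss_immersion = shadow_map +
  fixes F :: "real^3 \<Rightarrow> real^3"
  assumes contF: "continuous_on S2 F"
    and locally_inj: "x \<in> S2 \<Longrightarrow> \<exists>N. openin (top_of_set S2) N \<and> x \<in> N \<and> inj_on F N"
    and normal_at_max: "x \<in> S2 \<Longrightarrow> v \<noteq> 0 \<Longrightarrow> (\<And>y. y \<in> S2 \<Longrightarrow> F y \<bullet> v \<le> F x \<bullet> v) \<Longrightarrow> \<exists>c. g x = c *\<^sub>R v"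
    and height_constant: "C \<subseteq> S2 \<Longrightarrow> connected C \<Longrightarrow> (\<And>x. x \<in> C \<Longrightarrow> \<exists>c. g x = c *\<^sub>R v) \<Longrightarrow> x \<in> C \<Longrightarrow> y \<in> C
      \<Longrightarrow> F x \<bullet> v = F y \<bullet> v"
    and generic_locally_inj: "open U \<Longrightarrow> U \<noteq> {} \<Longrightarrow> \<exists>v\<in>U. v \<noteq> 0 \<and>
      (\<forall>p\<in>S2. (\<exists>c. g p = c *\<^sub>R v) \<longrightarrow> (\<exists>N. openin (top_of_set S2) N \<and> p \<in> N \<and> inj_on g N))"
begin

lemma S2_nonempty: "S2 \<noteq> {}" by simp

lemma unit_multiple:
  assumes "x \<in> S2" "v \<in> S2" "g x = c *\<^sub>R v"
  shows "g x = v \<or> g x = - v"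
proof -
  have "\<bar>c\<bar> = 1" using norm_g[OF assms(1)] assms by simp
  then show ?thesis using assms(3) by (auto simp: abs_if split: if_splits)
qed

lemma max_height:
  obtains m where "m \<in> S2" "\<And>y. y \<in> S2 \<Longrightarrow> F y \<bullet> v \<le> F m \<bullet> v"
proof -
  have "continuous_on S2 (\<lambda>x. F x \<bullet> v)" by (intro continuous_intros contF)
  then show thesis using continuous_attains_sup[of S2 "\<lambda>x. F x \<bullet> v"] that by auto
qed

lemma normal_at_min:
  assumes "x \<in> S2" "v \<noteq> 0" "\<And>y. y \<in> S2 \<Longrightarrow> F x \<bullet> v \<le> F y \<bullet> v"
  shows "\<exists>c. g x = c *\<^sub>R v"
proof -
  obtain c where "g x = c *\<^sub>R (- v)" using normal_at_max[of x "- v"] assms by auto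
  then show ?thesis by (metis scaleR_minus_left scaleR_minus_right)
qed

text \<open>If the image lay in a plane orthogonal to \<open>v\<close>, every normal would be
  parallel to \<open>v\<close>. But where the height in an orthogonal direction \<open>w\<close> is
  maximal, the normal is parallel to \<open>w\<close>.\<close>

lemma height_not_constant:
  assumes "v \<noteq> 0"
  shows "\<exists>x\<in>S2. F x \<bullet> v \<noteq> b"
proof (rule ccontr)
  assume "\<not> ?thesis"
  then have const: "F x \<bullet> v = b" if "x \<in> S2" for x using that by blast
  have normal: "\<exists>c. g x = c *\<^sub>R v" if "x \<in> S2" for x
    using normal_at_max[OF that assms] const that by simp
  obtain w where w: "w \<noteq> 0" "v \<bullet> w = 0"
    using orthogonal_to_vector_exists[of v] by (auto simp: orthogonal_def)
  obtain m where m: "m \<in> S2" "\<And>y. y \<in> S2 \<Longrightarrow> F y \<bullet> w \<le> F m \<bullet> w" using max_height by blast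
  obtain c d where "g m = c *\<^sub>R w" "g m = d *\<^sub>R v"
    using normal[OF m(1)] normal_at_max[OF m(1) w(1) m(2)] by blast
  then have "g m \<bullet> g m = 0" using w by (metis inner_scaleR_left inner_scaleR_right mult_zero_right inner_commute)
  then show False using norm_g[OF m(1)] by simp
qed

text \<open>Both a maximum and a minimum of the height in direction \<open>v\<close> belong to this
  set. Were it connected, they would have equal height by \<open>height_constant\<close>.\<close>

lemma fibres_disconnected:
  assumes "v \<in> S2"
  shows "\<not> connected {x \<in> S2. g x = v \<or> g x = - v}" (is "\<not> connected ?K")
proof
  assume con: "connected ?K"
  have "v \<noteq> 0" using assms by auto
  obtain m where m: "m \<in> S2" "\<And>y. y \<in> S2 \<Longrightarrow> F y \<bullet> v \<le> F m \<bullet> v" using max_height by blast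
  obtain l where l: "l \<in> S2" "\<And>y. y \<in> S2 \<Longrightarrow> F y \<bullet> - v \<le> F l \<bullet> - v" using max_height by blast
  have "\<exists>c. g m = c *\<^sub>R v" using normal_at_max[OF m(1) \<open>v \<noteq> 0\<close> m(2)] .
  then have "m \<in> ?K" using unit_multiple[OF m(1) assms] m(1) by blast
  have "\<exists>c. g l = c *\<^sub>R v" using normal_at_min[OF l(1) \<open>v \<noteq> 0\<close>] l(2) by simp
  then have "l \<in> ?K" using unit_multiple[OF l(1) assms] l(1) by blast
  have mult: "\<exists>c. g x = c *\<^sub>R v" if "x \<in> ?K" for x
    using that by (auto intro: exI[of _ 1] exI[of _ "-1"])
  have eq: "F m \<bullet> v = F l \<bullet> v"
    by (rule height_constant[OF _ con mult \<open>m \<in> ?K\<close> \<open>l \<in> ?K\<close>]) auto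
  obtain x where "x \<in> S2" "F x \<bullet> v \<noteq> F m \<bullet> v" using height_not_constant[OF \<open>v \<noteq> 0\<close>] by blast
  then show False using m(2)[of x] l(2)[of x] eq by simp
qed

sublocale nice_shadow_map g
proof
  show "\<not> connected {x \<in> S2. g x = v \<or> g x = - v}" if "v \<in> S2" for v
    using fibres_disconnected[OF that] .
  show "\<exists>v\<in>U. v \<noteq> 0 \<and> (\<forall>p\<in>S2. (\<exists>c. g p = c *\<^sub>R v) \<longrightarrow>
      (\<exists>N. openin (top_of_set S2) N \<and> p \<in> N \<and> (\<forall>a b. connected (N \<inter> open_shadow a \<inter> open_shadow b))))"
    if U: "open U" "U \<noteq> {}" for U
    using generic_locally_inj[OF U] locally_injective_imp_nice by meson
qed

lemma height_eq_on_fibre: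
  assumes "x \<in> S2" "y \<in> S2" "g x = g y"
  shows "F x \<bullet> g x = F y \<bullet> g x"
proof (rule height_constant[of "{z \<in> S2. g z = g x}"])
  have "g x \<in> S2" using norm_g[OF assms(1)] by simp
  then show "connected {z \<in> S2. g z = g x}" by (rule connected_fibre)
qed (use assms in \<open>auto intro: exI[of _ 1]\<close>)

text \<open>If the maximum or the minimum in direction \<open>v = g x\<close> has normal
  \<open>v\<close>, then \<open>x\<close> lies in its fibre and shares its height. If both have
  normal \<open>- v\<close>, they share a fibre, so the height is constant.\<close>

lemma supporting:
  assumes x: "x \<in> S2"
  shows "(\<forall>y\<in>S2. F y \<bullet> g x \<le> F x \<bullet> g x) \<or> (\<forall>y\<in>S2. F x \<bullet> g x \<le> F y \<bullet> g x)"
proof -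
  define v where "v = g x"
  have v: "v \<in> S2" "v \<noteq> 0" using norm_g[OF x] by (auto simp: v_def)
  obtain m where m: "m \<in> S2" "\<And>y. y \<in> S2 \<Longrightarrow> F y \<bullet> v \<le> F m \<bullet> v" using max_height by blast
  obtain l where l: "l \<in> S2" "\<And>y. y \<in> S2 \<Longrightarrow> F y \<bullet> - v \<le> F l \<bullet> - v" using max_height by blast
  have gm: "g m = v \<or> g m = - v"
    using unit_multiple[OF m(1) v(1)] normal_at_max[OF m(1) v(2) m(2)] by blast
  have "\<exists>c. g l = c *\<^sub>R v" using normal_at_min[OF l(1) v(2)] l(2) by simp
  then have gl: "g l = v \<or> g l = - v" using unit_multiple[OF l(1) v(1)] by blast
  show ?thesis
  proof (cases "g m = v \<or> g l = v")
    case True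
    then show ?thesis
      using height_eq_on_fibre[OF x m(1)] height_eq_on_fibre[OF x l(1)] m(2) l(2) by (auto simp: v_def)
  next
    case False
    then have "F m \<bullet> v = F l \<bullet> v"
      using height_eq_on_fibre[OF m(1) l(1)] gm gl by simp
    then have "F y \<bullet> v = F m \<bullet> v" if "y \<in> S2" for y
      using m(2)[OF that] l(2)[OF that] by simp
    then show ?thesis using x by (simp add: v_def)
  qed
qed

text \<open>The height in the direction \<open>v\<close> of \<open>F p\<close> is maximal at
  \<open>p\<close>, and by Cauchy-Schwarz only points mapped to \<open>F p\<close> attain it.
  Preimages of \<open>F p\<close> with opposite normals would exhaust both fibres over
  \<open>v\<close> and \<open>- v\<close>, and the minimum would have maximal height. So all have
  the normal of \<open>p\<close>; its connected fibre is collapsed by \<open>F\<close>, and local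
  injectivity makes it a single point.\<close>

lemma fibre_of_farthest_point:
  assumes p: "p \<in> S2" "\<And>y. y \<in> S2 \<Longrightarrow> norm (F y) \<le> norm (F p)" and q: "q \<in> S2" "F q = F p"
  shows "q = p"
proof -
  obtain x where "x \<in> S2" "F x \<bullet> axis 1 1 \<noteq> 0"
    using height_not_constant[of "axis 1 1" 0] by (auto simp: axis_eq_0_iff)
  then have "F p \<noteq> 0" using p(2)[of x] by auto
  define v where "v = F p /\<^sub>R norm (F p)"
  have v: "v \<in> S2" "v \<noteq> 0" "F p \<bullet> v = norm (F p)" using \<open>F p \<noteq> 0\<close>
    by (auto simp: v_def dot_square_norm power2_eq_square)
  have le: "F y \<bullet> v \<le> norm (F p)" if "y \<in> S2" for y
    using norm_cauchy_schwarz[of "F y" v] v(1) p(2)[OF that] by simp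
  have eq: "F y = F p" if "y \<in> S2" "F y \<bullet> v = norm (F p)" for y
  proof -
    have "norm (F y - norm (F p) *\<^sub>R v) ^ 2 = norm (F y) ^ 2 - norm (F p) ^ 2"
    proof -
      have "v \<bullet> v = 1" using v(1) by (simp add: dot_square_norm)
      then show ?thesis
        unfolding power2_norm_eq_inner[of "F y - norm (F p) *\<^sub>R v"] power2_norm_eq_inner[of "F y"]
          inner_diff_left inner_diff_right
        using that(2) by (simp add: inner_commute[of v "F y"] power2_eq_square)
    qed
    also have "\<dots> \<le> 0" using p(2)[OF that(1)] by simp
    finally have "F y = norm (F p) *\<^sub>R v" by simp
    then show ?thesis using \<open>F p \<noteq> 0\<close> by (simp add: v_def)
  qed
  have max: "F y \<bullet> v \<le> F z \<bullet> v" if "z \<in> S2" "F z = F p" "y \<in> S2" for y z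
    using le[OF that(3)] that(2) v(3) by simp
  have g: "g z = v \<or> g z = - v" if "z \<in> S2" "F z = F p" for z
    using normal_at_max[OF that(1) v(2) max[OF that]] unit_multiple[OF that(1) v(1)] by blast
  have fib: "F z \<bullet> v = F y \<bullet> v" if "y \<in> S2" "z \<in> S2" "g y = g z" "g z = v \<or> g z = - v" for y z
    using height_eq_on_fibre[OF that(2,1)] that(3,4) by auto
  have gq: "g q = g p"
  proof (rule ccontr)
    assume ne: "g q \<noteq> g p"
    obtain l where l: "l \<in> S2" "\<And>y. y \<in> S2 \<Longrightarrow> F y \<bullet> - v \<le> F l \<bullet> - v" using max_height by blast
    have "\<exists>c. g l = c *\<^sub>R v" using normal_at_min[OF l(1) v(2)] l(2) by simp
    then have "g l = v \<or> g l = - v" using unit_multiple[OF l(1) v(1)] by blast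
    then have "g l = g p \<or> g l = g q" using g[OF p(1)] g[OF q] ne by auto
    then have "F l \<bullet> v = F p \<bullet> v"
      using fib[OF l(1) p(1)] fib[OF l(1) q(1)] g[OF p(1)] g[OF q] q(2) by auto
    moreover obtain y where "y \<in> S2" "F y \<bullet> v \<noteq> F p \<bullet> v" using height_not_constant[OF v(2)] by blast
    ultimately show False using l(2)[of y] le[of y] v(3) by simp
  qed
  define A where "A = {y \<in> S2. g y = g p}"
  have "g p \<in> S2" using norm_g[OF p(1)] by simp
  then have "connected A" unfolding A_def by (rule connected_fibre)
  have FA: "F y = F p" if "y \<in> A" for y
    using that fib[OF p(1), of y] g[OF p(1)] v(3) by (intro eq) (auto simp: A_def)
  obtain N where N: "openin (top_of_set S2) N" "p \<in> N" "inj_on F N" using locally_inj[OF p(1)] by blast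
  have "A \<inter> N = {p}" using FA N(2,3) p(1) by (auto simp: A_def dest: inj_onD)
  obtain T where "open T" "N = S2 \<inter> T" using N(1) by (auto simp: openin_open)
  moreover have "A \<subseteq> S2" by (auto simp: A_def)
  ultimately have "A \<inter> T = {p}" using \<open>A \<inter> N = {p}\<close> by blast
  then have "openin (top_of_set A) {p}" using openin_open_Int[OF \<open>open T\<close>, of A] by simp
  moreover have "closedin (top_of_set A) {p}" using p(1) by (simp add: A_def closedin_singleton)
  ultimately have "A = {p}" using \<open>connected A\<close> connected_clopen[of A] by blast
  then show "q = p" using q(1) gq by (auto simp: A_def)
qed

lemma image_subset_frontier_hull: "F ` S2 \<subseteq> frontier (convex hull (F ` S2))"
proof (intro subsetI)
  let ?C = "convex hull (F ` S2)"
  have side: "F x \<notin> interior ?C" if "x \<in> S2" "v \<noteq> 0" "\<And>y. y \<in> S2 \<Longrightarrow> F y \<bullet> v \<le> F x \<bullet> v" for x v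
  proof
    assume "F x \<in> interior ?C"
    then obtain e where e: "0 < e" "cball (F x) e \<subseteq> ?C" by (auto simp: mem_interior_cball)
    have "?C \<subseteq> {y. v \<bullet> y \<le> F x \<bullet> v}"
    proof (rule hull_minimal)
      show "F ` S2 \<subseteq> {y. v \<bullet> y \<le> F x \<bullet> v}" using that(3) by (auto simp: inner_commute)
      show "convex {y. v \<bullet> y \<le> F x \<bullet> v}" by (rule convex_halfspace_le)
    qed
    moreover have "F x + (e / norm v) *\<^sub>R v \<in> cball (F x) e" using that(2) e by (simp add: dist_norm)
    ultimately have "v \<bullet> (F x + (e / norm v) *\<^sub>R v) \<le> F x \<bullet> v" using e by blast
    then have "(e / norm v) * (v \<bullet> v) \<le> 0" by (simp add: inner_add_right inner_commute)
    moreover have "0 < (e / norm v) * (v \<bullet> v)" using e that(2) by simp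
    ultimately show False by simp
  qed
  fix z assume "z \<in> F ` S2"
  then obtain x where x: "x \<in> S2" "z = F x" by blast
  have "g x \<noteq> 0" using norm_g[OF x(1)] by auto
  have "F x \<notin> interior ?C"
    using supporting[OF x(1)] side[OF x(1) \<open>g x \<noteq> 0\<close>] side[OF x(1), of "- g x"] \<open>g x \<noteq> 0\<close> by auto
  moreover have "F x \<in> closure ?C" using x(1) by (meson closure_subset hull_inc image_eqI subsetD)
  ultimately show "z \<in> frontier ?C" using x by (simp add: frontier_def)
qed

lemma interior_hull_nonempty: "interior (convex hull (F ` S2)) \<noteq> {}"
proof
  assume "interior (convex hull (F ` S2)) = {}"
  then obtain a b where ab: "a \<noteq> 0" "convex hull (F ` S2) \<subseteq> {x. a \<bullet> x = b}"
    using empty_interior_subset_hyperplane[OF convex_convex_hull] by blast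
  obtain x where "x \<in> S2" "F x \<bullet> a \<noteq> b" using height_not_constant[OF ab(1)] by blast
  then show False using ab(2) hull_inc[of "F x" "F ` S2" convex] by (auto simp: inner_commute)
qed

text \<open>The points of the frontier with several preimages form a clopen set, which misses the
  point farthest from the origin.\<close>

theorem frontier_hull:
  "inj_on F S2" "F ` S2 = frontier (convex hull (F ` S2))" "convex_body (convex hull (F ` S2))"
proof -
  define C where "C = convex hull (F ` S2)"
  have "compact (F ` S2)" using contF by (intro compact_continuous_image) auto
  then have C: "compact C" "convex C" "interior C \<noteq> {}"
    using interior_hull_nonempty by (simp_all add: C_def compact_convex_hull)
  then show "convex_body (convex hull (F ` S2))" by (simp add: convex_body_def C_def)
  have "C homeomorphic cball (0::real^3) 1"
    using homeomorphic_convex_compact_cball[OF C(2,1,3)] by simp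
  then have "frontier C homeomorphic frontier (cball (0::real^3) 1)"
    using C by (intro homeomorphic_frontiers_same_dimension) (auto simp: compact_imp_closed)
  then obtain h k where hk: "homeomorphism (frontier C) S2 h k"
    by (auto simp: homeomorphic_def)
  have FC: "F ` S2 \<subseteq> frontier C" using image_subset_frontier_hull by (simp add: C_def)
  define \<Phi> where "\<Phi> x = h (F x)" for x
  have injh: "inj_on h (frontier C)" by (rule inj_on_inverseI[of _ k]) (rule homeomorphism_apply1[OF hk])
  have \<Phi>S: "\<Phi> ` S2 \<subseteq> S2" using FC hk by (auto simp: \<Phi>_def homeomorphism_def)
  have cont\<Phi>: "continuous_on S2 \<Phi>"
    unfolding \<Phi>_def using continuous_on_compose2[OF homeomorphism_cont1[OF hk] contF] FC by blast
  have \<Phi>F: "\<Phi> x = \<Phi> y \<longleftrightarrow> F x = F y" if "x \<in> S2" "y \<in> S2" for x y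
    using inj_on_eq_iff[OF injh, of "F x" "F y"] that FC unfolding \<Phi>_def by blast
  have inj\<Phi>: "inj_on \<Phi> N \<longleftrightarrow> inj_on F N" if "N \<subseteq> S2" for N
    unfolding inj_on_def using \<Phi>F that by blast
  have "\<exists>T. open T \<and> x \<in> T \<and> inj_on F (S2 \<inter> T)" if "x \<in> S2" for x
    using locally_inj[OF that] by (auto simp: openin_open)
  then obtain T where T: "\<And>x. x \<in> S2 \<Longrightarrow> open (T x) \<and> x \<in> T x \<and> inj_on F (S2 \<inter> T x)" by metis
  have op: "openin (top_of_set S2) (\<Phi> ` (S2 \<inter> T x \<inter> V))" if "x \<in> S2" "open V" for x V
  proof (rule invariance_of_domain_S2)
    show "openin (top_of_set S2) (S2 \<inter> T x \<inter> V)" using T[OF that(1)] that(2) by (metis Int_assoc open_Int openin_open_Int)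
    show "continuous_on (S2 \<inter> T x \<inter> V) \<Phi>" by (rule continuous_on_subset[OF cont\<Phi>]) blast
    have "inj_on \<Phi> (S2 \<inter> T x)" using T[OF that(1)] inj\<Phi>[of "S2 \<inter> T x"] by blast
    then show "inj_on \<Phi> (S2 \<inter> T x \<inter> V)" by (rule inj_on_subset) blast
    show "\<Phi> ` (S2 \<inter> T x \<inter> V) \<subseteq> S2" using \<Phi>S by blast
  qed
  have conS: "connected S2" by (simp add: connected_sphere)
  have "\<Phi> ` S2 = (\<Union>x\<in>S2. \<Phi> ` (S2 \<inter> T x \<inter> UNIV))" using T by blast
  moreover have "openin (top_of_set S2) (\<Union>x\<in>S2. \<Phi> ` (S2 \<inter> T x \<inter> UNIV))"
    using op[OF _ open_UNIV] by (intro openin_Union) auto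
  ultimately have "openin (top_of_set S2) (\<Phi> ` S2)" by (simp only:)
  moreover have "closedin (top_of_set S2) (\<Phi> ` S2)"
    using cont\<Phi> \<Phi>S by (intro closed_subset compact_imp_closed compact_continuous_image) auto
  ultimately have surj: "\<Phi> ` S2 = S2" using conS S2_nonempty connected_clopen[of S2] by blast
  have "F ` S2 = frontier C"
  proof
    show "frontier C \<subseteq> F ` S2"
    proof
      fix y assume y: "y \<in> frontier C"
      then have "h y \<in> \<Phi> ` S2" using surj hk by (auto simp: homeomorphism_def)
      then obtain x where "x \<in> S2" "h y = h (F x)" by (auto simp: \<Phi>_def)
      then show "y \<in> F ` S2" using injh y FC by (metis image_subset_iff image_eqI inj_onD)
    qed
  qed (rule FC)
  then show "F ` S2 = frontier (convex hull (F ` S2))" by (simp add: C_def)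
  \<comment> \<open>By local injectivity the open squares \<open>T x \<times> T x\<close> contain no
    pair of distinct points with equal image. Removing them therefore removes exactly the diagonal,
    and what remains is compact.\<close>
  define P where "P = {z \<in> S2 \<times> S2. \<Phi> (fst z) = \<Phi> (snd z)} - (\<Union>x\<in>S2. T x \<times> T x)"
  have P: "(p, q) \<in> P \<longleftrightarrow> p \<in> S2 \<and> q \<in> S2 \<and> \<Phi> p = \<Phi> q \<and> p \<noteq> q" for p q
  proof
    assume "(p, q) \<in> P"
    then have "p \<in> S2" "q \<in> S2" "\<Phi> p = \<Phi> q" "(p, q) \<notin> T p \<times> T p" unfolding P_def by auto
    then show "p \<in> S2 \<and> q \<in> S2 \<and> \<Phi> p = \<Phi> q \<and> p \<noteq> q" using T[of p] by blast
  next
    assume pq: "p \<in> S2 \<and> q \<in> S2 \<and> \<Phi> p = \<Phi> q \<and> p \<noteq> q"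
    have "\<not> (p \<in> T x \<and> q \<in> T x)" if "x \<in> S2" for x
      using T[OF that] inj\<Phi>[of "S2 \<inter> T x"] pq by (auto dest: inj_onD)
    then show "(p, q) \<in> P" using pq by (auto simp: P_def)
  qed
  define D where "D = (\<lambda>z. \<Phi> (fst z)) ` P"
  have c1: "continuous_on (S2 \<times> S2) (\<lambda>z. \<Phi> (fst z))" "continuous_on (S2 \<times> S2) (\<lambda>z. \<Phi> (snd z))"
    by (rule continuous_on_compose2[OF cont\<Phi>], auto intro: continuous_intros)+
  then have "closed {z \<in> S2 \<times> S2. \<Phi> (fst z) - \<Phi> (snd z) = 0}"
    by (intro continuous_closed_preimage_constant continuous_on_diff) (auto intro: closed_Times)
  then have "compact ({z \<in> S2 \<times> S2. \<Phi> (fst z) - \<Phi> (snd z) = 0} \<inter> S2 \<times> S2)"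
    by (intro closed_Int_compact compact_Times compact_sphere)
  moreover have "{z \<in> S2 \<times> S2. \<Phi> (fst z) - \<Phi> (snd z) = 0} \<inter> S2 \<times> S2 = {z \<in> S2 \<times> S2. \<Phi> (fst z) = \<Phi> (snd z)}"
    by auto
  ultimately have "compact {z \<in> S2 \<times> S2. \<Phi> (fst z) = \<Phi> (snd z)}" by (simp only:)
  moreover have "open (\<Union>x\<in>S2. T x \<times> T x)" using T by (intro open_UN ballI open_Times) blast+
  ultimately have "compact P" unfolding P_def by (simp add: compact_diff)
  moreover have "P \<subseteq> S2 \<times> S2" by (auto simp: P_def)
  ultimately have "compact D" unfolding D_def
    using c1(1) by (intro compact_continuous_image continuous_on_subset[OF c1(1)])
  moreover have "D \<subseteq> S2"
  proof
    fix y assume "y \<in> D"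
    then obtain z where "z \<in> P" "y = \<Phi> (fst z)" by (auto simp: D_def)
    then show "y \<in> S2" using \<Phi>S \<open>P \<subseteq> S2 \<times> S2\<close> by (metis image_subset_iff mem_Times_iff subsetD)
  qed
  ultimately have clD: "closedin (top_of_set S2) D" by (simp add: closed_subset compact_imp_closed)
  \<comment> \<open>Around two distinct points with the same value both sheets are open maps, so all
    nearby values are again attained in two disjoint neighbourhoods.\<close>
  have opD: "openin (top_of_set S2) D"
  proof (subst openin_subopen, intro ballI)
    fix y assume "y \<in> D"
    then obtain z where "z \<in> P" "y = \<Phi> (fst z)" by (auto simp: D_def)
    moreover obtain p q where "z = (p, q)" by fastforce
    ultimately have pq: "p \<in> S2" "q \<in> S2" "p \<noteq> q" "y = \<Phi> p" "y = \<Phi> q" using P by auto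
    obtain U V where UV: "open U" "open V" "p \<in> U" "q \<in> V" "U \<inter> V = {}"
      using hausdorff[OF pq(3)] by blast
    let ?O = "\<Phi> ` (S2 \<inter> T p \<inter> U) \<inter> \<Phi> ` (S2 \<inter> T q \<inter> V)"
    have "openin (top_of_set S2) ?O" using op pq UV by (intro openin_Int) auto
    moreover have "y \<in> ?O" using pq UV T by blast
    moreover have "?O \<subseteq> D"
    proof
      fix w assume "w \<in> ?O"
      then obtain a b where ab: "a \<in> S2" "a \<in> U" "w = \<Phi> a" "b \<in> S2" "b \<in> V" "w = \<Phi> b" by blast
      then have "(a, b) \<in> P" using P UV(5) by auto
      then show "w \<in> D" using ab(3) by (force simp: D_def)
    qed
    ultimately show "\<exists>T. openin (top_of_set S2) T \<and> y \<in> T \<and> T \<subseteq> D" by blast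
  qed
  have "continuous_on S2 (\<lambda>x. norm (F x))" by (intro continuous_intros contF)
  then obtain p0 where p0: "p0 \<in> S2" "\<And>y. y \<in> S2 \<Longrightarrow> norm (F y) \<le> norm (F p0)"
    using continuous_attains_sup[of S2 "\<lambda>x. norm (F x)"] by auto
  have "\<Phi> p0 \<notin> D"
  proof
    assume "\<Phi> p0 \<in> D"
    then obtain z where "z \<in> P" "\<Phi> p0 = \<Phi> (fst z)" by (auto simp: D_def)
    moreover obtain p q where "z = (p, q)" by fastforce
    ultimately have pq: "p \<in> S2" "q \<in> S2" "p \<noteq> q" "\<Phi> p = \<Phi> p0" "\<Phi> q = \<Phi> p0" using P by auto
    then show False
      using fibre_of_farthest_point[OF p0, of p] fibre_of_farthest_point[OF p0, of q] \<Phi>F p0(1) by metis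
  qed
  moreover have "\<Phi> p0 \<in> S2" using \<Phi>S p0(1) by blast
  ultimately have "D = {}" using clD opD conS connected_clopen[of S2] by blast
  then have "P = {}" by (simp add: D_def)
  then have "inj_on \<Phi> S2" using P by (meson empty_iff inj_onI)
  then show "inj_on F S2" using inj\<Phi> by blast
qed

end

section \<open>From charts to the sphere\<close>

lemma higher_differentiable_on_cong:
  fixes f g :: "'a::real_normed_vector \<Rightarrow> 'b::real_normed_vector"
  assumes "open W" "\<And>x. x \<in> W \<Longrightarrow> f x = g x" "higher_differentiable_on W f k"
  shows "higher_differentiable_on W g k"
  using assms(2,3)
proof (induction k arbitrary: f g)
  case 0
  then show ?case by (simp cong: continuous_on_cong)
next
  case (Suc k)
  have D: "(g has_derivative frechet_derivative f (at x)) (at x)" if "x \<in> W" for x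
  proof -
    have "(f has_derivative frechet_derivative f (at x)) (at x)"
      using Suc.prems(2) that by (simp add: frechet_derivative_works)
    then show ?thesis
      by (rule has_derivative_transform_within_open[OF _ assms(1) that]) (use Suc.prems(1) in auto)
  qed
  then have eq: "frechet_derivative f (at x) v = frechet_derivative g (at x) v" if "x \<in> W" for x v
    using frechet_derivative_at that by metis
  have "higher_differentiable_on W (\<lambda>x. frechet_derivative g (at x) v) k" for v
    by (rule Suc.IH[of "\<lambda>x. frechet_derivative f (at x) v"]) (use Suc.prems(2) eq in auto)
  moreover have "g differentiable (at x)" if "x \<in> W" for x
    using D[OF that] by (auto simp: differentiable_def)
  ultimately show ?case by simp
qed

lemma smooth_on_inner:
  fixes f :: "'a::real_normed_vector \<Rightarrow> 'b::real_inner"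
  assumes "open W" "smooth_on W f"
  shows "smooth_on W (\<lambda>x. f x \<bullet> v)"
proof -
  have "higher_differentiable_on W (\<lambda>x. f x \<bullet> v) k" if "higher_differentiable_on W f k" for k
    using that
  proof (induction k arbitrary: f)
    case 0
    then show ?case by (auto intro: continuous_intros)
  next
    case (Suc k)
    have D: "((\<lambda>x. f x \<bullet> v) has_derivative (\<lambda>e. frechet_derivative f (at x) e \<bullet> v)) (at x)" if "x \<in> W" for x
      using Suc.prems that by (intro has_derivative_inner_left) (simp add: frechet_derivative_works)
    then have eq: "frechet_derivative (\<lambda>x. f x \<bullet> v) (at x) = (\<lambda>e. frechet_derivative f (at x) e \<bullet> v)" if "x \<in> W" for x
      using frechet_derivative_at that by metis
    have "higher_differentiable_on W (\<lambda>x. frechet_derivative (\<lambda>x. f x \<bullet> v) (at x) e) k" for e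
      by (rule higher_differentiable_on_cong[OF assms(1) _ Suc.IH[of "\<lambda>x. frechet_derivative f (at x) e"]])
         (use Suc.prems eq in auto)
    then show ?case using D by (auto simp: differentiable_def)
  qed
  then show ?thesis using assms(2) by (simp add: smooth_on_def)
qed

text \<open>\<open>A\<close> and \<open>B\<close> are the coordinate expressions of \<open>F\<close>
  and \<open>g\<close>. Smoothness is imposed on them alone, since the homeomorphism with the sphere
  is merely topological and \<open>F\<close>, \<open>g\<close> are only continuous as maps on the
  round sphere.\<close>

definition gauss_chart ::
    "(real^3 \<Rightarrow> real^3) \<Rightarrow> (real^3 \<Rightarrow> real^3) \<Rightarrow> (real^3) set \<Rightarrow> (real^2) set \<Rightarrow> (real^3 \<Rightarrow> real^2) \<Rightarrow>
     (real^2 \<Rightarrow> real^3) \<Rightarrow> (real^2 \<Rightarrow> real^3) \<Rightarrow> bool" where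
  "gauss_chart F g V W c A B \<longleftrightarrow>
     openin (top_of_set S2) V \<and> open W \<and> continuous_on V c \<and> inj_on c V \<and> c ` V = W \<and>
     smooth_on W A \<and> smooth_on W B \<and> (\<forall>y\<in>V. F y = A (c y) \<and> g y = B (c y)) \<and>
     (\<forall>w\<in>W. inj (frechet_derivative A (at w)) \<and> (\<forall>e. B w \<bullet> frechet_derivative A (at w) e = 0))"

lemma gauss_chart_preimage_open:
  assumes "gauss_chart F g V W c A B" "x \<in> V" "open T" "c x \<in> T"
  shows "\<exists>S. open S \<and> x \<in> S \<and> (\<forall>y \<in> S2 \<inter> S. y \<in> V \<and> c y \<in> T)"
proof -
  have "openin (top_of_set V) (V \<inter> c -` T)"
    using assms by (intro continuous_openin_preimage_gen) (auto simp: gauss_chart_def)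
  then have "openin (top_of_set S2) (V \<inter> c -` T)"
    using assms(1) openin_trans unfolding gauss_chart_def by blast
  then obtain S where "open S" "V \<inter> c -` T = S2 \<inter> S" by (auto simp: openin_open)
  then show ?thesis using assms(2,4) by blast
qed

section \<open>Local differential geometry in charts and its globalisation by compactness\<close>

locale gauss_atlas =
  fixes F g :: "real^3 \<Rightarrow> real^3"
  assumes charts: "x \<in> S2 \<Longrightarrow> \<exists>V W c A B. x \<in> V \<and> gauss_chart F g V W c A B"
    and norm_g: "x \<in> S2 \<Longrightarrow> norm (g x) = 1"
begin

lemma continuous_F_g: "continuous_on S2 F" "continuous_on S2 g"
proof -
  have "continuous (at x within S2) F \<and> continuous (at x within S2) g" if "x \<in> S2" for x
  proof -
    obtain V W c A B where x: "x \<in> V" and ch: "gauss_chart F g V W c A B" using charts[OF \<open>x \<in> S2\<close>] by blast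
    have cc: "continuous_on V c" "c ` V \<subseteq> W" "continuous_on W A" "continuous_on W B"
      "openin (top_of_set S2) V"
      using ch by (auto simp: gauss_chart_def smooth_on_imp_continuous_on)
    have "continuous_on V F" "continuous_on V g"
      using ch continuous_on_compose2[OF cc(3,1,2)] continuous_on_compose2[OF cc(4,1,2)]
      by (auto simp: gauss_chart_def cong: continuous_on_cong)
    moreover obtain T where T: "open T" "V = S2 \<inter> T" using cc(5) by (auto simp: openin_open)
    then have "at x within S2 = at x within V"
      using x by (intro at_within_nhd[of x T]) auto
    ultimately show ?thesis using x by (simp add: continuous_on_eq_continuous_within)
  qed
  then show "continuous_on S2 F" "continuous_on S2 g" by (auto simp: continuous_on_eq_continuous_within)
qed

text \<open>Kept general in \<open>G\<close> and \<open>H\<close> to serve twice: for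
  \<open>F\<close> with \<open>A\<close>, and for \<open>g\<close> with \<open>B\<close> at the
  points where \<open>B\<close> has an injective derivative.\<close>

lemma locally_injective_at:
  fixes G :: "real^2 \<Rightarrow> real^3"
  assumes ch: "gauss_chart F g V W c A B" and x: "x \<in> V" and G: "smooth_on W G" "inj (frechet_derivative G (at (c x)))"
    and H: "\<And>y. y \<in> V \<Longrightarrow> H y = G (c y)"
  shows "\<exists>N. openin (top_of_set S2) N \<and> x \<in> N \<and> inj_on H N"
proof -
  have W: "open W" "c x \<in> W" "inj_on c V" "V \<subseteq> S2"
    using ch x openin_imp_subset by (auto simp: gauss_chart_def)
  obtain r where r: "0 < r" "inj_on G (ball (c x) r)"
    using smooth_immersion_locally_injective[OF W(1) G(1) W(2) G(2)] by blast
  obtain S where S: "open S" "x \<in> S" "\<And>y. y \<in> S2 \<inter> S \<Longrightarrow> y \<in> V \<and> c y \<in> ball (c x) r"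
    using gauss_chart_preimage_open[OF ch x open_ball, of "c x" r] r(1) by auto
  have "inj_on H (S2 \<inter> S)"
  proof (rule inj_onI)
    fix y z assume yz: "y \<in> S2 \<inter> S" "z \<in> S2 \<inter> S" "H y = H z"
    then have "G (c y) = G (c z)" using H S(3) by metis
    then have "c y = c z" using inj_onD[OF r(2)] S(3)[OF yz(1)] S(3)[OF yz(2)] by blast
    then show "y = z" using inj_onD[OF W(3)] S(3)[OF yz(1)] S(3)[OF yz(2)] by blast
  qed
  then show ?thesis using S(1,2) x W(4) openin_open_Int by blast
qed

lemma locally_injective_F:
  assumes "x \<in> S2"
  shows "\<exists>N. openin (top_of_set S2) N \<and> x \<in> N \<and> inj_on F N"
proof -
  obtain V W c A B where x: "x \<in> V" and ch: "gauss_chart F g V W c A B" using charts[OF assms] by blast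
  have "c x \<in> W" using ch x by (auto simp: gauss_chart_def)
  then show ?thesis
    using ch by (intro locally_injective_at[OF ch x, of A]) (auto simp: gauss_chart_def)
qed

text \<open>At a maximum both \<open>v\<close> and \<open>g x\<close> are orthogonal to the two
  partial derivatives of \<open>A\<close>. These are independent because \<open>A\<close> is an
  immersion, which leaves a single direction.\<close>

lemma normal_at_max:
  assumes "x \<in> S2" "v \<noteq> 0" "\<And>y. y \<in> S2 \<Longrightarrow> F y \<bullet> v \<le> F x \<bullet> v"
  shows "\<exists>k. g x = k *\<^sub>R v"
proof -
  obtain V W c A B where x: "x \<in> V" and ch: "gauss_chart F g V W c A B" using charts[OF assms(1)] by blast
  have W: "open W" "c x \<in> W" "smooth_on W A" "V \<subseteq> S2" "c ` V = W" "inj (frechet_derivative A (at (c x)))"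
    using ch x openin_imp_subset by (auto simp: gauss_chart_def)
  define d where "d = frechet_derivative A (at (c x))"
  have D: "(A has_derivative d) (at (c x))"
    unfolding d_def by (rule smooth_on_differentiable[OF W(3,2)])
  then have lin: "linear d" using has_derivative_linear by blast
  have "A w \<bullet> v \<le> A (c x) \<bullet> v" if w: "w \<in> W" for w
  proof -
    obtain y where "y \<in> V" "w = c y" using w W(5) by blast
    then show ?thesis using assms(3)[of y] ch x W(4) by (auto simp: gauss_chart_def)
  qed
  then have "(\<lambda>e. d e \<bullet> v) = (\<lambda>e. 0)"
    by (intro differential_zero_maxmin[OF W(2,1) has_derivative_inner_left[OF D]]) auto
  then have dv: "v \<bullet> d e = 0" for e by (metis inner_commute)
  have gd: "g x \<bullet> d e = 0" for e using ch x W(2) by (auto simp: gauss_chart_def d_def)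
  have "cross3 (d (axis 1 1)) (d (axis 2 1)) \<noteq> 0"
  proof
    assume "cross3 (d (axis 1 1)) (d (axis 2 1)) = 0"
    then consider "d (axis 1 1) = 0" | "d (axis 2 1) = 0" | k where "d (axis 2 1) = k *\<^sub>R d (axis 1 1)"
      by (auto simp: cross_eq_0 collinear_lemma)
    then have "\<exists>e. e \<noteq> 0 \<and> d e = 0"
    proof cases
      case 3
      let ?e = "axis 2 1 - k *\<^sub>R axis 1 1 :: real^2"
      have "d ?e = 0" using 3 by (simp add: linear_diff[OF lin] linear_scale[OF lin])
      moreover have "?e $ 2 = 1" by (simp add: axis_def)
      then have "?e \<noteq> 0" by (metis zero_index zero_neq_one)
      ultimately show ?thesis by blast
    qed (metis axis_eq_0_iff zero_neq_one)+
    then show False using W(6) linear_injective_0[OF lin] by (auto simp: d_def)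
  qed
  then show ?thesis
    using orthogonal_pair_unique_direction[of "d (axis 1 1)" "d (axis 2 1)" "g x" v] gd dv assms(2) by blast
qed

lemma finite_cover:
  assumes "\<And>x. x \<in> S2 \<Longrightarrow> \<exists>T. open T \<and> x \<in> T \<and> P T"
  obtains \<T> where "finite \<T>" "S2 \<subseteq> \<Union>\<T>" "\<And>T. T \<in> \<T> \<Longrightarrow> P T"
proof -
  note result = that
  have "S2 \<subseteq> \<Union>{T. open T \<and> P T}"
  proof
    fix x assume "x \<in> S2"
    then show "x \<in> \<Union>{T. open T \<and> P T}" using assms[of x] by auto
  qed
  then show thesis
  proof (rule compactE[OF compact_sphere])
    show "open B" if "B \<in> {T. open T \<and> P T}" for B using that by simp
    show thesis if "\<T> \<subseteq> {T. open T \<and> P T}" "finite \<T>" "S2 \<subseteq> \<Union>\<T>" for \<T>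
      using that by (intro result[of \<T>]) auto
  qed
qed

text \<open>Where \<open>v\<close> is normal, the coordinate height \<open>A w \<bullet> v\<close>
  has zero derivative. Closed discs in the charts provide the compact convex sets for
  \<open>negligible_critical_values\<close>, and finitely many chart neighbourhoods cover the
  sphere.\<close>

lemma negligible_heights:
  assumes C: "C \<subseteq> S2" "\<And>x. x \<in> C \<Longrightarrow> \<exists>k. g x = k *\<^sub>R v"
  shows "negligible ((\<lambda>x. F x \<bullet> v) ` C)"
proof -
  have "\<exists>T. open T \<and> x \<in> T \<and> negligible ((\<lambda>x. F x \<bullet> v) ` (C \<inter> T))" if "x \<in> S2" for x
  proof -
    obtain V W c A B where x: "x \<in> V" and ch: "gauss_chart F g V W c A B" using charts[OF \<open>x \<in> S2\<close>] by blast
    have W: "open W" "c x \<in> W" "smooth_on W A" using ch x by (auto simp: gauss_chart_def)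
    obtain r where r: "0 < r" "cball (c x) r \<subseteq> W" using W open_contains_cball by metis
    obtain S where S: "open S" "x \<in> S" "\<And>y. y \<in> S2 \<inter> S \<Longrightarrow> y \<in> V \<and> c y \<in> ball (c x) r"
      using gauss_chart_preimage_open[OF ch x open_ball, of "c x" r] r(1) by auto
    let ?Q = "{w \<in> cball (c x) r. \<forall>e. frechet_derivative (\<lambda>w. A w \<bullet> v) (at w) e = 0}"
    have "negligible ((\<lambda>w. A w \<bullet> v) ` ?Q)"
      by (rule negligible_critical_values[OF smooth_on_inner[OF W(1,3)] r(2)]) auto
    moreover have "(\<lambda>x. F x \<bullet> v) ` (C \<inter> S) \<subseteq> (\<lambda>w. A w \<bullet> v) ` ?Q"
    proof
      fix t assume "t \<in> (\<lambda>x. F x \<bullet> v) ` (C \<inter> S)"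
      then obtain y where y: "y \<in> C" "y \<in> S" "t = F y \<bullet> v" by blast
      then have yV: "y \<in> V" "c y \<in> ball (c x) r" "y \<in> S2" using S(3)[of y] C(1) by auto
      then have w: "c y \<in> W" using r(2) by auto
      obtain k where k: "g y = k *\<^sub>R v" using C(2) y(1) by blast
      then have "k \<noteq> 0" using norm_g[OF yV(3)] by auto
      have "frechet_derivative (\<lambda>w. A w \<bullet> v) (at (c y)) e = 0" for e
      proof -
        have "((\<lambda>w. A w \<bullet> v) has_derivative (\<lambda>e. frechet_derivative A (at (c y)) e \<bullet> v)) (at (c y))"
          by (intro has_derivative_inner_left smooth_on_differentiable[OF W(3) w])
        then have "frechet_derivative (\<lambda>w. A w \<bullet> v) (at (c y)) = (\<lambda>e. frechet_derivative A (at (c y)) e \<bullet> v)"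
          using frechet_derivative_at by metis
        moreover have "g y \<bullet> frechet_derivative A (at (c y)) e = 0"
          using ch yV(1) w by (auto simp: gauss_chart_def)
        ultimately show ?thesis using k \<open>k \<noteq> 0\<close> by (simp add: inner_commute)
      qed
      moreover have "t = A (c y) \<bullet> v" using ch yV(1) y(3) by (auto simp: gauss_chart_def)
      ultimately show "t \<in> (\<lambda>w. A w \<bullet> v) ` ?Q" using yV(2) by (intro image_eqI[of _ _ "c y"]) auto
    qed
    ultimately show ?thesis using S(1,2) negligible_subset by blast
  qed
  then obtain \<T> where T: "finite \<T>" "S2 \<subseteq> \<Union>\<T>" "\<And>T. T \<in> \<T> \<Longrightarrow> negligible ((\<lambda>x. F x \<bullet> v) ` (C \<inter> T))"
    using finite_cover[of "\<lambda>T. negligible ((\<lambda>x. F x \<bullet> v) ` (C \<inter> T))"] by blast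
  have "negligible (\<Union>T\<in>\<T>. (\<lambda>x. F x \<bullet> v) ` (C \<inter> T))" using T by (intro negligible_Union) auto
  moreover have "(\<lambda>x. F x \<bullet> v) ` C \<subseteq> (\<Union>T\<in>\<T>. (\<lambda>x. F x \<bullet> v) ` (C \<inter> T))" using T(2) C(1) by blast
  ultimately show ?thesis using negligible_subset by blast
qed

text \<open>The heights form a connected set of reals of measure zero, hence at most one
  point.\<close>

lemma height_constant:
  assumes C: "C \<subseteq> S2" "connected C" "\<And>x. x \<in> C \<Longrightarrow> \<exists>k. g x = k *\<^sub>R v" and xy: "x \<in> C" "y \<in> C"
  shows "F x \<bullet> v = F y \<bullet> v"
proof -
  let ?H = "(\<lambda>x. F x \<bullet> v) ` C"
  have "continuous_on C (\<lambda>x. F x \<bullet> v)"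
    by (intro continuous_intros continuous_on_subset[OF continuous_F_g(1) C(1)])
  then have con: "connected ?H" using C(2) connected_continuous_image by blast
  have "\<not> a < b" if "a \<in> ?H" "b \<in> ?H" for a b
  proof
    assume "a < b"
    have "{a..b} \<subseteq> ?H" using connected_contains_Icc[OF con that] .
    then have "negligible (cbox a b)"
      using negligible_heights[OF C(1,3)] negligible_subset by (metis box_real(2))
    then show False using \<open>a < b\<close> negligible_interval(1)[of a b] by (simp add: box_real)
  qed
  then show ?thesis using xy by (metis image_eqI linorder_neqE)
qed

text \<open>If \<open>g\<close> fails to be locally injective at a point over a multiple of
  \<open>v\<close>, then \<open>v\<close> lies in the cone over the critical values of some
  \<open>B\<close>. Finitely many such cones have measure zero and cannot cover
  \<open>U\<close>.\<close>

lemma generic_locally_injective_g: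
  assumes U: "open U" "U \<noteq> {}"
  shows "\<exists>v\<in>U. v \<noteq> 0 \<and>
      (\<forall>p\<in>S2. (\<exists>k. g p = k *\<^sub>R v) \<longrightarrow> (\<exists>N. openin (top_of_set S2) N \<and> p \<in> N \<and> inj_on g N))"
proof -
  define bad where "bad p \<longleftrightarrow> \<not> (\<exists>N. openin (top_of_set S2) N \<and> p \<in> N \<and> inj_on g N)" for p
  have "\<exists>T. open T \<and> x \<in> T \<and> negligible {k *\<^sub>R g p | k p. p \<in> S2 \<inter> T \<and> bad p}" if "x \<in> S2" for x
  proof -
    obtain V W c A B where x: "x \<in> V" and ch: "gauss_chart F g V W c A B" using charts[OF \<open>x \<in> S2\<close>] by blast
    obtain T where T: "open T" "V = S2 \<inter> T" using ch by (auto simp: gauss_chart_def openin_open)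
    have "{k *\<^sub>R g p | k p. p \<in> S2 \<inter> T \<and> bad p} \<subseteq>
        {k *\<^sub>R B w | k w. w \<in> W \<and> \<not> inj (frechet_derivative B (at w))}"
    proof clarify
      fix k p assume p: "p \<in> S2" "p \<in> T" "bad p"
      then have "p \<in> V" using T by simp
      moreover have "\<not> inj (frechet_derivative B (at (c p)))"
        using locally_injective_at[OF ch \<open>p \<in> V\<close>, of B g] ch p(3) by (auto simp: gauss_chart_def bad_def)
      ultimately show "\<exists>k' w. k *\<^sub>R g p = k' *\<^sub>R B w \<and> w \<in> W \<and> \<not> inj (frechet_derivative B (at w))"
        using ch by (auto simp: gauss_chart_def)
    qed
    moreover have "smooth_on W B" using ch by (simp add: gauss_chart_def)
    then have "negligible {k *\<^sub>R B w | k w. w \<in> W \<and> \<not> inj (frechet_derivative B (at w))}"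
      by (rule negligible_cone_over_critical_values)
    ultimately have "negligible {k *\<^sub>R g p | k p. p \<in> S2 \<inter> T \<and> bad p}"
      by (rule negligible_subset[rotated])
    moreover have "x \<in> T" using x T(2) by blast
    ultimately show ?thesis using T(1) by blast
  qed
  then obtain \<T> where T: "finite \<T>" "S2 \<subseteq> \<Union>\<T>"
      "\<And>T. T \<in> \<T> \<Longrightarrow> negligible {k *\<^sub>R g p | k p. p \<in> S2 \<inter> T \<and> bad p}"
    using finite_cover[of "\<lambda>T. negligible {k *\<^sub>R g p | k p. p \<in> S2 \<inter> T \<and> bad p}"] by blast
  \<comment> \<open>The point 0 is put into the exceptional set so that \<open>v\<close> comes out
    nonzero.\<close>
  define Z where "Z = {0} \<union> (\<Union>T\<in>\<T>. {k *\<^sub>R g p | k p. p \<in> S2 \<inter> T \<and> bad p})"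
  have "negligible Z" unfolding Z_def using T by (intro negligible_Un negligible_Union) auto
  then have "\<not> U \<subseteq> Z" using open_not_negligible[OF U] negligible_subset by blast
  then obtain v where v: "v \<in> U" "v \<notin> Z" by blast
  have "\<not> bad p" if p: "p \<in> S2" "g p = k *\<^sub>R v" for p k
  proof
    assume "bad p"
    have "k \<noteq> 0" using norm_g[OF p(1)] p(2) by auto
    then have "v = (1 / k) *\<^sub>R g p" using p(2) by simp
    moreover obtain T where "T \<in> \<T>" "p \<in> T" using p(1) T(2) by blast
    ultimately have "v \<in> Z" using p(1) \<open>bad p\<close> unfolding Z_def by blast
    then show False using v(2) by blast
  qed
  then have "\<forall>p\<in>S2. (\<exists>k. g p = k *\<^sub>R v) \<longrightarrow> (\<exists>N. openin (top_of_set S2) N \<and> p \<in> N \<and> inj_on g N)"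
    unfolding bad_def by blast
  moreover have "v \<noteq> 0" using v(2) by (auto simp: Z_def)
  ultimately show ?thesis using v(1) by blast
qed

end

section \<open>Transport of the charts of the manifold to the sphere\<close>

lemma chart_homeomorphism:
  assumes "chart_on X (U, \<phi>)"
  shows "openin X U" "open (\<phi> ` U)" "inj_on \<phi> U" "U \<subseteq> topspace X"
    "continuous_map (subtopology X U) (top_of_set (\<phi> ` U)) \<phi>"
proof -
  have ch: "openin X U" "open (\<phi> ` U)" "homeomorphic_map (subtopology X U) (top_of_set (\<phi> ` U)) \<phi>"
    using assms by (auto simp: chart_on_def)
  then show "U \<subseteq> topspace X" using openin_subset by blast
  then have "topspace (subtopology X U) = U" by (simp add: Int_absorb1)
  then show "inj_on \<phi> U" using homeomorphic_imp_injective_map[OF ch(3)] by simp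
  show "continuous_map (subtopology X U) (top_of_set (\<phi> ` U)) \<phi>"
    using homeomorphic_imp_continuous_map[OF ch(3)] .
qed (use assms in \<open>auto simp: chart_on_def\<close>)

lemma gauss_chart_of_chart:
  assumes M: "closed_oriented_manifold M \<A>" and f: "smooth_immersion \<A> f" and n: "gauss_map M \<A> f n"
    and hk: "homeomorphic_maps M (top_of_set S2) h k"
    and U: "(U, \<phi>) \<in> \<A>"
  shows "gauss_chart (f \<circ> k) (n \<circ> k) {x \<in> S2. k x \<in> U} (\<phi> ` U) (\<phi> \<circ> k) (f \<circ> inv_into U \<phi>) (n \<circ> inv_into U \<phi>)"
proof -
  have "chart_on M (U, \<phi>)"
    using M U by (auto simp: closed_oriented_manifold_def oriented_atlas_def smooth_atlas_def)
  note ch = chart_homeomorphism[OF this]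
  have k: "continuous_map (top_of_set S2) M k" "\<And>x. x \<in> S2 \<Longrightarrow> h (k x) = x"
    and h: "\<And>p. p \<in> topspace M \<Longrightarrow> h p \<in> S2 \<and> k (h p) = p"
    using hk by (auto simp: homeomorphic_maps_def continuous_map_def)
  let ?V = "{x \<in> S2. k x \<in> U}"
  have V: "openin (top_of_set S2) ?V"
    using openin_continuous_map_preimage[OF k(1) ch(1)] by simp
  have "continuous_map (top_of_set ?V) (subtopology M U) k"
  proof (rule continuous_map_into_subtopology)
    show "continuous_map (top_of_set ?V) M k"
      by (rule continuous_map_from_subtopology_mono[OF k(1)]) blast
  qed auto
  then have "continuous_map (top_of_set ?V) (top_of_set (\<phi> ` U)) (\<phi> \<circ> k)"
    using ch(5) continuous_map_compose by blast
  then have 1: "continuous_on ?V (\<phi> \<circ> k)" by (simp add: continuous_map_in_subtopology)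
  have injk: "inj_on k ?V" using k(2) by (metis (mono_tags, lifting) inj_onI mem_Collect_eq)
  moreover have "k ` ?V = U"
  proof (intro subset_antisym subsetI)
    fix p assume "p \<in> U"
    then show "p \<in> k ` ?V" using h[of p] ch(4) by (intro image_eqI[of _ _ "h p"]) auto
  qed auto
  ultimately have 2: "inj_on (\<phi> \<circ> k) ?V" "(\<phi> \<circ> k) ` ?V = \<phi> ` U"
    using ch(3) comp_inj_on[of k ?V \<phi>] image_comp[of \<phi> k ?V] by (simp_all only:)
  have "smooth_on (\<phi> ` U) (f \<circ> inv_into U \<phi>)" "smooth_on (\<phi> ` U) (n \<circ> inv_into U \<phi>)"
    "\<forall>w\<in>\<phi> ` U. inj (frechet_derivative (f \<circ> inv_into U \<phi>) (at w))"
    using f n U by (auto simp: smooth_immersion_def gauss_map_def smooth_map_def)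
  moreover have "(n \<circ> inv_into U \<phi>) w \<bullet> frechet_derivative (f \<circ> inv_into U \<phi>) (at w) e = 0"
    if w: "w \<in> \<phi> ` U" for w e
  proof -
    obtain p where p: "p \<in> U" "w = \<phi> p" using w by blast
    have "frechet_derivative (f \<circ> inv_into U \<phi>) (at (\<phi> p)) e \<in> tangent_image \<A> f p"
      using U p(1) unfolding tangent_image_def by blast
    then have "orthogonal (n p) (frechet_derivative (f \<circ> inv_into U \<phi>) (at (\<phi> p)) e)"
      using n p(1) ch(4) by (auto simp: gauss_map_def)
    then show ?thesis using p ch(3) by (simp add: orthogonal_def)
  qed
  ultimately show ?thesis
    using V ch(2,3) 1 2 by (auto simp: gauss_chart_def)
qed

theorem theorem1p3:
  fixes M :: "'a topology" and \<A> :: "('a, 2) chart set"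
    and f n :: "'a \<Rightarrow> real ^ 3"
  assumes "closed_oriented_manifold M \<A>"
    and "smooth_immersion \<A> f"
    and "gauss_map M \<A> f n"
    and "M homeomorphic_space top_of_set (sphere (0 :: real ^ 3) 1)"
    and "\<And>u :: real ^ 3. u \<in> sphere 0 1 \<Longrightarrow> connectedin M (shadow M n u)"
  shows "convex_embedding M f"
proof -
  obtain h k where hk: "homeomorphic_maps M (top_of_set S2) h k"
    using assms(4) by (auto simp: homeomorphic_space_def)
  have h: "continuous_map M (top_of_set S2) h" "\<And>p. p \<in> topspace M \<Longrightarrow> h p \<in> S2 \<and> k (h p) = p"
    and k: "\<And>x. x \<in> S2 \<Longrightarrow> k x \<in> topspace M \<and> h (k x) = x"
    using hk by (auto simp: homeomorphic_maps_def continuous_map_def)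
  define F where "F = f \<circ> k"
  define g where "g = n \<circ> k"
  have covers: "(\<Union>(U, \<phi>)\<in>\<A>. U) = topspace M"
    using assms(1) by (auto simp: closed_oriented_manifold_def oriented_atlas_def smooth_atlas_def)
  interpret ga: gauss_atlas F g
  proof
    show "norm (g x) = 1" if "x \<in> S2" for x
      using assms(3) k[OF that] by (auto simp: g_def gauss_map_def)
    fix x assume x: "x \<in> S2"
    then obtain U \<phi> where U: "(U, \<phi>) \<in> \<A>" "k x \<in> U" using k[OF x] covers by blast
    have "x \<in> {x \<in> S2. k x \<in> U}" using x U(2) by simp
    then show "\<exists>V W c A B. x \<in> V \<and> gauss_chart F g V W c A B"
      using gauss_chart_of_chart[OF assms(1-3) hk U(1)] unfolding F_def g_def by (intro exI conjI)
  qed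
  have shadows: "connected {x \<in> S2. 0 < g x \<bullet> u}" for u
  \<comment> \<open>The assumption speaks of unit vectors only: normalising \<open>u\<close> does
    not change its shadow, and the null vector has an empty one.\<close>
  proof (cases "u = 0")
    case False
    let ?u = "u /\<^sub>R norm u"
    have "connectedin (top_of_set S2) (h ` shadow M n ?u)"
      using False by (intro connectedin_continuous_map_image[OF h(1)] assms(5)) simp
    moreover have "h ` shadow M n ?u = {x \<in> S2. 0 < g x \<bullet> u}"
    proof (intro subset_antisym subsetI)
      fix x assume "x \<in> h ` shadow M n ?u"
      then obtain p where "p \<in> topspace M" "0 < n p \<bullet> ?u" "x = h p" by (auto simp: shadow_def)
      then show "x \<in> {x \<in> S2. 0 < g x \<bullet> u}"
        using h(2)[of p] False by (simp add: g_def zero_less_mult_iff)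
    next
      fix x assume "x \<in> {x \<in> S2. 0 < g x \<bullet> u}"
      then have "x \<in> S2" "0 < n (k x) \<bullet> ?u" using False by (auto simp: g_def)
      then show "x \<in> h ` shadow M n ?u"
        using k[of x] by (intro image_eqI[of _ _ "k x"]) (auto simp: shadow_def)
    qed
    ultimately show ?thesis by (simp add: connectedin_subtopology)
  qed simp
  interpret gauss_immersion g F
    by (unfold_locales; rule ga.continuous_F_g ga.norm_g shadows ga.locally_injective_F ga.normal_at_max
        ga.height_constant ga.generic_locally_injective_g; assumption)
  have "F ` S2 = f ` topspace M"
  proof (intro subset_antisym subsetI)
    fix y assume "y \<in> f ` topspace M"
    then obtain p where "p \<in> topspace M" "y = f p" by blast
    then show "y \<in> F ` S2" using h(2)[of p] by (intro image_eqI[of _ _ "h p"]) (auto simp: F_def)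
  qed (use k in \<open>auto simp: F_def\<close>)
  define K where "K = convex hull (F ` S2)"
  have FK: "F ` S2 = frontier K" "convex_body K" using frontier_hull by (simp_all add: K_def)
  have "homeomorphic_map M (top_of_set (frontier K)) f"
  proof (rule continuous_imp_homeomorphic_map)
    show "compact_space M" using assms(1) by (simp add: closed_oriented_manifold_def)
    have "continuous_map (top_of_set S2) (top_of_set (frontier K)) F"
      using ga.continuous_F_g(1) FK(1) by (auto simp: continuous_map_in_subtopology)
    then have "continuous_map M (top_of_set (frontier K)) (F \<circ> h)"
      using h(1) continuous_map_compose by blast
    then show "continuous_map M (top_of_set (frontier K)) f"
      by (rule continuous_map_eq) (use h(2) in \<open>auto simp: F_def\<close>)
    show "f ` topspace M = topspace (top_of_set (frontier K))"
      using \<open>F ` S2 = f ` topspace M\<close> FK(1) by simp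
    show "inj_on f (topspace M)"
    proof (rule inj_onI)
      fix p q assume "p \<in> topspace M" "q \<in> topspace M" "f p = f q"
      then have "F (h p) = F (h q)" "h p \<in> S2" "h q \<in> S2" using h(2) by (auto simp: F_def)
      then have "h p = h q" using frontier_hull(1) inj_onD by metis
      then show "p = q" using h(2) \<open>p \<in> topspace M\<close> \<open>q \<in> topspace M\<close> by metis
    qed
  qed (simp add: Hausdorff_space_subtopology)
  then show ?thesis using FK(2) by (auto simp: convex_embedding_def)
qed

end
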